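(* In each of the following two cases there is a $\mathbb{C}[z,z^{-1}]$-valued degree-preserving linear transformation (that is, a linear map $U:H_{hyb}\to H_{GW}\otimes\mathbb{C}[z,z^{-1}]$, extended linearly in $z$, preserving degree where $\deg z=2$) mapping $I_{hyb}(t,z)$ to the analytic continuation of $I_{GW}(q,z)$ near $t=0$, where $q=\psi^{-1}$. (Cubic case.) $\psi=e^{3t}$, $$I_{hyb}(t,z)=\sum_{\substack{d\ge 0\\ d\not\equiv -1 \bmod 3}}\frac{z\,e^{(d+1+\frac{H^{(d+1)}}{z})t}}{3^{6\lfloor d/3\rfloor}}\;\frac{\prod_{1\le b\le d,\ b\equiv d+1 \bmod 3}(H^{(d+1)}+bz)^4}{\prod_{1\le b\le d,\ b\not\equiv d+1 \bmod 3}(H^{(d+1)}+bz)^2},$$ and $I_{GW}$ is the $I$-function of the complete intersection $X_{3,3}\subset\mathbb{P}^5$ of two cubics. (Quadric case.) $\psi=e^{2t}$, $$I_{hyb}(t,z)=\sum_{\substack{d\ge 0\\ d\not\equiv -1 \bmod 2}}\frac{z\,e^{(d+1+\frac{H^{(d+1)}}{z})t}}{2^{8\lfloor d/2\rfloor}}\;\frac{\prod_{1\le b\le d,\ b\equiv d+1 \bmod 2}(H^{(d+1)}+bz)^4}{\prod_{1\le b\le d,\ b\not\equiv d+1 \bmod 2}(H^{(d+1)}+bz)^4},$$ and $I_{GW}$ is the $I$-function of the complete intersection $X_{2,2,2,2}\subset\mathbb{P}^7$ of four quadrics.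
   Context: Hybrid side: in the cubic case $H_{hyb}=H^*_1(\mathbb{P}^1)\oplus H^*_2(\mathbb{P}^1)$, two copies of $H^*(\mathbb{P}^1;\mathbb{C})$ with basis $1^{(1)},H^{(1)},1^{(2)},H^{(2)}$ of degrees $0,2,4,6$ respectively. In the quadric case $H_{hyb}=H^*_1(\mathbb{P}^3)$, a copy of $H^*(\mathbb{P}^3;\mathbb{C})$ with basis $1^{(1)},H^{(1)},(H^{(1)})^2,(H^{(1)})^3$ of degrees $0,2,4,6$. (These are the narrow parts of the hybrid state spaces, in which $I_{hyb}$ takes values.) Indices $h$ of $H^{(h)}$ are taken mod $3$ (resp. mod $2$), and $g(H^{(h)})$ means the copy in the summand $h$ of $g(H)$, $H$ the hyperplane class. Gromov-Witten side: $H_{GW}=\bigoplus_{h=0}^3\mathbb{C}\,H^h=H^{even}(X;\mathbb{C})$, where $H$ is the restriction to $X$ of the hyperplane class, so $H^4=0$ and $\deg H^h=2h$. Givental's $I$-functions are $$I_{GW}(q,z)=z\,e^{\frac{H\log q}{z}}\sum_{d\ge0}q^d\frac{\prod_{b=1}^{3d}(3H+bz)^2}{\prod_{b=1}^{d}(H+bz)^6}\quad\text{for }X_{3,3},$$ $$I_{GW}(q,z)=z\,e^{\frac{H\log q}{z}}\sum_{d\ge0}q^d\frac{\prod_{b=1}^{2d}(2H+bz)^4}{\prod_{b=1}^{d}(H+bz)^8}\quad\text{for }X_{2,2,2,2}.$$ These converge for small $|q|$; the analytic continuation is taken to the $\psi$-coordinate patch ($\psi=q^{-1}$, region around $\psi=1$,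 i.e. $t=0$), along a chosen path avoiding the singular points of the differential equation satisfied by $I_{GW}$. For $X_{3,3}$ this equation is $[D_q^4-3^6q(D_q+\frac13)^2(D_q+\frac23)^2]I_{GW}=0$ and for $X_{2,2,2,2}$ it is $[D_q^4-2^8q(D_q+\frac12)^4]I_{GW}=0$, with $D_q=q\frac{\partial}{\partial q}$. *)

theory Defs
  imports
    "HOL-Complex_Analysis.Complex_Analysis"
    "HOL-Library.Poly_Mapping"
    "HOL-Number_Theory.Cong"
begin

section \<open>State spaces\<close>

text \<open>Basis \<open>1, H, H^2, H^3\<close> of \<open>H^*(P^3)\<close>, and likewise of the even cohomology of a
  complete intersection threefold.\<close>

datatype hpow = Pow0 | Pow1 | Pow2 | Pow3

primrec hexp :: "hpow \<Rightarrow> nat" where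
  "hexp Pow0 = 0"
| "hexp Pow1 = 1"
| "hexp Pow2 = 2"
| "hexp Pow3 = 3"

lemma UNIV_hpow: "UNIV = {Pow0, Pow1, Pow2, Pow3}"
  by (auto intro: hpow.exhaust)

instance hpow :: finite
  by standard (simp add: UNIV_hpow)

definition hpow_deg :: "hpow \<Rightarrow> int" where
  "hpow_deg h = 2 * int (hexp h)"

text \<open>Basis \<open>1^(1), H^(1), 1^(2), H^(2)\<close> of two copies of \<open>H^*(P^1)\<close>. The grading is shifted
  by 4 on the second copy.\<close>

datatype cubic_basis = One1 | Hyp1 | One2 | Hyp2

primrec cubic_sector :: "cubic_basis \<Rightarrow> nat" where
  "cubic_sector One1 = 1"
| "cubic_sector Hyp1 = 1"
| "cubic_sector One2 = 2"
| "cubic_sector Hyp2 = 2"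

primrec cubic_exp :: "cubic_basis \<Rightarrow> nat" where
  "cubic_exp One1 = 0"
| "cubic_exp Hyp1 = 1"
| "cubic_exp One2 = 0"
| "cubic_exp Hyp2 = 1"

primrec cubic_deg :: "cubic_basis \<Rightarrow> int" where
  "cubic_deg One1 = 0"
| "cubic_deg Hyp1 = 2"
| "cubic_deg One2 = 4"
| "cubic_deg Hyp2 = 6"

lemma UNIV_cubic_basis: "UNIV = {One1, Hyp1, One2, Hyp2}"
  by (auto intro: cubic_basis.exhaust)

instance cubic_basis :: finite
  by standard (simp add: UNIV_cubic_basis)

type_synonym H_hyb_cubic = "complex ^ cubic_basis"
type_synonym H_hyb_quadric = "complex ^ hpow"
type_synonym H_GW = "complex ^ hpow"

text \<open>Laurent polynomials in \<open>z\<close> are the group ring of the integers: \<open>Poly_Mapping.single k c\<close>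
  is \<open>c z^k\<close>.\<close>

type_synonym laurent = "int \<Rightarrow>\<^sub>0 complex"
type_synonym H_GW_laurent = "laurent ^ hpow"

definition laurent_scale :: "complex \<Rightarrow> H_GW_laurent \<Rightarrow> H_GW_laurent" where
  "laurent_scale c w = Poly_Mapping.single 0 c *s w"

definition laurent_eval :: "complex \<Rightarrow> laurent \<Rightarrow> complex" where
  "laurent_eval z p = (\<Sum>k\<in>Poly_Mapping.keys p. Poly_Mapping.lookup p k * z powi k)"

text \<open>For \<open>z \<noteq> 0\<close> the map \<open>v \<mapsto> eval_at z (U v)\<close> is the value at \<open>z\<close> of the \<open>z\<close>-linear
  extension of \<open>U\<close>.\<close>

definition eval_at :: "complex \<Rightarrow> H_GW_laurent \<Rightarrow> H_GW" where
  "eval_at z w = (\<chi> h. laurent_eval z (w $ h))"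

definition homogeneous :: "('b::finite \<Rightarrow> int) \<Rightarrow> int \<Rightarrow> complex ^ 'b \<Rightarrow> bool" where
  "homogeneous deg e v \<longleftrightarrow> (\<forall>i. v $ i \<noteq> 0 \<longrightarrow> deg i = e)"

definition laurent_homogeneous :: "int \<Rightarrow> H_GW_laurent \<Rightarrow> bool" where
  "laurent_homogeneous e w \<longleftrightarrow>
     (\<forall>h k. Poly_Mapping.lookup (w $ h) k \<noteq> 0 \<longrightarrow> hpow_deg h + 2 * k = e)"

definition degree_preserving_linear ::
  "('b::finite \<Rightarrow> int) \<Rightarrow> (complex ^ 'b \<Rightarrow> H_GW_laurent) \<Rightarrow> bool" where
  "degree_preserving_linear deg U \<longleftrightarrow>
     Vector_Spaces.linear (*s) laurent_scale U \<and>
     (\<forall>e v. homogeneous deg e v \<longrightarrow> laurent_homogeneous e (U v))"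

section \<open>I-functions\<close>

text \<open>For \<open>z \<noteq> 0\<close>, an expression in the hyperplane class is computed as a formal power series in
  \<open>H = fps_X\<close>, where the factors \<open>H + b z\<close> with \<open>b \<ge> 1\<close> are units; its class modulo \<open>H^n\<close> is read
  off from the coefficients below \<open>n\<close>.\<close>

definition lin :: "complex \<Rightarrow> nat \<Rightarrow> complex \<Rightarrow> complex fps" where
  "lin c b z = fps_const c * fps_X + fps_const (of_nat b * z)"

definition cubic_GW_coeff :: "nat \<Rightarrow> complex \<Rightarrow> complex fps" where
  "cubic_GW_coeff d z = (\<Prod>b=1..3*d. (lin 3 b z)^2) / (\<Prod>b=1..d. (lin 1 b z)^6)"

text \<open>The argument \<open>lg\<close> is the branch of \<open>log q\<close>.\<close>

definition cubic_I_GW :: "(complex \<Rightarrow> complex) \<Rightarrow> complex \<Rightarrow> complex \<Rightarrow> H_GW" where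
  "cubic_I_GW lg q z = (\<chi> h. fps_nth
     (fps_const z * fps_exp (lg q / z) *
       Abs_fps (\<lambda>n. suminf (\<lambda>d. q^d * fps_nth (cubic_GW_coeff d z) n))) (hexp h))"

definition quadric_GW_coeff :: "nat \<Rightarrow> complex \<Rightarrow> complex fps" where
  "quadric_GW_coeff d z = (\<Prod>b=1..2*d. (lin 2 b z)^4) / (\<Prod>b=1..d. (lin 1 b z)^8)"

definition quadric_I_GW :: "(complex \<Rightarrow> complex) \<Rightarrow> complex \<Rightarrow> complex \<Rightarrow> H_GW" where
  "quadric_I_GW lg q z = (\<chi> h. fps_nth
     (fps_const z * fps_exp (lg q / z) *
       Abs_fps (\<lambda>n. suminf (\<lambda>d. q^d * fps_nth (quadric_GW_coeff d z) n))) (hexp h))"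

definition cubic_hyb_term :: "nat \<Rightarrow> complex \<Rightarrow> complex \<Rightarrow> complex fps" where
  "cubic_hyb_term d t z =
     fps_const (z * exp (of_nat (d + 1) * t) / 3^(6 * (d div 3))) * fps_exp (t / z) *
     ((\<Prod>b\<in>{b\<in>{1..d}. [b = d + 1] (mod 3)}. (lin 1 b z)^4) /
      (\<Prod>b\<in>{b\<in>{1..d}. \<not> [b = d + 1] (mod 3)}. (lin 1 b z)^2))"

text \<open>The \<open>d\<close>-th term lies in the copy of \<open>H^*(P^1)\<close> with index \<open>d + 1\<close> modulo 3; as the sectors
  are 1 and 2, the terms with \<open>d\<close> congruent to \<open>-1\<close> do not occur.\<close>

definition cubic_I_hyb :: "complex \<Rightarrow> complex \<Rightarrow> H_hyb_cubic" where
  "cubic_I_hyb t z = (\<chi> i. suminf (\<lambda>d.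
     if [d + 1 = cubic_sector i] (mod 3) then fps_nth (cubic_hyb_term d t z) (cubic_exp i) else 0))"

definition quadric_hyb_term :: "nat \<Rightarrow> complex \<Rightarrow> complex \<Rightarrow> complex fps" where
  "quadric_hyb_term d t z =
     fps_const (z * exp (of_nat (d + 1) * t) / 2^(8 * (d div 2))) * fps_exp (t / z) *
     ((\<Prod>b\<in>{b\<in>{1..d}. [b = d + 1] (mod 2)}. (lin 1 b z)^4) /
      (\<Prod>b\<in>{b\<in>{1..d}. \<not> [b = d + 1] (mod 2)}. (lin 1 b z)^4))"

definition quadric_I_hyb :: "complex \<Rightarrow> complex \<Rightarrow> H_hyb_quadric" where
  "quadric_I_hyb t z = (\<chi> i. suminf (\<lambda>d.
     if [d + 1 = 1] (mod 2) then fps_nth (quadric_hyb_term d t z) (hexp i) else 0))"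

section \<open>Analytic continuation\<close>

text \<open>The germ of \<open>g\<close> at the end point of \<open>\<gamma>\<close> is obtained from the germ of \<open>f\<close> at its starting
  point by a chain of function elements \<open>(F s, D s)\<close> along \<open>\<gamma>\<close>.\<close>

definition continuation_along ::
  "(real \<Rightarrow> complex) \<Rightarrow> (complex \<Rightarrow> complex) \<Rightarrow> (complex \<Rightarrow> complex) \<Rightarrow> bool" where
  "continuation_along \<gamma> f g \<longleftrightarrow>
     (\<exists>F D. (\<forall>s\<in>{0..1}. open (D s) \<and> connected (D s) \<and> \<gamma> s \<in> D s \<and> F s holomorphic_on D s) \<and>
       (\<forall>s\<in>{0..1}. \<exists>\<delta>>0. \<forall>s'\<in>{0..1}. \<bar>s' - s\<bar> < \<delta> \<longrightarrow>
          \<gamma> s' \<in> D s \<and> (\<forall>\<^sub>F q in nhds (\<gamma> s'). F s' q = F s q)) \<and>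
       (\<forall>\<^sub>F q in nhds (pathstart \<gamma>). F 0 q = f q) \<and>
       (\<forall>\<^sub>F q in nhds (pathfinish \<gamma>). F 1 q = g q))"

definition continuation_along_vec ::
  "(real \<Rightarrow> complex) \<Rightarrow> (complex \<Rightarrow> H_GW) \<Rightarrow> (complex \<Rightarrow> H_GW) \<Rightarrow> bool" where
  "continuation_along_vec \<gamma> f g \<longleftrightarrow>
     (\<forall>h. continuation_along \<gamma> (\<lambda>q. f q $ h) (\<lambda>q. g q $ h))"

definition log_branch_at :: "(complex \<Rightarrow> complex) \<Rightarrow> complex \<Rightarrow> bool" where
  "log_branch_at lg q0 \<longleftrightarrow> lg analytic_on {q0} \<and> (\<forall>\<^sub>F q in nhds q0. exp (lg q) = q)"

text \<open>The differential equation \<open>D^4 - 3^6 q (D + 1/3)^2 (D + 2/3)^2\<close> (respectively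
  \<open>D^4 - 2^8 q (D + 1/2)^4\<close>) has leading coefficient \<open>1 - 3^6 q\<close> (respectively \<open>1 - 2^8 q\<close>) in
  \<open>D = q d/dq\<close>, so its finite singular points are 0 and \<open>\<rho> = 3^(-6)\<close> (respectively \<open>2^(-8)\<close>); the
  I-function series converge for \<open>0 < |q| < \<rho>\<close>. The end point \<open>q = 1\<close> corresponds to \<open>t = 0\<close>.\<close>

definition continuation_path :: "real \<Rightarrow> (real \<Rightarrow> complex) \<Rightarrow> bool" where
  "continuation_path \<rho> \<gamma> \<longleftrightarrow>
     path \<gamma> \<and> cmod (pathstart \<gamma>) < \<rho> \<and> pathfinish \<gamma> = 1 \<and>
     path_image \<gamma> \<inter> {0, complex_of_real \<rho>} = {}"

end

theory Submission
  imports Defs "HOL-Real_Asymp.Real_Asymp"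
begin

text \<open>Both I-functions are generating functions of the solutions of one and the same differential
equation of order four in \<open>q\<close>: the Gromov-Witten I-function is its Frobenius basis at the singular
point \<open>q = 0\<close>, the hybrid I-function its Frobenius basis at \<open>q = \<infinity>\<close>. In the notation
\<open>D = q d/dq\<close> the equation is \<open>D^4 y = q b(D) y\<close>, where \<open>b(s)\<close> is \<open>9 (3s + 1)^2 (3s + 2)^2\<close> for cubics
and \<open>16 (2s + 1)^4\<close> for quadrics. Solutions continue along every path that avoids the singular
points \<open>0\<close> and \<open>1 / b_4\<close> (\<open>ode_continuation_along_path\<close>), and near \<open>q = 1\<close> the continued solution is a linear combination of the
four hybrid functions, because these are linearly independent and the solution space has
dimension four. The coefficients of this combination define the transformation.

Frobenius bases are handled by one device: an exponent \<open>a + X\<close> with a formal variable \<open>X\<close>. The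
series \<open>\<Sum>k. C_k(X) exp ((k + a + X) x)\<close>, with \<open>exp x = q\<close> or \<open>exp x = 1 / q\<close>, solves the equation modulo
a power of \<open>X\<close> if its coefficients satisfy a two-term recurrence and \<open>a\<close> is an indicial root of
that multiplicity (\<open>frobenius_series_ode\<close>), and it converges in the
expected disc because the truncated coefficient norm of \<open>C_k\<close> grows geometrically
(\<open>converges_below_ratio\<close>). For the I-functions \<open>X\<close> is the hyperplane class, up to a factor.
Independence at infinity comes from the growth of the four functions for \<open>x \<rightarrow> -\<infinity>\<close>: they are
products of different powers of \<open>x\<close> and \<open>exp x\<close> up to lower order terms
(\<open>frobenius_series_independent\<close>). These facts combine to \<open>frobenius_series_connection\<close>.

The dependence on \<open>z\<close> is pure homogeneity: replacing \<open>H\<close> by \<open>z H\<close> turns every factor \<open>c H + b z\<close>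
into \<open>z (c H + b)\<close>, so that each component of either I-function is a power of \<open>z\<close>, namely
\<open>z^(1 - deg / 2)\<close>, times a function that is independent of \<open>z\<close>. Hence connection coefficients found
at \<open>z = 1\<close>, multiplied by the powers of \<open>z\<close> that the degrees dictate, serve for all \<open>z\<close>, and the
resulting map preserves degrees (\<open>graded_map_degree_preserving\<close>).\<close>

section \<open>Linear differential equations in the complex domain\<close>

definition ode_solution ::
  "nat \<Rightarrow> (nat \<Rightarrow> nat \<Rightarrow> complex \<Rightarrow> complex) \<Rightarrow> (nat \<Rightarrow> complex \<Rightarrow> complex) \<Rightarrow> complex set \<Rightarrow> bool" where
  "ode_solution n A Y S \<longleftrightarrow>
     (\<forall>q\<in>S. \<forall>i<n. (Y i has_field_derivative (\<Sum>j<n. A i j q * Y j q)) (at q))"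

lemma ode_solution_subset: "ode_solution n A Y S \<Longrightarrow> T \<subseteq> S \<Longrightarrow> ode_solution n A Y T"
  by (auto simp: ode_solution_def)

lemma ode_solution_holomorphic:
  "ode_solution n A Y S \<Longrightarrow> open S \<Longrightarrow> i < n \<Longrightarrow> Y i holomorphic_on S"
  by (auto simp: ode_solution_def holomorphic_on_open)

lemma ode_solution_diff:
  assumes "ode_solution n A Y S" "ode_solution n A Z S"
  shows "ode_solution n A (\<lambda>i q. Y i q - Z i q) S"
  using assms unfolding ode_solution_def
  by (auto simp: right_diff_distrib sum_subtractf intro!: derivative_eq_intros)

lemma ode_solution_linear_combination:
  assumes "\<And>k. k \<in> I \<Longrightarrow> ode_solution n A (Y k) S"
  shows "ode_solution n A (\<lambda>i q. \<Sum>k\<in>I. c k * Y k i q) S"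
  unfolding ode_solution_def
proof (intro ballI allI impI)
  fix q i assume qi: "q \<in> S" "i < n"
  have "((\<lambda>q. \<Sum>k\<in>I. c k * Y k i q) has_field_derivative
          (\<Sum>k\<in>I. c k * (\<Sum>j<n. A i j q * Y k j q))) (at q)"
    using assms qi unfolding ode_solution_def by (auto intro!: DERIV_sum DERIV_cmult)
  also have "(\<Sum>k\<in>I. c k * (\<Sum>j<n. A i j q * Y k j q)) = (\<Sum>j<n. A i j q * (\<Sum>k\<in>I. c k * Y k j q))"
    by (simp add: sum_distrib_left mult_ac) (rule sum.swap)
  finally show "((\<lambda>q. \<Sum>k\<in>I. c k * Y k i q) has_field_derivative \<dots>) (at q)" .
qed

lemma higher_deriv_sum:
  assumes "finite I" "\<And>i. i \<in> I \<Longrightarrow> f i holomorphic_on S" "open S" "z \<in> S"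
  shows "(deriv ^^ n) (\<lambda>w. \<Sum>i\<in>I. f i w) z = (\<Sum>i\<in>I. (deriv ^^ n) (f i) z)"
  using assms(1,2)
proof (induction rule: finite_induct)
  case (insert i I)
  have "(deriv ^^ n) (\<lambda>w. f i w + (\<Sum>j\<in>I. f j w)) z = (deriv ^^ n) (f i) z + (deriv ^^ n) (\<lambda>w. \<Sum>j\<in>I. f j w) z"
    by (rule higher_deriv_add[OF _ _ assms(3,4)]) (use insert in \<open>auto intro!: holomorphic_intros\<close>)
  then show ?case using insert by simp
qed simp

text \<open>The equation expresses the derivatives of order \<open>k + 1\<close> at \<open>c\<close> through those of order at most \<open>k\<close>,
by the Leibniz rule. So all derivatives at \<open>c\<close> vanish, and the identity theorem applies.\<close>

lemma ode_solution_unique: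
  assumes A: "\<And>i j. i < n \<Longrightarrow> j < n \<Longrightarrow> A i j holomorphic_on S"
    and S: "open S" "connected S" and Y: "ode_solution n A Y S" and c: "c \<in> S"
    and zero: "\<And>i. i < n \<Longrightarrow> Y i c = 0" and i: "i < n" and q: "q \<in> S"
  shows "Y i q = 0"
proof -
  note hol = ode_solution_holomorphic[OF Y S(1)]
  have "\<forall>i<n. (deriv ^^ k) (Y i) c = 0" for k
  proof (induction k rule: less_induct)
    case (less k)
    show ?case
    proof (intro allI impI)
      fix i assume i: "i < n"
      show "(deriv ^^ k) (Y i) c = 0"
      proof (cases k)
        case 0 then show ?thesis using zero i by simp
      next
        case (Suc l)
        have "\<forall>\<^sub>F w in nhds c. deriv (Y i) w = (\<Sum>j<n. A i j w * Y j w)"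
          using Y i by (intro eventually_nhds_in_open[OF S(1) c, THEN eventually_mono])
            (auto simp: ode_solution_def intro!: DERIV_imp_deriv)
        then have "(deriv ^^ l) (deriv (Y i)) c = (deriv ^^ l) (\<lambda>w. \<Sum>j<n. A i j w * Y j w) c"
          by (intro higher_deriv_cong_ev) auto
        also have "\<dots> = (\<Sum>j<n. (deriv ^^ l) (\<lambda>w. A i j w * Y j w) c)"
          using A hol i c by (intro higher_deriv_sum[OF _ _ S(1)]) (auto intro!: holomorphic_intros)
        also have "\<dots> = 0"
        proof (rule sum.neutral, intro ballI)
          fix j assume "j \<in> {..<n}"
          then have j: "j < n" by simp
          have "(deriv ^^ l) (\<lambda>w. A i j w * Y j w) c
            = (\<Sum>m = 0..l. of_nat (l choose m) * (deriv ^^ m) (A i j) c * (deriv ^^ (l - m)) (Y j) c)"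
            by (rule higher_deriv_mult[OF A[OF i j] hol[OF j] S(1) c])
          also have "\<dots> = 0" using less.IH j Suc by (intro sum.neutral) auto
          finally show "(deriv ^^ l) (\<lambda>w. A i j w * Y j w) c = 0" .
        qed
        finally show ?thesis using Suc by (simp add: funpow_Suc_right del: funpow.simps)
      qed
    qed
  qed
  then show ?thesis
    using i by (intro holomorphic_fun_eq_0_on_connected[OF hol[OF i] S _ c q]) auto
qed

text \<open>The solution is the Peano-Baker series of iterated primitives starting from the constant \<open>v\<close>. If the
absolute row sums of \<open>A\<close> are at most \<open>M\<close> and \<open>r \<le> 1 / (4 M)\<close>, every iteration gains a factor \<open>1 / 2\<close> on the disc,
as two of its points have distance less than \<open>2 r\<close>. The disc does not depend on the initial point
\<open>c\<close>; continuation along paths rests on this uniformity.\<close>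

lemma ode_local_existence:
  assumes S: "open S" "p \<in> S" and A: "\<And>i j. i < n \<Longrightarrow> j < n \<Longrightarrow> A i j holomorphic_on S"
  shows "\<exists>r>0. ball p r \<subseteq> S \<and>
    (\<forall>c\<in>ball p r. \<forall>v. \<exists>Y. ode_solution n A Y (ball p r) \<and> (\<forall>i<n. Y i c = v i))"
proof -
  obtain r0 where r0: "r0 > 0" "cball p r0 \<subseteq> S" using S open_contains_cball by blast
  have "continuous_on (cball p r0) (\<lambda>q. \<Sum>i<n. \<Sum>j<n. norm (A i j q))"
    using A r0(2) by (intro continuous_intros)
      (auto intro!: holomorphic_on_imp_continuous_on intro: holomorphic_on_subset)
  then have "bounded ((\<lambda>q. \<Sum>i<n. \<Sum>j<n. norm (A i j q)) ` cball p r0)"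
    by (intro compact_imp_bounded compact_continuous_image) auto
  then obtain M where M: "M > 0" "\<And>q. q \<in> cball p r0 \<Longrightarrow> norm (\<Sum>i<n. \<Sum>j<n. norm (A i j q)) \<le> M"
    unfolding bounded_pos by auto
  have M': "(\<Sum>j<n. norm (A i j q)) \<le> M" if "q \<in> cball p r0" "i < n" for i q
  proof -
    have "(\<Sum>j<n. norm (A i j q)) \<le> (\<Sum>i<n. \<Sum>j<n. norm (A i j q))"
      using that by (intro member_le_sum[where f = "\<lambda>i. \<Sum>j<n. norm (A i j q)"] sum_nonneg) auto
    then show ?thesis using M(2)[OF that(1)] unfolding real_norm_def by linarith
  qed
  define r where "r = min r0 (1 / (4 * M))"
  define B where "B = ball p r"
  have r: "r > 0" "4 * M * r \<le> 1" using r0 M by (auto simp: r_def min_def field_simps)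
  have BS: "B \<subseteq> S" and Bc: "B \<subseteq> cball p r0" using r0(2) by (auto simp: B_def r_def)
  have B: "open B" "convex B" by (auto simp: B_def)
  have "\<exists>Y. ode_solution n A Y B \<and> (\<forall>i<n. Y i c = v i)" if c: "c \<in> B" for c v
  proof -
    define V where "V = (\<Sum>i<n. norm (v i))"
    have V: "V \<ge> 0" "\<And>i. i < n \<Longrightarrow> norm (v i) \<le> V"
      unfolding V_def by (auto intro!: sum_nonneg member_le_sum[where f = "\<lambda>i. norm (v i)"])
    \<comment> \<open>\<open>P l\<close> is the estimate for the \<open>l\<close>-th iterate; \<open>Q\<close> relates an iterate to the next one.\<close>
    define P where "P = (\<lambda>l e. (l = 0 \<longrightarrow> e = (\<lambda>i q. v i)) \<and>
        (\<forall>i<n. e i holomorphic_on B \<and> (\<forall>q\<in>B. norm (e i q) \<le> V / 2 ^ l)))"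
    define Q where "Q = (\<lambda>e e'. \<forall>i<n. e' i c = 0 \<and>
        (\<forall>q\<in>B. (e' i has_field_derivative (\<Sum>j<n. A i j q * e j q)) (at q)))"
    have bound: "norm (\<Sum>j<n. A i j q * e j q) \<le> M * (V / 2 ^ l)" if "P l e" "i < n" "q \<in> B" for l e i q
    proof -
      have "norm (e j q) \<le> V / 2 ^ l" if "j < n" for j
        using \<open>P l e\<close> \<open>q \<in> B\<close> that by (simp add: P_def)
      then have "norm (\<Sum>j<n. A i j q * e j q) \<le> (\<Sum>j<n. norm (A i j q) * (V / 2 ^ l))"
        by (intro sum_norm_le) (metis lessThan_iff mult_left_mono norm_ge_zero norm_mult)
      also have "\<dots> \<le> M * (V / 2 ^ l)"
        unfolding sum_distrib_right[symmetric]
        using M'[of q i] that Bc V by (intro mult_right_mono) auto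
      finally show ?thesis .
    qed
    have "\<exists>e. \<forall>l. P l (e l) \<and> Q (e l) (e (Suc l))"
    proof (rule dependent_nat_choice)
      show "\<exists>e. P 0 e" using V by (intro exI[of _ "\<lambda>i q. v i"]) (auto simp: P_def)
    next
      fix e l assume e: "P l e"
      have "\<exists>f. f c = 0 \<and> (\<forall>q\<in>B. (f has_field_derivative (\<Sum>j<n. A i j q * e j q)) (at q))" if i: "i < n" for i
      proof -
        have "(\<lambda>q. \<Sum>j<n. A i j q * e j q) holomorphic_on B"
          using A[THEN holomorphic_on_subset, OF _ _ BS] e i
          by (intro holomorphic_intros) (auto simp: P_def)
        then obtain f where "\<And>q. q \<in> B \<Longrightarrow> (f has_field_derivative (\<Sum>j<n. A i j q * e j q)) (at q within B)"
          using holomorphic_convex_primitive'[OF B(2,1)] by blast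
        then have "\<forall>q\<in>B. ((\<lambda>q. f q - f c) has_field_derivative (\<Sum>j<n. A i j q * e j q)) (at q)"
          using B(1) by (auto simp: at_within_open[of _ B] intro!: derivative_eq_intros)
        then show ?thesis by (intro exI[of _ "\<lambda>q. f q - f c"]) auto
      qed
      then obtain e' where e': "Q e e'" unfolding Q_def by metis
      have "norm (e' i q) \<le> V / 2 ^ Suc l" if i: "i < n" and q: "q \<in> B" for i q
      proof -
        have "norm (e' i q - e' i c) \<le> M * (V / 2 ^ l) * norm (q - c)"
          using e' i bound[OF e i]
          by (intro field_differentiable_bound[OF B(2) _ _ q c]) (auto simp: Q_def intro: has_field_derivative_at_within)
        also have "norm (q - c) \<le> 2 * r"
          using q c norm_triangle_ineq4[of "q - p" "c - p"] by (auto simp: B_def dist_norm norm_minus_commute)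
        then have "M * (V / 2 ^ l) * norm (q - c) \<le> M * (V / 2 ^ l) * (2 * r)"
          using M V by (intro mult_left_mono) auto
        also have "\<dots> = (4 * M * r) * (V / 2 ^ Suc l)" by simp
        also have "\<dots> \<le> 1 * (V / 2 ^ Suc l)" using V r by (intro mult_right_mono) auto
        finally show ?thesis using e' i by (simp add: Q_def)
      qed
      moreover have "e' i holomorphic_on B" if "i < n" for i
        using e' that B(1) by (auto simp: Q_def holomorphic_on_open)
      ultimately show "\<exists>e'. P (Suc l) e' \<and> Q e e'" using e' by (auto simp: P_def)
    qed
    then obtain e where e: "\<And>l. P l (e l)" "\<And>l. Q (e l) (e (Suc l))" by blast
    have e0: "e 0 = (\<lambda>i q. v i)" using e(1)[of 0] by (simp add: P_def)
    define Y where "Y = (\<lambda>i q. suminf (\<lambda>l. e l i q))"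
    have sumV: "summable (\<lambda>l. V / 2 ^ l)"
      using summable_mult[OF summable_geometric[of "1/2::real"], of V] by (simp add: power_divide)
    have sms: "summable (\<lambda>l. e l i q)" if "i < n" "q \<in> B" for i q
      using e(1) that by (intro summable_comparison_test'[OF sumV, of 0]) (auto simp: P_def)
    define f' where "f' = (\<lambda>i l q. case l of 0 \<Rightarrow> 0 | Suc k \<Rightarrow> \<Sum>j<n. A i j q * e k j q)"
    have f': "(e l i has_field_derivative f' i l q) (at q)" if "i < n" "q \<in> B" for i l q
      using e(2) that e0 by (cases l) (auto simp: f'_def Q_def)
    have Yder: "(Y i has_field_derivative (\<Sum>j<n. A i j q * Y j q)) (at q)" if i: "i < n" and q: "q \<in> B" for i q
    proof -
      have "uniform_limit B (\<lambda>m x. \<Sum>l<m. f' i l x) (\<lambda>x. suminf (\<lambda>l. f' i l x)) sequentially"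
      proof (rule Weierstrass_m_test)
        show "norm (f' i l x) \<le> 2 * M * (V / 2 ^ l)" if "x \<in> B" for l x
          using bound[OF e(1) i that] M V by (cases l) (auto simp: f'_def)
        show "summable (\<lambda>l. 2 * M * (V / 2 ^ l))" by (intro summable_mult sumV)
      qed
      then have "((\<lambda>q. suminf (\<lambda>l. e l i q)) has_field_derivative suminf (\<lambda>l. f' i l q)) (at q)"
        using f' i q B sms[OF i q]
        by (intro has_field_derivative_series'(2)[OF B(2)])
           (auto intro: has_field_derivative_at_within simp: interior_open uniformly_convergent_on_def)
      moreover have "(\<lambda>l. f' i l q) sums (\<Sum>j<n. A i j q * Y j q)"
      proof -
        have "(\<lambda>k. \<Sum>j<n. A i j q * e k j q) sums (\<Sum>j<n. A i j q * Y j q)"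
          using sms q by (intro sums_sum sums_mult) (auto simp: Y_def)
        then have "(\<lambda>l. f' i (Suc l) q) sums (\<Sum>j<n. A i j q * Y j q)" by (simp add: f'_def)
        then show ?thesis by (subst (asm) sums_Suc_iff) (simp add: f'_def)
      qed
      ultimately show ?thesis by (simp add: Y_def sums_iff)
    qed
    have "Y i c = v i" if "i < n" for i
    proof -
      have "e l i c = 0" if "l > 0" for l
        using e(2)[of "l - 1"] \<open>i < n\<close> that by (simp add: Q_def)
      then have "Y i c = e 0 i c"
        using suminf_finite[of "{0}" "\<lambda>l. e l i c"] by (auto simp: Y_def)
      then show ?thesis by (simp add: e0)
    qed
    then show ?thesis using Yder by (auto simp: ode_solution_def)
  qed
  then show ?thesis using r BS by (intro exI[of _ r]) (auto simp: B_def)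
qed

section \<open>Continuation of solutions along a path\<close>

text \<open>The data of an analytic continuation over the initial segment \<open>[0, a]\<close> of a path, for all
components simultaneously. The function elements are required to be solutions, so that the chain
can be prolonged.\<close>

definition solution_chain ::
  "nat \<Rightarrow> (nat \<Rightarrow> nat \<Rightarrow> complex \<Rightarrow> complex) \<Rightarrow> (real \<Rightarrow> complex) \<Rightarrow> real \<Rightarrow>
   (real \<Rightarrow> nat \<Rightarrow> complex \<Rightarrow> complex) \<Rightarrow> (real \<Rightarrow> complex set) \<Rightarrow> bool" where
  "solution_chain n A \<gamma> a F D \<longleftrightarrow>
     (\<forall>s\<in>{0..a}. open (D s) \<and> connected (D s) \<and> \<gamma> s \<in> D s \<and> ode_solution n A (F s) (D s)) \<and>
     (\<forall>s\<in>{0..a}. \<exists>\<delta>>0. \<forall>s'\<in>{0..a}. \<bar>s' - s\<bar> < \<delta> \<longrightarrow>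
        \<gamma> s' \<in> D s \<and> (\<forall>i<n. \<forall>\<^sub>F q in nhds (\<gamma> s'). F s' i q = F s i q))"

text \<open>After \<open>a\<close> the chain continues with one and the same solution on \<open>B\<close>, the one that has the value of
the old chain at \<open>\<gamma> a\<close>. By uniqueness the old and the new solution agree on a ball around \<open>\<gamma> a\<close>,
which gives the compatibility of germs at the only critical parameter.\<close>

lemma solution_chain_extend:
  assumes chain: "solution_chain n A \<gamma> a F D" and ab: "0 \<le> a" "a \<le> b"
    and S: "open S" and A: "\<And>i j. i < n \<Longrightarrow> j < n \<Longrightarrow> A i j holomorphic_on S"
    and B: "open B" "connected B" "\<gamma> ` {a..b} \<subseteq> B" "B \<subseteq> S"
    and ex: "\<And>v. \<exists>Y. ode_solution n A Y B \<and> (\<forall>i<n. Y i (\<gamma> a) = v i)"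
    and cont: "continuous_on {0..b} \<gamma>"
  shows "\<exists>F' D'. solution_chain n A \<gamma> b F' D' \<and> F' 0 = F 0"
proof -
  have a: "a \<in> {0..a}" using ab by simp
  have B': "\<gamma> s \<in> B" if "a \<le> s" "s \<le> b" for s using B(3) that by auto
  obtain Y where Y: "ode_solution n A Y B" "\<And>i. i < n \<Longrightarrow> Y i (\<gamma> a) = F a i (\<gamma> a)"
    using ex by meson
  have Da: "open (D a)" "\<gamma> a \<in> D a" "ode_solution n A (F a) (D a)"
    using chain a by (auto simp: solution_chain_def)
  obtain e where e: "e > 0" "ball (\<gamma> a) e \<subseteq> D a \<inter> B"
    using Da B(1) B'[of a] ab openE[of "D a \<inter> B" "\<gamma> a"] by auto
  have eq: "Y i q = F a i q" if "i < n" "q \<in> ball (\<gamma> a) e" for i q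
  proof -
    have "ode_solution n A (\<lambda>i q. Y i q - F a i q) (ball (\<gamma> a) e)"
      using e by (intro ode_solution_diff ode_solution_subset[OF Y(1)] ode_solution_subset[OF Da(3)]) auto
    moreover have "A i j holomorphic_on ball (\<gamma> a) e" if "i < n" "j < n" for i j
      using e B(4) by (intro holomorphic_on_subset[OF A[OF that]]) auto
    ultimately have "Y i q - F a i q = 0"
      using Y(2) e(1) by (intro ode_solution_unique[OF _ open_ball _ _ _ _ that]) (auto intro: convex_connected)
    then show ?thesis by simp
  qed
  obtain \<delta>0 where \<delta>0: "\<delta>0 > 0" "\<And>s. s \<in> {0..b} \<Longrightarrow> \<bar>s - a\<bar> < \<delta>0 \<Longrightarrow> \<gamma> s \<in> ball (\<gamma> a) e"
  proof -
    have "a \<in> {0..b}" using ab by simp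
    then obtain d where "d > 0" "\<forall>s\<in>{0..b}. dist s a < d \<longrightarrow> dist (\<gamma> s) (\<gamma> a) < e"
      using cont e(1) unfolding continuous_on_iff by blast
    then show ?thesis by (intro that[of d]) (auto simp: dist_commute dist_real_def)
  qed
  define F' where "F' = (\<lambda>s. if s \<le> a then F s else Y)"
  define D' where "D' = (\<lambda>s. if s \<le> a then D s else B)"
  have "solution_chain n A \<gamma> b F' D'"
    unfolding solution_chain_def
  proof (intro conjI ballI)
    fix s assume s: "s \<in> {0..b}"
    show "open (D' s)" "connected (D' s)" "\<gamma> s \<in> D' s" "ode_solution n A (F' s) (D' s)"
      using chain s B B'[of s] Y unfolding solution_chain_def by (auto simp: F'_def D'_def)
    show "\<exists>\<delta>>0. \<forall>s'\<in>{0..b}. \<bar>s' - s\<bar> < \<delta> \<longrightarrow>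
        \<gamma> s' \<in> D' s \<and> (\<forall>i<n. \<forall>\<^sub>F q in nhds (\<gamma> s'). F' s' i q = F' s i q)"
    proof (cases "s \<le> a")
      case True
      then obtain \<delta> where \<delta>: "\<delta> > 0" "\<And>s'. s' \<in> {0..a} \<Longrightarrow> \<bar>s' - s\<bar> < \<delta> \<Longrightarrow>
          \<gamma> s' \<in> D s \<and> (\<forall>i<n. \<forall>\<^sub>F q in nhds (\<gamma> s'). F s' i q = F s i q)"
      proof -
        have "s \<in> {0..a}" using True s by simp
        then show ?thesis using chain that unfolding solution_chain_def by blast
      qed
      \<comment> \<open>Only for \<open>s = a\<close> does the neighbourhood of \<open>s\<close> reach beyond \<open>a\<close>.\<close>
      define \<delta>' where "\<delta>' = (if s = a then min \<delta> \<delta>0 else min \<delta> (a - s))"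
      have "\<delta>' > 0" using \<delta> \<delta>0 True by (auto simp: \<delta>'_def)
      moreover have "\<gamma> s' \<in> D' s \<and> (\<forall>i<n. \<forall>\<^sub>F q in nhds (\<gamma> s'). F' s' i q = F' s i q)"
        if s': "s' \<in> {0..b}" "\<bar>s' - s\<bar> < \<delta>'" for s'
      proof (cases "s' \<le> a")
        case True
        then show ?thesis using \<delta>(2)[of s'] s' \<open>s \<le> a\<close>
          by (auto simp: \<delta>'_def F'_def D'_def split: if_splits)
      next
        case False
        then have sa: "s = a" using s' \<open>s \<le> a\<close> by (auto simp: \<delta>'_def split: if_splits)
        then have ball: "\<gamma> s' \<in> ball (\<gamma> a) e" using s' \<delta>0(2)[of s'] by (auto simp: \<delta>'_def)
        then have "\<forall>\<^sub>F q in nhds (\<gamma> s'). q \<in> ball (\<gamma> a) e" by (intro eventually_nhds_in_open) auto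
        then have "\<forall>i<n. \<forall>\<^sub>F q in nhds (\<gamma> s'). F' s' i q = F' s i q"
          using eq False sa by (auto simp: F'_def elim!: eventually_mono)
        then show ?thesis using ball e sa by (auto simp: D'_def)
      qed
      ultimately show ?thesis by blast
    next
      case False
      then show ?thesis using B' s by (intro exI[of _ "s - a"]) (auto simp: F'_def D'_def)
    qed
  qed
  moreover have "F' 0 = F 0" using ab by (simp add: F'_def)
  ultimately show ?thesis by blast
qed

text \<open>Every parameter \<open>x\<close> has a neighbourhood that \<open>\<gamma>\<close> maps into a disc as in \<open>ode_local_existence\<close>, so a
chain over \<open>[0, a]\<close> extends to \<open>[0, b]\<close> whenever \<open>a \<le> x \<le> b\<close> are close together. The bisection
principle of Bolzano passes from short intervals to \<open>[0, 1]\<close>.\<close>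

lemma ode_continuation_along_path:
  assumes S: "open S" and A: "\<And>i j. i < n \<Longrightarrow> j < n \<Longrightarrow> A i j holomorphic_on S"
    and \<gamma>: "path \<gamma>" "path_image \<gamma> \<subseteq> S"
    and Y: "ode_solution n A Y U" "open U" "pathstart \<gamma> \<in> U"
  shows "\<exists>Z V. open V \<and> pathfinish \<gamma> \<in> V \<and> ode_solution n A Z V \<and>
    (\<forall>i<n. continuation_along \<gamma> (Y i) (Z i))"
proof -
  obtain e where e: "e > 0" "ball (\<gamma> 0) e \<subseteq> U"
    using Y(2,3) open_contains_ball[of U] by (auto simp: pathstart_def)
  have cont: "continuous_on {0..1} \<gamma>" using \<gamma>(1) by (simp add: path_def)
  have start: "solution_chain n A \<gamma> 0 (\<lambda>_. Y) (\<lambda>_. ball (\<gamma> 0) e)"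
    using e ode_solution_subset[OF Y(1)]
    by (auto simp: solution_chain_def zero_less_one intro!: exI[of _ "1::real"])
  define P where "P = (\<lambda>a. \<exists>F D. solution_chain n A \<gamma> a F D \<and> F 0 = Y)"
  have "0 \<le> (0::real) \<and> (1::real) \<le> 1 \<and> P 0 \<longrightarrow> P 1"
  proof (rule Bolzano[of 0 1 "\<lambda>a b. 0 \<le> a \<and> b \<le> 1 \<and> P a \<longrightarrow> P b"])
    fix a b c :: real
    assume "0 \<le> a \<and> b \<le> 1 \<and> P a \<longrightarrow> P b" "0 \<le> b \<and> c \<le> 1 \<and> P b \<longrightarrow> P c" "a \<le> b" "b \<le> c"
    then show "0 \<le> a \<and> c \<le> 1 \<and> P a \<longrightarrow> P c" by auto
  next
    fix x :: real assume local: "0 \<le> x" "x \<le> 1"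
    then have x: "\<gamma> x \<in> S" using \<gamma>(2) by (auto simp: path_image_def)
    obtain r where r: "r > 0" "ball (\<gamma> x) r \<subseteq> S"
      "\<forall>c\<in>ball (\<gamma> x) r. \<forall>v. \<exists>Y. ode_solution n A Y (ball (\<gamma> x) r) \<and> (\<forall>i<n. Y i c = v i)"
      using ode_local_existence[where n = n and A = A, OF S x A] by auto
    obtain d where d: "d > 0" "\<And>s. s \<in> {0..1} \<Longrightarrow> \<bar>s - x\<bar> < d \<Longrightarrow> \<gamma> s \<in> ball (\<gamma> x) r"
    proof -
      have "x \<in> {0..1}" using local by simp
      then obtain d where "d > 0" "\<forall>s\<in>{0..1}. dist s x < d \<longrightarrow> dist (\<gamma> s) (\<gamma> x) < r"
        using cont r(1) unfolding continuous_on_iff by blast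
      then show ?thesis by (intro that[of d]) (auto simp: dist_commute dist_real_def)
    qed
    have "P b" if ab: "a \<le> x" "x \<le> b" "b - a < d" and "0 \<le> a" "b \<le> 1" "P a" for a b
    proof -
      obtain F D where F: "solution_chain n A \<gamma> a F D" "F 0 = Y" using \<open>P a\<close> by (auto simp: P_def)
      have img: "\<gamma> ` {a..b} \<subseteq> ball (\<gamma> x) r" using that d(2) by auto
      have start: "\<gamma> a \<in> ball (\<gamma> x) r" using img ab by (intro subsetD[OF img] imageI) simp
      have "\<exists>F' D'. solution_chain n A \<gamma> b F' D' \<and> F' 0 = F 0"
      proof (rule solution_chain_extend[OF F(1) _ _ S A open_ball _ img r(2)])
        show "\<exists>Y. ode_solution n A Y (ball (\<gamma> x) r) \<and> (\<forall>i<n. Y i (\<gamma> a) = v i)" for v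
          using r(3) start by blast
        show "continuous_on {0..b} \<gamma>" using that by (intro continuous_on_subset[OF cont]) auto
      qed (use that in \<open>auto intro: convex_connected\<close>)
      then show ?thesis by (simp add: P_def F(2))
    qed
    then show "\<exists>d>0. \<forall>a b. a \<le> x \<and> x \<le> b \<and> b - a < d \<longrightarrow> (0 \<le> a \<and> b \<le> 1 \<and> P a \<longrightarrow> P b)"
      using d(1) by (intro exI[of _ d]) auto
  qed simp
  moreover have "P 0" using start by (auto simp: P_def)
  ultimately obtain F D where F: "solution_chain n A \<gamma> 1 F D" "F 0 = Y" by (auto simp: P_def)
  have "continuation_along \<gamma> (Y i) (F 1 i)" if i: "i < n" for i
    unfolding continuation_along_def
  proof (intro exI[of _ "\<lambda>s. F s i"] exI[of _ D] conjI)
    show "\<forall>s\<in>{0..1}. open (D s) \<and> connected (D s) \<and> \<gamma> s \<in> D s \<and> F s i holomorphic_on D s"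
      using F(1) i ode_solution_holomorphic unfolding solution_chain_def by blast
    show "\<forall>s\<in>{0..1}. \<exists>\<delta>>0. \<forall>s'\<in>{0..1}. \<bar>s' - s\<bar> < \<delta> \<longrightarrow>
        \<gamma> s' \<in> D s \<and> (\<forall>\<^sub>F q in nhds (\<gamma> s'). F s' i q = F s i q)"
    proof
      fix s :: real assume "s \<in> {0..1}"
      then obtain \<delta> where "\<delta> > 0" "\<forall>s'\<in>{0..1}. \<bar>s' - s\<bar> < \<delta> \<longrightarrow>
          \<gamma> s' \<in> D s \<and> (\<forall>i<n. \<forall>\<^sub>F q in nhds (\<gamma> s'). F s' i q = F s i q)"
        using F(1) unfolding solution_chain_def by blast
      then show "\<exists>\<delta>>0. \<forall>s'\<in>{0..1}. \<bar>s' - s\<bar> < \<delta> \<longrightarrow>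
        \<gamma> s' \<in> D s \<and> (\<forall>\<^sub>F q in nhds (\<gamma> s'). F s' i q = F s i q)" using i by blast
    qed
  qed (auto simp: F(2))
  moreover have "open (D 1)" "pathfinish \<gamma> \<in> D 1" "ode_solution n A (F 1) (D 1)"
    using F(1) by (auto simp: solution_chain_def pathfinish_def)
  ultimately show ?thesis by blast
qed

lemma continuation_along_cmult:
  assumes "continuation_along \<gamma> f g"
  shows "continuation_along \<gamma> (\<lambda>q. c * f q) (\<lambda>q. c * g q)"
proof -
  obtain F D where
    "\<forall>s\<in>{0..1}. open (D s) \<and> connected (D s) \<and> \<gamma> s \<in> D s \<and> F s holomorphic_on D s"
    and near: "\<forall>s\<in>{0..1}. \<exists>\<delta>>0. \<forall>s'\<in>{0..1}. \<bar>s' - s\<bar> < \<delta> \<longrightarrow>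
          \<gamma> s' \<in> D s \<and> (\<forall>\<^sub>F q in nhds (\<gamma> s'). F s' q = F s q)"
    and "\<forall>\<^sub>F q in nhds (pathstart \<gamma>). F 0 q = f q" "\<forall>\<^sub>F q in nhds (pathfinish \<gamma>). F 1 q = g q"
    using assms unfolding continuation_along_def by (elim exE conjE) (rule that; assumption)
  moreover have "\<forall>s\<in>{0..1}. \<exists>\<delta>>0. \<forall>s'\<in>{0..1}. \<bar>s' - s\<bar> < \<delta> \<longrightarrow>
          \<gamma> s' \<in> D s \<and> (\<forall>\<^sub>F q in nhds (\<gamma> s'). c * F s' q = c * F s q)"
  proof
    fix s :: real assume "s \<in> {0..1}"
    then obtain \<delta> where \<delta>: "\<delta> > 0" "\<forall>s'\<in>{0..1}. \<bar>s' - s\<bar> < \<delta> \<longrightarrow>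
          \<gamma> s' \<in> D s \<and> (\<forall>\<^sub>F q in nhds (\<gamma> s'). F s' q = F s q)" using near by blast
    show "\<exists>\<delta>>0. \<forall>s'\<in>{0..1}. \<bar>s' - s\<bar> < \<delta> \<longrightarrow>
          \<gamma> s' \<in> D s \<and> (\<forall>\<^sub>F q in nhds (\<gamma> s'). c * F s' q = c * F s q)"
      using \<delta> by (intro exI[of _ \<delta>]) (auto elim!: eventually_mono)
  qed
  ultimately show ?thesis
    unfolding continuation_along_def
    by (intro exI[of _ "\<lambda>s q. c * F s q"] exI[of _ D])
      (auto intro!: holomorphic_intros elim!: eventually_mono)
qed

lemma continuation_along_cong_start:
  assumes "continuation_along \<gamma> f g" "\<forall>\<^sub>F q in nhds (pathstart \<gamma>). f q = f' q"
  shows "continuation_along \<gamma> f' g"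
proof -
  have "\<forall>\<^sub>F q in nhds (pathstart \<gamma>). F 0 q = f' q" if "\<forall>\<^sub>F q in nhds (pathstart \<gamma>). F 0 q = f q"
    for F :: "real \<Rightarrow> complex \<Rightarrow> complex"
    using assms(2) that by eventually_elim simp
  moreover obtain F D where
    "\<forall>s\<in>{0..1}. open (D s) \<and> connected (D s) \<and> \<gamma> s \<in> D s \<and> F s holomorphic_on D s"
    "\<forall>s\<in>{0..1}. \<exists>\<delta>>0. \<forall>s'\<in>{0..1}. \<bar>s' - s\<bar> < \<delta> \<longrightarrow>
          \<gamma> s' \<in> D s \<and> (\<forall>\<^sub>F q in nhds (\<gamma> s'). F s' q = F s q)"
    "\<forall>\<^sub>F q in nhds (pathstart \<gamma>). F 0 q = f q" "\<forall>\<^sub>F q in nhds (pathfinish \<gamma>). F 1 q = g q"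
    using assms(1) unfolding continuation_along_def by (elim exE conjE) (rule that; assumption)
  ultimately show ?thesis
    unfolding continuation_along_def by (intro exI[of _ F] exI[of _ D]) auto
qed

section \<open>Frobenius series\<close>

definition converges_below :: "real \<Rightarrow> (nat \<Rightarrow> complex fps) \<Rightarrow> bool" where
  "converges_below r C \<longleftrightarrow> (\<forall>m q. cmod q < r \<longrightarrow> summable (\<lambda>k. fps_nth (C k) m * q ^ k))"

text \<open>A power series in \<open>q\<close> whose coefficients are formal power series in \<open>X\<close>, summed separately for each
power of \<open>X\<close>.\<close>

definition fps_powser :: "(nat \<Rightarrow> complex fps) \<Rightarrow> complex \<Rightarrow> complex fps" where
  "fps_powser C q = Abs_fps (\<lambda>m. suminf (\<lambda>k. fps_nth (C k) m * q ^ k))"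

text \<open>This is \<open>\<Sum>k. C_k exp ((k + a + X) x)\<close>, a series in powers \<open>q^(k + a + X)\<close> of \<open>q = exp x\<close> with formal exponent.
The expansion of \<open>exp (X x)\<close> produces the logarithmic terms \<open>x^m / m!\<close>.\<close>

definition frobenius_series :: "complex \<Rightarrow> (nat \<Rightarrow> complex fps) \<Rightarrow> complex \<Rightarrow> complex fps" where
  "frobenius_series a C x = fps_const (exp (a * x)) * fps_exp x * fps_powser C (exp x)"

text \<open>The effect of \<open>d/dx\<close> on the coefficients of a Frobenius series.\<close>

definition theta :: "complex \<Rightarrow> (nat \<Rightarrow> complex fps) \<Rightarrow> nat \<Rightarrow> complex fps" where
  "theta a C k = (fps_const (of_nat k + a) + fps_X) * C k"

lemma fps_powser_sums:
  "converges_below r C \<Longrightarrow> cmod q < r \<Longrightarrow>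
     (\<lambda>k. fps_nth (C k) m * q ^ k) sums fps_nth (fps_powser C q) m"
  by (simp add: converges_below_def fps_powser_def summable_sums)

lemma converges_below_and_fps_powserI:
  assumes "\<And>m q. cmod q < r \<Longrightarrow> (\<lambda>k. fps_nth (C k) m * q ^ k) sums fps_nth (F q) m"
  shows "converges_below r C" "cmod q < r \<Longrightarrow> fps_powser C q = F q"
  using assms by (auto simp: converges_below_def fps_powser_def fps_eq_iff sums_iff)

lemma
  assumes "converges_below r C"
  shows converges_below_mult_left: "converges_below r (\<lambda>k. c * C k)"
    and fps_powser_mult_left: "cmod q < r \<Longrightarrow> fps_powser (\<lambda>k. c * C k) q = c * fps_powser C q"
proof -
  have "(\<lambda>k. fps_nth (c * C k) m * q ^ k) sums fps_nth (c * fps_powser C q) m" if "cmod q < r" for m q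
  proof -
    have "(\<lambda>k. \<Sum>i=0..m. fps_nth c i * (fps_nth (C k) (m - i) * q ^ k))
            sums (\<Sum>i=0..m. fps_nth c i * fps_nth (fps_powser C q) (m - i))"
      by (intro sums_sum sums_mult fps_powser_sums[OF assms that])
    then show ?thesis by (simp add: fps_mult_nth sum_distrib_right mult.assoc)
  qed
  from converges_below_and_fps_powserI[OF this]
  show "converges_below r (\<lambda>k. c * C k)" "cmod q < r \<Longrightarrow> fps_powser (\<lambda>k. c * C k) q = c * fps_powser C q"
    by blast+
qed

lemma
  assumes "converges_below r C" "converges_below r D"
  shows converges_below_add: "converges_below r (\<lambda>k. C k + D k)"
    and fps_powser_add: "cmod q < r \<Longrightarrow> fps_powser (\<lambda>k. C k + D k) q = fps_powser C q + fps_powser D q"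
proof -
  have "(\<lambda>k. fps_nth (C k + D k) m * q ^ k) sums fps_nth (fps_powser C q + fps_powser D q) m"
    if "cmod q < r" for m q
    using sums_add[OF fps_powser_sums[OF assms(1) that, of m] fps_powser_sums[OF assms(2) that, of m]]
    by (simp add: algebra_simps)
  from converges_below_and_fps_powserI[OF this]
  show "converges_below r (\<lambda>k. C k + D k)"
    "cmod q < r \<Longrightarrow> fps_powser (\<lambda>k. C k + D k) q = fps_powser C q + fps_powser D q"
    by blast+
qed

lemma
  assumes "\<And>i. i \<in> I \<Longrightarrow> converges_below r (C i)"
  shows converges_below_sum: "converges_below r (\<lambda>k. \<Sum>i\<in>I. C i k)"
    and fps_powser_sum: "cmod q < r \<Longrightarrow> fps_powser (\<lambda>k. \<Sum>i\<in>I. C i k) q = (\<Sum>i\<in>I. fps_powser (C i) q)"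
proof -
  have "(\<lambda>k. fps_nth (\<Sum>i\<in>I. C i k) m * q ^ k) sums fps_nth (\<Sum>i\<in>I. fps_powser (C i) q) m"
    if "cmod q < r" for m q
    using sums_sum[OF fps_powser_sums[OF assms that], of I "\<lambda>i. i" "\<lambda>_. m"]
    by (simp add: fps_sum_nth sum_distrib_right)
  from converges_below_and_fps_powserI[OF this]
  show "converges_below r (\<lambda>k. \<Sum>i\<in>I. C i k)"
    "cmod q < r \<Longrightarrow> fps_powser (\<lambda>k. \<Sum>i\<in>I. C i k) q = (\<Sum>i\<in>I. fps_powser (C i) q)"
    by blast+
qed

lemma
  assumes C: "converges_below r C"
  shows converges_below_of_nat: "converges_below r (\<lambda>k. of_nat k * C k)"
    and fps_powser_has_derivative: "cmod q < r \<Longrightarrow>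
      ((\<lambda>q. fps_nth (fps_powser C q) m) has_field_derivative
        fps_nth (fps_powser (\<lambda>k. of_nat (Suc k) * C (Suc k)) q) m) (at q)"
    and fps_powser_of_nat: "cmod q < r \<Longrightarrow>
      fps_powser (\<lambda>k. of_nat k * C k) q = fps_const q * fps_powser (\<lambda>k. of_nat (Suc k) * C (Suc k)) q"
proof -
  let ?E = "\<lambda>k. of_nat (Suc k) * C (Suc k)"
  have of_nat_nth: "fps_nth (of_nat k * F) m = of_nat k * fps_nth F m" for k m and F :: "complex fps"
    by (simp add: fps_of_nat[symmetric])
  have E: "(\<lambda>k. diffs (\<lambda>k. fps_nth (C k) m) k * q ^ k) = (\<lambda>k. fps_nth (?E k) m * q ^ k)" for m q
    by (simp add: diffs_def of_nat_nth del: of_nat_Suc)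
  have smE: "summable (\<lambda>k. fps_nth (?E k) m * q ^ k)" if "cmod q < r" for m q
    using termdiff_converges[OF that, of "\<lambda>k. fps_nth (C k) m"] C
    unfolding E by (auto simp: converges_below_def)
  show "cmod q < r \<Longrightarrow> ((\<lambda>q. fps_nth (fps_powser C q) m) has_field_derivative
        fps_nth (fps_powser ?E q) m) (at q)"
    using termdiffs_strong'[of r "\<lambda>k. fps_nth (C k) m" q] C
    unfolding E by (auto simp: fps_powser_def converges_below_def)
  have "(\<lambda>k. fps_nth (of_nat k * C k) m * q ^ k) sums fps_nth (fps_const q * fps_powser ?E q) m"
    if "cmod q < r" for m q
  proof -
    have "(\<lambda>k. q * (fps_nth (?E k) m * q ^ k)) sums (q * fps_nth (fps_powser ?E q) m)"
      using smE[OF that] by (intro sums_mult) (simp add: fps_powser_def summable_sums)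
    then have "(\<lambda>k. fps_nth (of_nat (Suc k) * C (Suc k)) m * q ^ Suc k) sums (q * fps_nth (fps_powser ?E q) m)"
      by (simp add: mult_ac del: of_nat_Suc)
    then show ?thesis by (subst (asm) sums_Suc_iff) (simp del: of_nat_Suc)
  qed
  from converges_below_and_fps_powserI[OF this]
  show "converges_below r (\<lambda>k. of_nat k * C k)"
    "cmod q < r \<Longrightarrow> fps_powser (\<lambda>k. of_nat k * C k) q = fps_const q * fps_powser ?E q"
    by blast+
qed

lemma theta_alt: "theta a C = (\<lambda>k. of_nat k * C k + (fps_const a + fps_X) * C k)"
  by (simp add: theta_def fun_eq_iff algebra_simps fps_of_nat fps_const_add[symmetric] del: fps_const_add)

lemma converges_below_theta: "converges_below r C \<Longrightarrow> converges_below r (theta a C)"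
  unfolding theta_alt
  by (intro converges_below_add converges_below_of_nat converges_below_mult_left)

lemma converges_below_theta_funpow: "converges_below r C \<Longrightarrow> converges_below r ((theta a ^^ j) C)"
  by (induction j) (auto intro: converges_below_theta)

lemma theta_funpow: "(theta a ^^ j) C k = (fps_const (of_nat k + a) + fps_X) ^ j * C k"
  by (induction j) (auto simp: theta_def mult_ac)

lemma has_field_derivative_fps_mult:
  fixes f g :: "complex \<Rightarrow> complex fps"
  assumes "\<And>m. ((\<lambda>x. fps_nth (f x) m) has_field_derivative fps_nth f' m) (at x)"
    and "\<And>m. ((\<lambda>x. fps_nth (g x) m) has_field_derivative fps_nth g' m) (at x)"
  shows "((\<lambda>x. fps_nth (f x * g x) m) has_field_derivative fps_nth (f' * g x + f x * g') m) (at x)"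
proof -
  have "((\<lambda>x. \<Sum>i=0..m. fps_nth (f x) i * fps_nth (g x) (m - i)) has_field_derivative
     (\<Sum>i=0..m. fps_nth f' i * fps_nth (g x) (m - i) + fps_nth g' (m - i) * fps_nth (f x) i)) (at x)"
    by (intro DERIV_sum DERIV_mult assms)
  then show ?thesis by (simp add: fps_mult_nth sum.distrib mult.commute[of "fps_nth (f x) _"])
qed

lemma frobenius_series_has_derivative:
  assumes C: "converges_below r C" and x: "cmod (exp x) < r"
  shows "((\<lambda>x. fps_nth (frobenius_series a C x) m) has_field_derivative
          fps_nth (frobenius_series a (theta a C) x) m) (at x)"
proof -
  let ?E = "\<lambda>k. of_nat (Suc k) * C (Suc k)"
  let ?f = "\<lambda>x. fps_const (exp (a * x)) * fps_exp x"
  have f: "((\<lambda>x. fps_nth (?f x) m) has_field_derivative fps_nth ((fps_const a + fps_X) * ?f x) m) (at x)" for m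
  proof (cases m)
    case 0 then show ?thesis by (auto intro!: derivative_eq_intros)
  next
    case (Suc l)
    have "((\<lambda>x. exp (a * x) * (x ^ Suc l / fact (Suc l))) has_field_derivative
        (exp (a * x) * a) * (x ^ Suc l / fact (Suc l)) + exp (a * x) * (x ^ l / fact l)) (at x)"
      using of_nat_neq_0[of l, where 'a = complex]
      by (auto intro!: derivative_eq_intros simp del: of_nat_Suc power_Suc)
         (simp add: divide_simps del: of_nat_Suc)
    moreover have "fps_nth ((fps_const a + fps_X) * F) (Suc l) = a * fps_nth F (Suc l) + fps_nth F l"
      for F :: "complex fps" by (simp add: distrib_right)
    moreover have "fps_nth (?f x) k = exp (a * x) * (x ^ k / fact k)" for k x by simp
    ultimately show ?thesis unfolding Suc by (simp only:) (simp add: mult_ac del: fact_Suc power_Suc)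
  qed
  have g: "((\<lambda>x. fps_nth (fps_powser C (exp x)) m) has_field_derivative
      fps_nth (fps_powser (\<lambda>k. of_nat k * C k) (exp x)) m) (at x)" for m
    using DERIV_chain2[OF fps_powser_has_derivative[OF C x, of m] DERIV_exp]
    by (simp add: fps_powser_of_nat[OF C x] mult.commute[of _ "exp x"] del: of_nat_Suc)
  have "fps_powser (theta a C) (exp x) =
      fps_powser (\<lambda>k. of_nat k * C k) (exp x) + (fps_const a + fps_X) * fps_powser C (exp x)"
    unfolding theta_alt using x
    by (simp add: fps_powser_add[OF converges_below_of_nat[OF C] converges_below_mult_left[OF C]]
        fps_powser_mult_left[OF C])
  then have "frobenius_series a (theta a C) x =
     ((fps_const a + fps_X) * ?f x) * fps_powser C (exp x) + ?f x * fps_powser (\<lambda>k. of_nat k * C k) (exp x)"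
    unfolding frobenius_series_def by (simp only:) (simp add: algebra_simps)
  then show ?thesis
    using has_field_derivative_fps_mult[of ?f, OF f g] by (simp add: frobenius_series_def)
qed

text \<open>The constant coefficient differential operator with symbol \<open>p\<close> acts on the \<open>k\<close>-th coefficient of a
Frobenius series as multiplication by the value of \<open>p\<close> at \<open>k + a + X\<close>.\<close>

definition quartic_eval :: "(nat \<Rightarrow> complex) \<Rightarrow> complex fps \<Rightarrow> complex fps" where
  "quartic_eval p s = (\<Sum>j\<le>4. fps_const (p j) * s ^ j)"

lemma quartic_eval_reflect: "quartic_eval (\<lambda>j. (- 1) ^ j * b j) s = quartic_eval b (- s)"
  unfolding quartic_eval_def
proof (rule sum.cong)
  show "fps_const ((- 1) ^ j * b j) * s ^ j = fps_const (b j) * (- s) ^ j" for j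
    by (cases "even j") (auto simp flip: fps_const_neg)
qed simp

lemma frobenius_series_operator:
  assumes C: "converges_below r C" and x: "cmod (exp x) < r"
  shows "(\<Sum>j\<le>4. fps_const (p j) * frobenius_series a ((theta a ^^ j) C) x) =
     frobenius_series a (\<lambda>k. quartic_eval p (fps_const (of_nat k + a) + fps_X) * C k) x"
    and "converges_below r (\<lambda>k. quartic_eval p (fps_const (of_nat k + a) + fps_X) * C k)"
proof -
  have eq: "(\<lambda>k. quartic_eval p (fps_const (of_nat k + a) + fps_X) * C k) =
     (\<lambda>k. \<Sum>j\<le>4. fps_const (p j) * (theta a ^^ j) C k)"
    by (simp only: quartic_eval_def theta_funpow sum_distrib_right mult.assoc)
  have conv: "converges_below r (\<lambda>k. fps_const (p j) * (theta a ^^ j) C k)" for j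
    by (intro converges_below_mult_left converges_below_theta_funpow C)
  show "converges_below r (\<lambda>k. quartic_eval p (fps_const (of_nat k + a) + fps_X) * C k)"
    unfolding eq by (intro converges_below_sum conv)
  show "(\<Sum>j\<le>4. fps_const (p j) * frobenius_series a ((theta a ^^ j) C) x) =
     frobenius_series a (\<lambda>k. quartic_eval p (fps_const (of_nat k + a) + fps_X) * C k) x"
    unfolding eq frobenius_series_def
    by (subst fps_powser_sum[OF conv x], subst fps_powser_mult_left[OF converges_below_theta_funpow[OF C] x])
       (simp add: sum_distrib_left mult_ac)
qed

text \<open>Multiplication by \<open>exp x\<close> shifts the coefficients by one, so the recurrence makes all terms of
\<open>p(d/dx) y - exp x w(d/dx) y\<close> cancel except the leading one. That one is a multiple of
\<open>p(a + X) C_0\<close>; it starts with a high power of \<open>X\<close> if \<open>a\<close> is a multiple root of \<open>p\<close>, and then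
it contributes nothing to the coefficients up to \<open>X^m\<close>.\<close>

lemma frobenius_series_ode:
  assumes C: "converges_below r C" and x: "cmod (exp x) < r"
    and rec: "\<And>k. quartic_eval p (fps_const (of_nat (Suc k) + a) + fps_X) * C (Suc k) =
                   quartic_eval w (fps_const (of_nat k + a) + fps_X) * C k"
    and head: "\<And>l. l \<le> m \<Longrightarrow> fps_nth (quartic_eval p (fps_const a + fps_X) * C 0) l = 0"
  shows "(\<Sum>j\<le>4. p j * fps_nth (frobenius_series a ((theta a ^^ j) C) x) m) =
     exp x * (\<Sum>j\<le>4. w j * fps_nth (frobenius_series a ((theta a ^^ j) C) x) m)"
proof -
  let ?P = "\<lambda>k. quartic_eval p (fps_const (of_nat k + a) + fps_X) * C k"
  let ?W = "\<lambda>k. quartic_eval w (fps_const (of_nat k + a) + fps_X) * C k"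
  have "fps_powser ?P (exp x) = ?P 0 + fps_const (exp x) * fps_powser ?W (exp x)"
  proof (rule fps_ext)
    fix l
    have "(\<lambda>k. exp x * (fps_nth (?W k) l * exp x ^ k)) sums (exp x * fps_nth (fps_powser ?W (exp x)) l)"
      by (intro sums_mult fps_powser_sums[OF frobenius_series_operator(2)[OF C x] x])
    then have "(\<lambda>k. fps_nth (?P (Suc k)) l * exp x ^ Suc k) sums (exp x * fps_nth (fps_powser ?W (exp x)) l)"
      unfolding rec by (simp add: mult_ac)
    then have "(\<lambda>k. fps_nth (?P k) l * exp x ^ k) sums
        (exp x * fps_nth (fps_powser ?W (exp x)) l + fps_nth (?P 0) l)"
      by (subst (asm) sums_Suc_iff) simp
    then show "fps_nth (fps_powser ?P (exp x)) l =
        fps_nth (?P 0 + fps_const (exp x) * fps_powser ?W (exp x)) l"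
      by (simp add: fps_powser_def sums_iff)
  qed
  then have "frobenius_series a ?P x =
     fps_const (exp (a * x)) * fps_exp x * ?P 0 + fps_const (exp x) * frobenius_series a ?W x"
    unfolding frobenius_series_def by (simp only:) (simp add: algebra_simps)
  moreover have "fps_nth (fps_const (exp (a * x)) * fps_exp x * ?P 0) m = 0"
    unfolding fps_mult_nth[of _ "?P 0"] using head by (intro sum.neutral) auto
  ultimately have "fps_nth (frobenius_series a ?P x) m = exp x * fps_nth (frobenius_series a ?W x) m"
    by simp
  then show ?thesis
    unfolding frobenius_series_operator(1)[OF C x, symmetric] by (simp add: fps_sum_nth)
qed

section \<open>Convergence of Frobenius series\<close>

text \<open>The \<open>l^1\<close> norm of the coefficients modulo \<open>X^(N + 1)\<close>. As it bounds all these coefficients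
together, one ratio test settles the convergence of all the series in \<open>fps_powser\<close>.\<close>

definition fps_norm :: "nat \<Rightarrow> complex fps \<Rightarrow> real" where
  "fps_norm N f = (\<Sum>m\<le>N. cmod (fps_nth f m))"

lemma fps_norm_nonneg: "fps_norm N f \<ge> 0"
  by (simp add: fps_norm_def sum_nonneg)

lemma cmod_fps_nth_le_fps_norm: "m \<le> N \<Longrightarrow> cmod (fps_nth f m) \<le> fps_norm N f"
  unfolding fps_norm_def by (intro member_le_sum) auto

lemma fps_norm_add: "fps_norm N (f + g) \<le> fps_norm N f + fps_norm N g"
  unfolding fps_norm_def by (simp add: sum.distrib[symmetric] sum_mono norm_triangle_ineq)

lemma fps_norm_const_mult: "fps_norm N (fps_const c * f) = cmod c * fps_norm N f"
  by (simp add: fps_norm_def norm_mult sum_distrib_left)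

lemma fps_norm_X_mult: "fps_norm N (fps_X * f) \<le> fps_norm N f"
proof (cases N)
  case (Suc M)
  have "fps_norm N (fps_X * f) = (\<Sum>m\<le>M. cmod (fps_nth f m))"
    by (simp add: fps_norm_def Suc sum.atMost_Suc_shift del: sum.atMost_Suc)
  then show ?thesis by (simp add: fps_norm_def Suc)
qed (simp add: fps_norm_def)

text \<open>The norm does not increase under multiplication by \<open>X\<close>. The lower bound serves to estimate
quotients without inverting power series.\<close>

lemma fps_norm_linear_factor:
  shows fps_norm_linear_factor_upper:
      "fps_norm N ((fps_const c + fps_const d * fps_X) * f) \<le> (cmod c + cmod d) * fps_norm N f"
    and fps_norm_linear_factor_lower:
      "(cmod c - cmod d) * fps_norm N f \<le> fps_norm N ((fps_const c + fps_const d * fps_X) * f)"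
proof -
  let ?g = "fps_const d * (fps_X * f)"
  have eq: "(fps_const c + fps_const d * fps_X) * f = fps_const c * f + ?g"
    by (simp add: algebra_simps)
  have g: "fps_norm N ?g \<le> cmod d * fps_norm N f"
    unfolding fps_norm_const_mult by (intro mult_left_mono fps_norm_X_mult) auto
  show "fps_norm N ((fps_const c + fps_const d * fps_X) * f) \<le> (cmod c + cmod d) * fps_norm N f"
    using fps_norm_add[of N "fps_const c * f" ?g] g unfolding eq fps_norm_const_mult[of N c]
    by (simp add: algebra_simps)
  have "fps_norm N (fps_const (- 1) * ?g) = fps_norm N ?g" by (simp only: fps_norm_const_mult) simp
  moreover have "fps_const c * f = (fps_const c * f + ?g) + fps_const (- 1) * ?g"
    by (simp add: fps_const_neg[symmetric] del: fps_const_neg)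
  ultimately have "fps_norm N (fps_const c * f) \<le> fps_norm N (fps_const c * f + ?g) + fps_norm N ?g"
    using fps_norm_add[of N "fps_const c * f + ?g" "fps_const (- 1) * ?g"] by metis
  then show "(cmod c - cmod d) * fps_norm N f \<le> fps_norm N ((fps_const c + fps_const d * fps_X) * f)"
    using g unfolding eq fps_norm_const_mult[of N c] left_diff_distrib by linarith
qed

lemma fps_norm_linear_power_upper:
  "fps_norm N ((fps_const c + fps_const d * fps_X) ^ n * f) \<le> (cmod c + cmod d) ^ n * fps_norm N f"
proof (induction n)
  case (Suc n)
  let ?l = "fps_const c + fps_const d * fps_X"
  have "fps_norm N (?l ^ Suc n * f) = fps_norm N (?l * (?l ^ n * f))" by (simp add: mult.assoc)
  also have "\<dots> \<le> (cmod c + cmod d) * fps_norm N (?l ^ n * f)" by (rule fps_norm_linear_factor_upper)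
  also have "\<dots> \<le> (cmod c + cmod d) * ((cmod c + cmod d) ^ n * fps_norm N f)"
    using Suc by (intro mult_left_mono) auto
  finally show ?case by simp
qed simp

lemma fps_norm_linear_power_lower:
  assumes "cmod d \<le> cmod c"
  shows "(cmod c - cmod d) ^ n * fps_norm N f \<le> fps_norm N ((fps_const c + fps_const d * fps_X) ^ n * f)"
proof (induction n)
  case (Suc n)
  let ?l = "fps_const c + fps_const d * fps_X"
  have "(cmod c - cmod d) ^ Suc n * fps_norm N f = (cmod c - cmod d) * ((cmod c - cmod d) ^ n * fps_norm N f)"
    by simp
  also have "\<dots> \<le> (cmod c - cmod d) * fps_norm N (?l ^ n * f)"
    using Suc assms by (intro mult_left_mono) auto
  also have "\<dots> \<le> fps_norm N (?l * (?l ^ n * f))" by (rule fps_norm_linear_factor_lower)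
  finally show ?case by (simp add: mult.assoc)
qed simp

text \<open>In the application \<open>lo k\<close> and \<open>hi k\<close> are estimates for the two sides of the recurrence; they are
polynomials in \<open>k\<close> of the same degree, and the quotient of their leading coefficients is the
inverse radius of convergence.\<close>

lemma converges_below_ratio:
  assumes le: "\<And>N k. k \<ge> K \<Longrightarrow> lo k * fps_norm N (C (Suc k)) \<le> hi k * fps_norm N (C k)"
    and lo: "\<And>k. k \<ge> K \<Longrightarrow> lo k > 0"
    and lim: "(\<lambda>k. hi k / lo k) \<longlonglongrightarrow> L" and L: "L > 0"
  shows "converges_below (1 / L) C"
  unfolding converges_below_def
proof (intro allI impI)
  fix m q assume q: "cmod q < 1 / L"
  define s where "s = (\<lambda>k. fps_norm m (C k) * cmod q ^ k)"
  define c where "c = (L * cmod q + 1) / 2"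
  have c: "L * cmod q < c" "c < 1" using q L by (auto simp: c_def field_simps)
  have "(\<lambda>k. hi k / lo k * cmod q) \<longlonglongrightarrow> L * cmod q" by (intro tendsto_intros lim)
  then have "\<forall>\<^sub>F k in sequentially. hi k / lo k * cmod q < c" using c(1) by (rule order_tendstoD)
  then obtain K' where K': "\<And>k. k \<ge> K' \<Longrightarrow> hi k / lo k * cmod q < c"
    by (auto simp: eventually_sequentially)
  have "norm (s (Suc k)) \<le> c * norm (s k)" if k: "k \<ge> max K K'" for k
  proof -
    have "fps_norm m (C (Suc k)) \<le> hi k / lo k * fps_norm m (C k)"
      using le[of k m] lo[of k] k by (simp add: field_simps)
    then have "s (Suc k) \<le> (hi k / lo k * fps_norm m (C k)) * cmod q ^ Suc k"
      unfolding s_def by (intro mult_right_mono) auto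
    also have "\<dots> = (hi k / lo k * cmod q) * s k" by (simp add: s_def)
    also have "\<dots> \<le> c * s k"
      using K'[of k] k by (intro mult_right_mono) (auto simp: s_def fps_norm_nonneg)
    finally show ?thesis by (simp add: s_def fps_norm_nonneg)
  qed
  then have "summable s" by (intro summable_ratio_test[OF c(2), of "max K K'"]) auto
  then show "summable (\<lambda>k. fps_nth (C k) m * q ^ k)"
    by (rule summable_comparison_test'[where N = 0])
      (auto simp: s_def norm_mult norm_power intro!: mult_right_mono cmod_fps_nth_le_fps_norm)
qed

section \<open>The equation in the variable q\<close>

text \<open>The first order system for \<open>y, D y, D^2 y, D^3 y\<close>, where \<open>D = q d/dq\<close>, that is equivalent to
\<open>D^4 y = q (\<Sum>j\<le>4. b_j D^j y)\<close>. Solving for \<open>D^4 y\<close> divides by \<open>1 - b_4 q\<close>.\<close>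

definition companion :: "(nat \<Rightarrow> complex) \<Rightarrow> nat \<Rightarrow> nat \<Rightarrow> complex \<Rightarrow> complex" where
  "companion b i j q = (if i < 3 then (if j = Suc i then 1 / q else 0) else b j / (1 - b 4 * q))"

lemma companion_holomorphic:
  assumes "b 4 \<noteq> 0"
  shows "companion b i j holomorphic_on - {0, 1 / b 4}"
proof -
  have "(\<lambda>q. if i < 3 then (if j = Suc i then 1 / q else 0) else b j / (1 - b 4 * q)) holomorphic_on - {0, 1 / b 4}"
    using assms by (cases "i < 3"; cases "j = Suc i") (auto intro!: holomorphic_intros simp: field_simps)
  then show ?thesis by (simp add: companion_def[abs_def])
qed

lemma ode_solution_companion:
  assumes U: "U \<subseteq> - {0, 1 / b 4}" and b4: "b 4 \<noteq> 0"
    and der: "\<And>j q. j < 4 \<Longrightarrow> q \<in> U \<Longrightarrow> (Y j has_field_derivative Y (Suc j) q / q) (at q)"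
    and eq: "\<And>q. q \<in> U \<Longrightarrow> Y 4 q = q * (\<Sum>j\<le>4. b j * Y j q)"
  shows "ode_solution 4 (companion b) Y U"
  unfolding ode_solution_def
proof (intro ballI allI impI)
  fix q and i :: nat assume q: "q \<in> U" and i: "i < 4"
  have q0: "q \<noteq> 0" "1 - b 4 * q \<noteq> 0" using q U b4 by (auto simp: field_simps)
  have "(\<Sum>j<4. companion b i j q * Y j q) = Y (Suc i) q / q"
  proof (cases "i < 3")
    case True
    then have "(\<Sum>j<4. companion b i j q * Y j q) = (\<Sum>j<4. if j = Suc i then Y j q / q else 0)"
      by (intro sum.cong) (auto simp: companion_def)
    then show ?thesis using True by (simp add: sum.delta)
  next
    case False
    then have i3: "i = 3" using i by simp
    have "{..4::nat} = insert 4 {..<4}" by auto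
    then have "Y 4 q * (1 - b 4 * q) = q * (\<Sum>j<4. b j * Y j q)"
      using eq[OF q] by (simp add: algebra_simps)
    then have "Y 4 q / q = (\<Sum>j<4. b j * Y j q) / (1 - b 4 * q)" using q0 by (simp add: frac_eq_eq mult_ac)
    then show ?thesis by (simp add: i3 companion_def sum_divide_distrib)
  qed
  then show "(Y i has_field_derivative (\<Sum>j<4. companion b i j q * Y j q)) (at q)"
    using der[OF i q] by simp
qed

text \<open>The indicial polynomial at \<open>q = 0\<close> is \<open>s^4\<close>, with the fourfold root \<open>0\<close>. So the coefficients of
\<open>1, X, X^2, X^3\<close> are solutions.\<close>

lemma frobenius_series_solution_at_0:
  assumes C: "converges_below r C" and b4: "b 4 \<noteq> 0"
    and rec: "\<And>k. (fps_const (of_nat (Suc k)) + fps_X) ^ 4 * C (Suc k) =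
                   quartic_eval b (fps_const (of_nat k) + fps_X) * C k"
    and m: "m < 4"
    and lg: "open U" "lg holomorphic_on U" "\<And>q. q \<in> U \<Longrightarrow> exp (lg q) = q"
    and U: "U \<subseteq> - {0, 1 / b 4}" "\<And>q. q \<in> U \<Longrightarrow> cmod q < r"
  shows "ode_solution 4 (companion b)
           (\<lambda>j q. fps_nth (frobenius_series 0 ((theta 0 ^^ j) C) (lg q)) m) U"
proof (rule ode_solution_companion[where b = b, OF U(1) b4])
  fix q assume q: "q \<in> U"
  have "(lg has_field_derivative deriv lg q) (at q)"
    using lg q by (auto intro: holomorphic_derivI)
  then have "((\<lambda>q. exp (lg q)) has_field_derivative exp (lg q) * deriv lg q) (at q)"
    by (rule DERIV_chain2[OF DERIV_exp])
  moreover have "((\<lambda>q. exp (lg q)) has_field_derivative 1) (at q)"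
    by (rule has_field_derivative_transform_within_open[OF DERIV_ident lg(1) q]) (use lg(3) in auto)
  ultimately have "q * deriv lg q = 1" using lg(3)[OF q] DERIV_unique by metis
  then have "deriv lg q = 1 / q" using U(1) q by (auto simp: field_simps)
  then have lg': "(lg has_field_derivative 1 / q) (at q)"
    using \<open>(lg has_field_derivative deriv lg q) (at q)\<close> by simp
  have x: "cmod (exp (lg q)) < r" using lg(3) U(2) q by simp
  show "((\<lambda>q. fps_nth (frobenius_series 0 ((theta 0 ^^ j) C) (lg q)) m) has_field_derivative
      fps_nth (frobenius_series 0 ((theta 0 ^^ Suc j) C) (lg q)) m / q) (at q)" for j
    using DERIV_chain2[OF frobenius_series_has_derivative[where a = 0 and m = m,
        OF converges_below_theta_funpow[where a = 0 and j = j, OF C] x] lg']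
    by simp
  define p :: "nat \<Rightarrow> complex" where "p = (\<lambda>j. if j = 4 then 1 else 0)"
  have p: "quartic_eval p s = s ^ 4" for s
    by (simp add: quartic_eval_def p_def if_distrib[of fps_const] if_distrib[of "\<lambda>c. c * _"] cong: if_cong)
  have "(\<Sum>j\<le>4. p j * fps_nth (frobenius_series 0 ((theta 0 ^^ j) C) (lg q)) m) =
     exp (lg q) * (\<Sum>j\<le>4. b j * fps_nth (frobenius_series 0 ((theta 0 ^^ j) C) (lg q)) m)"
  proof (rule frobenius_series_ode[OF C x])
    show "quartic_eval p (fps_const (of_nat (Suc k) + 0) + fps_X) * C (Suc k) =
          quartic_eval b (fps_const (of_nat k + 0) + fps_X) * C k" for k
      using rec[of k] by (simp add: p)
    show "fps_nth (quartic_eval p (fps_const 0 + fps_X) * C 0) l = 0" if "l \<le> m" for l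
      using that m by (simp add: p fps_X_power_mult_nth)
  qed
  then show "fps_nth (frobenius_series 0 ((theta 0 ^^ 4) C) (lg q)) m =
     q * (\<Sum>j\<le>4. b j * fps_nth (frobenius_series 0 ((theta 0 ^^ j) C) (lg q)) m)"
    using lg(3)[OF q] by (simp add: p_def if_distrib[of "\<lambda>c. c * _"] cong: if_cong)
qed

text \<open>At infinity the local parameter is \<open>1 / q = exp x\<close>, so \<open>D = - d/dx\<close>: this explains the alternating
signs, and the two sides of the recurrence change their roles.\<close>

lemma frobenius_series_solution_at_infinity:
  assumes C: "converges_below r C" and b4: "b 4 \<noteq> 0"
    and rec: "\<And>k. quartic_eval (\<lambda>j. (- 1) ^ j * b j) (fps_const (of_nat (Suc k) + a) + fps_X) * C (Suc k) =
                   (fps_const (of_nat k + a) + fps_X) ^ 4 * C k"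
    and head: "\<And>l. l \<le> m \<Longrightarrow>
        fps_nth (quartic_eval (\<lambda>j. (- 1) ^ j * b j) (fps_const a + fps_X) * C 0) l = 0"
    and U: "U \<subseteq> - {0, 1 / b 4}" "\<And>q. q \<in> U \<Longrightarrow> q \<notin> \<real>\<^sub>\<le>\<^sub>0" "\<And>q. q \<in> U \<Longrightarrow> 1 / r < cmod q" and r: "r > 0"
  shows "ode_solution 4 (companion b)
           (\<lambda>j q. (- 1) ^ j * fps_nth (frobenius_series a ((theta a ^^ j) C) (- Ln q)) m) U"
proof (rule ode_solution_companion[where b = b, OF U(1) b4])
  fix q assume q: "q \<in> U"
  have q0: "q \<noteq> 0" using q U by auto
  have ex: "exp (- Ln q) = 1 / q" using q0 by (simp add: exp_minus inverse_eq_divide)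
  have x: "cmod (exp (- Ln q)) < r"
    using U(3)[OF q] r q0 by (simp add: ex norm_divide field_simps)
  have lg': "((\<lambda>q. - Ln q) has_field_derivative - (1 / q)) (at q)"
    using U(2)[OF q] by (auto intro!: derivative_eq_intros simp: inverse_eq_divide)
  show "((\<lambda>q. (- 1) ^ j * fps_nth (frobenius_series a ((theta a ^^ j) C) (- Ln q)) m) has_field_derivative
      (- 1) ^ Suc j * fps_nth (frobenius_series a ((theta a ^^ Suc j) C) (- Ln q)) m / q) (at q)" for j
    using DERIV_cmult[OF DERIV_chain2[OF frobenius_series_has_derivative[where a = a and m = m,
        OF converges_below_theta_funpow[where a = a and j = j, OF C] x] lg'], of "(-1) ^ j"]
    by simp
  define p :: "nat \<Rightarrow> complex" where "p = (\<lambda>j. if j = 4 then 1 else 0)"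
  have p: "quartic_eval p s = s ^ 4" for s
    by (simp add: quartic_eval_def p_def if_distrib[of fps_const] if_distrib[of "\<lambda>c. c * _"] cong: if_cong)
  have "(\<Sum>j\<le>4. (- 1) ^ j * b j * fps_nth (frobenius_series a ((theta a ^^ j) C) (- Ln q)) m) =
     exp (- Ln q) * (\<Sum>j\<le>4. p j * fps_nth (frobenius_series a ((theta a ^^ j) C) (- Ln q)) m)"
    using rec head by (intro frobenius_series_ode[OF C x]) (simp_all add: p)
  then have "(\<Sum>j\<le>4. (- 1) ^ j * b j * fps_nth (frobenius_series a ((theta a ^^ j) C) (- Ln q)) m) =
     (1 / q) * fps_nth (frobenius_series a ((theta a ^^ 4) C) (- Ln q)) m"
    unfolding ex by (simp add: p_def if_distrib[of "\<lambda>c. c * _"] cong: if_cong)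
  then show "(- 1) ^ 4 * fps_nth (frobenius_series a ((theta a ^^ 4) C) (- Ln q)) m =
     q * (\<Sum>j\<le>4. b j * ((- 1) ^ j * fps_nth (frobenius_series a ((theta a ^^ j) C) (- Ln q)) m))"
    using q0 by (simp add: mult_ac)
qed

section \<open>Linear independence at infinity\<close>

text \<open>In a vanishing linear combination, divide by the dominant \<open>\<phi> k\<close> among those with nonzero coefficient:
in the limit only the term of index \<open>k\<close> survives.\<close>

lemma independent_if_asymptotically_separated:
  fixes v \<phi> :: "'b :: finite \<Rightarrow> 'c \<Rightarrow> complex" and rk :: "'b \<Rightarrow> nat"
  assumes F: "F \<noteq> bot"
    and lim: "\<And>i. ((\<lambda>t. v i t / \<phi> i t) \<longlongrightarrow> L i) F" "\<And>i. L i \<noteq> 0"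
    and nz: "\<And>i. \<forall>\<^sub>F t in F. \<phi> i t \<noteq> 0"
    and rk: "inj rk" "\<And>i k. rk i < rk k \<Longrightarrow> ((\<lambda>t. \<phi> i t / \<phi> k t) \<longlongrightarrow> 0) F"
    and zero: "\<forall>\<^sub>F t in F. (\<Sum>i\<in>UNIV. c i * v i t) = 0"
  shows "c i = 0"
proof (rule ccontr)
  assume "c i \<noteq> 0"
  then have "finite {i. c i \<noteq> 0}" "{i. c i \<noteq> 0} \<noteq> {}" by auto
  then obtain k where k: "c k \<noteq> 0" "\<And>i. c i \<noteq> 0 \<Longrightarrow> rk i \<le> rk k"
    using Max_in[of "rk ` {i. c i \<noteq> 0}"] Max_ge[of "rk ` {i. c i \<noteq> 0}"] by fastforce
  have "((\<lambda>t. c i * (v i t / \<phi> k t)) \<longlongrightarrow> (if i = k then c k * L k else 0)) F" for i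
  proof -
    consider "i = k" | "c i = 0" "i \<noteq> k" | "c i \<noteq> 0" "i \<noteq> k" by blast
    then show ?thesis
    proof cases
      case 1 then show ?thesis using tendsto_mult_left[OF lim(1), of "c k" k] by simp
    next
      case 2 then show ?thesis by simp
    next
      case 3
      then have "rk i < rk k" using k(2)[of i] rk(1) by (metis injD le_neq_implies_less)
      then have "((\<lambda>t. c i * ((v i t / \<phi> i t) * (\<phi> i t / \<phi> k t))) \<longlongrightarrow> c i * (L i * 0)) F"
        by (intro tendsto_intros lim rk)
      moreover have "\<forall>\<^sub>F t in F. c i * ((v i t / \<phi> i t) * (\<phi> i t / \<phi> k t)) = c i * (v i t / \<phi> k t)"
        using nz[of i] by eventually_elim simp
      ultimately have "((\<lambda>t. c i * (v i t / \<phi> k t)) \<longlongrightarrow> c i * (L i * 0)) F"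
        by (rule Lim_transform_eventually)
      then show ?thesis using 3 by simp
    qed
  qed
  then have "((\<lambda>t. \<Sum>i\<in>UNIV. c i * (v i t / \<phi> k t)) \<longlongrightarrow> (\<Sum>i\<in>UNIV. if i = k then c k * L k else 0)) F"
    by (intro tendsto_sum)
  moreover have "\<forall>\<^sub>F t in F. (\<Sum>i\<in>UNIV. c i * (v i t / \<phi> k t)) = 0"
    using zero by eventually_elim (simp add: sum_divide_distrib[symmetric])
  ultimately have "((\<lambda>t. 0) \<longlongrightarrow> (\<Sum>i\<in>UNIV. if i = k then c k * L k else 0)) F"
    by (rule Lim_transform_eventually)
  then have "c k * L k = 0" using F by (simp add: tendsto_const_iff)
  then show False using k(1) lim(2) by simp
qed

text \<open>For \<open>t \<rightarrow> -\<infinity>\<close> the power series tend to their constant terms, and the highest power of \<open>t\<close>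
dominates the others.\<close>

lemma frobenius_series_asymptotics:
  assumes C: "converges_below r C" and r: "r > 0"
  shows "((\<lambda>t. fps_nth (frobenius_series (of_real a) C (of_real t)) m / of_real (exp (a * t) * t ^ m))
            \<longlongrightarrow> fps_nth (C 0) 0 / fact m) at_bot"
proof -
  have e0: "((\<lambda>t::real. exp (of_real t :: complex)) \<longlongrightarrow> 0) at_bot"
  proof -
    have "((\<lambda>t::real. complex_of_real (exp t)) \<longlongrightarrow> complex_of_real 0) at_bot"
      by (intro tendsto_of_real exp_at_bot)
    then show ?thesis by (simp add: exp_of_real)
  qed
  have S: "((\<lambda>t. fps_nth (fps_powser C (exp (of_real t))) l) \<longlongrightarrow> fps_nth (C 0) l) at_bot" for l
  proof -
    have "isCont (\<lambda>q. fps_nth (fps_powser C q) l) 0"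
      using fps_powser_has_derivative[OF C, of 0] r by (auto intro: DERIV_isCont)
    then have "((\<lambda>t. fps_nth (fps_powser C (exp (of_real t))) l) \<longlongrightarrow> fps_nth (fps_powser C 0) l) at_bot"
      using e0 by (rule isCont_tendsto_compose)
    moreover have "fps_nth (fps_powser C 0) l = fps_nth (C 0) l"
      by (simp add: fps_powser_def)
    ultimately show ?thesis by simp
  qed
  have P: "((\<lambda>t::real. complex_of_real (t ^ j / t ^ m)) \<longlongrightarrow> (if j = m then 1 else 0)) at_bot" if "j \<le> m" for j
  proof -
    have "((\<lambda>t::real. complex_of_real (inverse t ^ (m - j))) \<longlongrightarrow> complex_of_real (0 ^ (m - j))) at_bot"
      by (intro tendsto_of_real tendsto_power filterlim_compose[OF tendsto_inverse_0]
            filterlim_at_bot_imp_at_infinity filterlim_ident)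
    moreover have "\<forall>\<^sub>F t::real in at_bot. complex_of_real (inverse t ^ (m - j)) = complex_of_real (t ^ j / t ^ m)"
      using eventually_at_bot_not_equal[of "0::real"] by eventually_elim (use that in \<open>simp add: power_inverse power_diff field_simps\<close>)
    ultimately have "((\<lambda>t::real. complex_of_real (t ^ j / t ^ m)) \<longlongrightarrow> complex_of_real (0 ^ (m - j))) at_bot"
      by (rule Lim_transform_eventually)
    then show ?thesis using that by (auto simp: power_0_left split: if_splits)
  qed
  have "((\<lambda>t. \<Sum>j=0..m. complex_of_real (t ^ j / t ^ m) / fact j * fps_nth (fps_powser C (exp (of_real t))) (m - j))
     \<longlongrightarrow> (\<Sum>j=0..m. (if j = m then 1 else 0) / fact j * fps_nth (C 0) (m - j))) at_bot"
    by (intro tendsto_intros P S) auto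
  also have "(\<Sum>j=0..m. (if j = m then 1 else 0) / fact j * fps_nth (C 0) (m - j)) =
     (\<Sum>j=0..m. if j = m then fps_nth (C 0) 0 / fact m else 0)"
    by (intro sum.cong) auto
  also have "\<dots> = fps_nth (C 0) 0 / fact m" by simp
  also have "(\<lambda>t. \<Sum>j=0..m. complex_of_real (t ^ j / t ^ m) / fact j * fps_nth (fps_powser C (exp (of_real t))) (m - j)) =
     (\<lambda>t. fps_nth (frobenius_series (of_real a) C (of_real t)) m / of_real (exp (a * t) * t ^ m))"
    by (simp add: frobenius_series_def mult.assoc fps_mult_nth[of "fps_exp _"] exp_of_real[symmetric]
        sum_divide_distrib field_simps)
  finally show ?thesis .
qed

lemma eventually_zero_imp_zero_on_connected:
  assumes f: "f holomorphic_on S" and S: "open S" "connected S" "p \<in> S"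
    and zero: "\<forall>\<^sub>F x in nhds p. f x = 0" and w: "w \<in> S"
  shows "f w = 0"
proof (rule holomorphic_fun_eq_0_on_connected[OF f S(1,2) _ S(3) w])
  fix n
  have "(deriv ^^ n) f p = (deriv ^^ n) (\<lambda>_. 0) p" using zero by (intro higher_deriv_cong_ev) auto
  then show "(deriv ^^ n) f p = 0" by simp
qed

text \<open>A linear relation near \<open>x = 0\<close> persists on the whole half plane of convergence by the identity
theorem, and this half plane contains the negative real axis, on which the growth of the functions
distinguishes them.\<close>

lemma frobenius_series_independent:
  fixes B :: "'b :: finite \<Rightarrow> nat \<Rightarrow> complex fps" and a :: "'b \<Rightarrow> real" and rk :: "'b \<Rightarrow> nat"
  assumes B: "\<And>i. converges_below r (B i)" "\<And>i. fps_nth (B i 0) 0 \<noteq> 0" and r: "r > 1"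
    and rk: "inj rk" "\<And>i k. rk i < rk k \<Longrightarrow>
      ((\<lambda>t. (exp (a i * t) * t ^ m i) / (exp (a k * t) * t ^ m k)) \<longlongrightarrow> 0) at_bot"
    and zero: "\<forall>\<^sub>F x in nhds 0. (\<Sum>i\<in>UNIV. c i * fps_nth (frobenius_series (of_real (a i)) (B i) x) (m i)) = 0"
  shows "c i = 0"
proof -
  define f where "f = (\<lambda>x. \<Sum>i\<in>UNIV. c i * fps_nth (frobenius_series (of_real (a i)) (B i) x) (m i))"
  define H where "H = {x. Re x < ln r}"
  have H: "open H" "connected H" "0 \<in> H"
    using r by (auto simp: H_def open_halfspace_Re_lt convex_halfspace_Re_lt intro: convex_connected)
  have "cmod (exp x) < r" if "x \<in> H" for x
    using that r by (simp add: H_def) (metis exp_less_mono exp_ln less_trans zero_less_one)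
  then have "f holomorphic_on H"
    unfolding f_def
    by (intro holomorphic_intros) (auto simp: holomorphic_on_open[OF H(1)]
        intro!: exI frobenius_series_has_derivative[OF B(1)])
  then have fz: "f x = 0" if "x \<in> H" for x
    using eventually_zero_imp_zero_on_connected[OF _ H _ that] zero by (simp add: f_def)
  show ?thesis
  proof (rule independent_if_asymptotically_separated[where F = "at_bot :: real filter" and rk = rk
      and v = "\<lambda>i t. fps_nth (frobenius_series (of_real (a i)) (B i) (of_real t)) (m i)"
      and \<phi> = "\<lambda>i t. of_real (exp (a i * t) * t ^ m i)"])
    show "((\<lambda>t. fps_nth (frobenius_series (of_real (a i)) (B i) (of_real t)) (m i) /
        of_real (exp (a i * t) * t ^ m i)) \<longlongrightarrow> fps_nth (B i 0) 0 / fact (m i)) at_bot" for i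
      using r by (intro frobenius_series_asymptotics[OF B(1)]) auto
    show "fps_nth (B i 0) 0 / fact (m i) \<noteq> 0" for i using B(2) by simp
    show "\<forall>\<^sub>F t in at_bot. complex_of_real (exp (a i * t) * t ^ m i) \<noteq> 0" for i
      using eventually_at_bot_not_equal[of "0::real"] by eventually_elim simp
    show "((\<lambda>t. complex_of_real (exp (a i * t) * t ^ m i) / complex_of_real (exp (a k * t) * t ^ m k)) \<longlongrightarrow> 0) at_bot"
      if "rk i < rk k" for i k
      using tendsto_of_real[OF rk(2)[OF that], where 'a = complex] by simp
    have "\<forall>\<^sub>F t::real in at_bot. t < 0" by simp
    then show "\<forall>\<^sub>F t in at_bot. (\<Sum>i\<in>UNIV. c i *
        fps_nth (frobenius_series (of_real (a i)) (B i) (of_real t)) (m i)) = 0"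
    proof eventually_elim
      case (elim t)
      then have "complex_of_real t \<in> H" using r by (simp add: H_def) (metis ln_gt_zero less_trans)
      from fz[OF this] show ?case by (simp add: f_def)
    qed
  qed (use rk(1) in auto)
qed

text \<open>The bijection \<open>rk\<close> of index sets turns the initial values into a square matrix; it is injective,
hence surjective.\<close>

lemma independent_initial_values_span:
  fixes M :: "'b :: finite \<Rightarrow> nat \<Rightarrow> complex" and rk :: "'b \<Rightarrow> nat"
  assumes rk: "bij_betw rk UNIV {..<n}"
    and indep: "\<And>c i. (\<And>j. j < n \<Longrightarrow> (\<Sum>k\<in>UNIV. c k * M k j) = 0) \<Longrightarrow> c i = 0"
  shows "\<exists>c. \<forall>j<n. (\<Sum>k\<in>UNIV. c k * M k j) = y j"
proof -
  define N :: "complex ^ 'b ^ 'b" where "N = (\<chi> s k. M k (rk s))"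
  have N: "(N *v v) $ s = (\<Sum>k\<in>UNIV. v $ k * M k (rk s))" for v s
    by (simp add: N_def matrix_vector_mult_def mult.commute)
  have ex: "\<exists>s. rk s = j" if "j < n" for j
    using rk that by (metis bij_betw_iff_bijections lessThan_iff)
  have "v = 0" if "N *v v = 0" for v
  proof -
    have "v $ i = 0" for i
    proof (rule indep)
      fix j assume "j < n"
      then obtain s where s: "rk s = j" using ex by blast
      show "(\<Sum>k\<in>UNIV. v $ k * M k j) = 0" using N[of v s] that s by simp
    qed
    then show ?thesis by (simp add: vec_eq_iff)
  qed
  then have "inj ((*v) N)"
    by (metis (no_types, lifting) eq_iff_diff_eq_0 injI matrix_vector_mult_diff_distrib)
  then obtain N' where "N ** N' = mat 1"
    using matrix_left_invertible_injective matrix_left_right_inverse by blast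
  then have "N *v (N' *v v) = v" for v by (simp add: matrix_vector_mul_assoc)
  then have "\<forall>j<n. (\<Sum>k\<in>UNIV. (N' *v (\<chi> s. y (rk s))) $ k * M k j) = y j"
    using N ex by (metis vec_lambda_beta)
  then show ?thesis by blast
qed

section \<open>The connection between the two singular points\<close>

text \<open>The component \<open>n\<close> of the series at \<open>0\<close> is continued along \<open>\<gamma>\<close> to a solution near \<open>q = 1\<close>. There
the functions from the expansion at infinity, which converges since \<open>1 > 1 / \<kappa>\<close>, are four independent
solutions; so a linear combination of them has the same initial values at \<open>q = 1\<close>, and it
coincides with the continued solution by uniqueness.\<close>

theorem frobenius_series_connection:
  fixes B :: "'b :: finite \<Rightarrow> nat \<Rightarrow> complex fps" and a :: "'b \<Rightarrow> real" and rk :: "'b \<Rightarrow> nat"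
  assumes \<kappa>: "b 4 = complex_of_real \<kappa>" "\<kappa> > 1"
    and C: "converges_below (1 / \<kappa>) C"
    and recC: "\<And>k. (fps_const (of_nat (Suc k)) + fps_X) ^ 4 * C (Suc k) =
                   quartic_eval b (fps_const (of_nat k) + fps_X) * C k"
    and B: "\<And>i. converges_below \<kappa> (B i)" "\<And>i. fps_nth (B i 0) 0 \<noteq> 0"
    and recB: "\<And>i k. quartic_eval (\<lambda>j. (- 1) ^ j * b j) (fps_const (of_nat (Suc k) + of_real (a i)) + fps_X) * B i (Suc k) =
                   (fps_const (of_nat k + of_real (a i)) + fps_X) ^ 4 * B i k"
    and head: "\<And>i l. l \<le> m i \<Longrightarrow>
        fps_nth (quartic_eval (\<lambda>j. (- 1) ^ j * b j) (fps_const (of_real (a i)) + fps_X) * B i 0) l = 0"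
    and rk: "bij_betw rk UNIV {..<4}" "\<And>i k. rk i < rk k \<Longrightarrow>
      ((\<lambda>t. (exp (a i * t) * t ^ m i) / (exp (a k * t) * t ^ m k)) \<longlongrightarrow> 0) at_bot"
    and \<gamma>: "continuation_path (1 / \<kappa>) \<gamma>" and lg: "log_branch_at lg (pathstart \<gamma>)" and n: "n < 4"
  shows "\<exists>G c. continuation_along \<gamma> (\<lambda>q. fps_nth (frobenius_series 0 C (lg q)) n) G \<and>
     (\<forall>\<^sub>F x in nhds 0. G (exp (- x)) =
        (\<Sum>i\<in>UNIV. c i * fps_nth (frobenius_series (of_real (a i)) (B i) x) (m i)))"
proof -
  define S where "S = - {0, 1 / b 4}"
  have b4: "b 4 \<noteq> 0" using \<kappa> by simp
  have S: "open S" by (simp add: S_def open_Compl)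
  note A = companion_holomorphic[where b = b, OF b4, folded S_def]
  have q0: "pathstart \<gamma> \<in> S" "cmod (pathstart \<gamma>) < 1 / \<kappa>" "path_image \<gamma> \<subseteq> S" "path \<gamma>" "pathfinish \<gamma> = 1"
    using \<gamma> pathstart_in_path_image[of \<gamma>] by (auto simp: continuation_path_def S_def \<kappa>)
  obtain e where e: "e > 0" "lg holomorphic_on ball (pathstart \<gamma>) e"
    using lg by (auto simp: log_branch_at_def analytic_on_def)
  obtain W where W: "open W" "pathstart \<gamma> \<in> W" "\<And>q. q \<in> W \<Longrightarrow> exp (lg q) = q"
    using lg by (auto simp: log_branch_at_def eventually_nhds)
  define U where "U = ball (pathstart \<gamma>) e \<inter> W \<inter> ball 0 (1 / \<kappa>) \<inter> S"
  define Y where "Y = (\<lambda>j q. fps_nth (frobenius_series 0 ((theta 0 ^^ j) C) (lg q)) n)"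
  have U: "open U" "pathstart \<gamma> \<in> U" using e W S q0 by (auto simp: U_def)
  have "ode_solution 4 (companion b) Y U"
    unfolding Y_def
    by (rule frobenius_series_solution_at_0[where b = b, OF C b4 recC n U(1)])
      (use e W in \<open>auto simp: U_def S_def intro: holomorphic_on_subset\<close>)
  from ode_continuation_along_path[where n = 4 and A = "companion b", OF S A q0(4,3) this U]
  obtain Z V where Z: "open V" "1 \<in> V" "ode_solution 4 (companion b) Z V"
    "\<And>i. i < 4 \<Longrightarrow> continuation_along \<gamma> (Y i) (Z i)"
    unfolding q0(5) by blast
  \<comment> \<open>On the disc of this radius around \<open>1\<close> both \<open>1 / \<kappa> < cmod q\<close> and \<open>Re q > 0\<close> hold, so the\<close>
  \<comment> \<open>expansion at infinity converges there and \<open>Ln\<close> is holomorphic.\<close>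
  define \<delta> where "\<delta> = 1 - 1 / \<kappa>"
  have \<delta>: "\<delta> > 0" "\<delta> \<le> 1" using \<kappa> by (auto simp: \<delta>_def)
  have "1 \<noteq> b 4" using \<kappa> by (metis less_irrefl of_real_1 of_real_eq_iff)
  then have "open (V \<inter> S \<inter> ball 1 \<delta>)" "1 \<in> V \<inter> S \<inter> ball 1 \<delta>" using Z S \<delta> b4 by (auto simp: S_def field_simps)
  then obtain \<epsilon> where \<epsilon>: "\<epsilon> > 0" "ball 1 \<epsilon> \<subseteq> V \<inter> S \<inter> ball 1 \<delta>" by (rule openE)
  define D where "D = ball (1::complex) \<epsilon>"
  have D: "open D" "connected D" "1 \<in> D" "D \<subseteq> V" "D \<subseteq> S" "D \<subseteq> ball 1 \<delta>"
    using \<epsilon> by (auto simp: D_def intro: convex_connected)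
  have AD: "companion b i j holomorphic_on D" for i j by (rule holomorphic_on_subset[OF A D(5)])
  define X where "X = (\<lambda>i j q. (- 1) ^ j *
     fps_nth (frobenius_series (of_real (a i)) ((theta (of_real (a i)) ^^ j) (B i)) (- Ln q)) (m i))"
  have X: "ode_solution 4 (companion b) (X i) D" for i
    unfolding X_def
  proof (rule frobenius_series_solution_at_infinity[where b = b, OF B(1) b4 recB head])
    show "D \<subseteq> - {0, 1 / b 4}" using D(5) by (simp add: S_def)
    fix q assume "q \<in> D"
    then have q: "cmod (1 - q) < \<delta>" using D(6) by (auto simp: dist_norm)
    show "1 / \<kappa> < cmod q" using q norm_triangle_ineq2[of 1 "1 - q"] by (simp add: \<delta>_def)
    have "Re q > 0" using q \<delta> abs_Re_le_cmod[of "1 - q"] by simp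
    then show "q \<notin> \<real>\<^sub>\<le>\<^sub>0" by (auto simp: complex_nonpos_Reals_iff)
  qed (use \<kappa> in auto)
  have near: "\<forall>\<^sub>F x in nhds 0. exp (- x) \<in> D \<and> - Ln (exp (- x)) = (x::complex)"
  proof -
    have "open ((\<lambda>x::complex. exp (- x)) -` D)" by (intro open_vimage D continuous_intros)
    from eventually_nhds_in_open[OF this, of 0]
    have "\<forall>\<^sub>F x::complex in nhds 0. exp (- x) \<in> D" using D by simp
    moreover have "\<forall>\<^sub>F x::complex in nhds 0. x \<in> ball 0 pi" by (intro eventually_nhds_in_open) auto
    ultimately show ?thesis
    proof eventually_elim
      case (elim x)
      then have "\<bar>Im x\<bar> < pi" using abs_Im_le_cmod[of x] by simp
      then have "Ln (exp (- x)) = - x" by (intro Ln_exp) auto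
      then show ?case using elim by simp
    qed
  qed
  have X0: "X i 0 (exp (- x)) = fps_nth (frobenius_series (of_real (a i)) (B i) x) (m i)"
    if "- Ln (exp (- x)) = x" for i x by (simp add: X_def that)
  have indep: "c i = 0" if c: "\<And>j. j < 4 \<Longrightarrow> (\<Sum>k\<in>UNIV. c k * X k j 1) = 0" for c i
  proof (rule frobenius_series_independent[OF B \<kappa>(2) _ rk(2)])
    show "inj rk" using rk(1) by (simp add: bij_betw_def)
    show "\<forall>\<^sub>F x in nhds 0. (\<Sum>i\<in>UNIV. c i * fps_nth (frobenius_series (of_real (a i)) (B i) x) (m i)) = 0"
      using near
    proof eventually_elim
      case (elim x)
      have "ode_solution 4 (companion b) (\<lambda>j q. \<Sum>k\<in>UNIV. c k * X k j q) D"
        by (rule ode_solution_linear_combination) (rule X)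
      from ode_solution_unique[OF AD D(1,2) this D(3), where i = 0 and q = "exp (- x)"]
      have "(\<Sum>k\<in>UNIV. c k * X k 0 (exp (- x))) = 0" using c elim by auto
      then show ?case using elim by (simp add: X0)
    qed
  qed
  obtain c where c: "\<And>j. j < 4 \<Longrightarrow> (\<Sum>k\<in>UNIV. c k * X k j 1) = Z j 1"
    using independent_initial_values_span[OF rk(1), of "\<lambda>k j. X k j 1" "\<lambda>j. Z j 1"] indep by auto
  have "ode_solution 4 (companion b) (\<lambda>j q. Z j q - (\<Sum>k\<in>UNIV. c k * X k j q)) D"
    by (intro ode_solution_diff ode_solution_subset[OF Z(3) D(4)] ode_solution_linear_combination X)
  from ode_solution_unique[OF AD D(1,2) this D(3), where i = 0]
  have Z0: "Z 0 q = (\<Sum>k\<in>UNIV. c k * X k 0 q)" if "q \<in> D" for q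
    using c that by simp
  have "\<forall>\<^sub>F x in nhds 0. Z 0 (exp (- x)) =
        (\<Sum>i\<in>UNIV. c i * fps_nth (frobenius_series (of_real (a i)) (B i) x) (m i))"
    using near by eventually_elim (simp add: Z0 X0)
  moreover have "continuation_along \<gamma> (\<lambda>q. fps_nth (frobenius_series 0 C (lg q)) n) (Z 0)"
    using Z(4)[of 0] by (simp add: Y_def)
  ultimately show ?thesis by blast
qed

section \<open>Homogeneity in z\<close>

definition fps_scale :: "complex \<Rightarrow> complex fps \<Rightarrow> complex fps" where
  "fps_scale w f = fps_compose f (fps_const w * fps_X)"

lemma fps_scale_nth [simp]: "fps_nth (fps_scale w f) n = w ^ n * fps_nth f n"
  by (simp add: fps_scale_def fps_compose_linear)

lemma fps_scale_mult: "fps_scale w (f * g) = fps_scale w f * fps_scale w g"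
  by (simp add: fps_scale_def fps_compose_mult_distrib)

lemma fps_scale_power: "fps_scale w (f ^ n) = fps_scale w f ^ n"
  by (simp add: fps_scale_def fps_compose_power)

lemma fps_scale_lin: "fps_scale w (lin c b z) = fps_const (of_nat b * z) + fps_const (c * w) * fps_X"
  by (rule fps_ext) (auto simp: lin_def fps_X_def)

lemma fps_scale_lin_homogeneous: "fps_scale z (lin c b z) = fps_const z * lin c b 1"
  by (rule fps_ext) (auto simp: lin_def fps_X_def)

lemma fps_scale_exp: "fps_scale w (fps_exp t) = fps_exp (w * t)"
  by (rule fps_ext) (simp add: power_mult_distrib)

lemma fps_scale_const [simp]: "fps_scale w (fps_const c) = fps_const c"
  by (rule fps_ext) simp

lemma fps_scale_one [simp]: "fps_scale w 1 = 1"
  by (rule fps_ext) simp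

lemma fps_scale_scale: "fps_scale v (fps_scale w f) = fps_scale (v * w) f"
  by (rule fps_ext) (simp add: power_mult_distrib)

lemma lin_nth_0 [simp]: "fps_nth (lin c b z) 0 = of_nat b * z"
  by (simp add: lin_def)

lemma lin_nonzero: "b > 0 \<Longrightarrow> z \<noteq> 0 \<Longrightarrow> lin c b z \<noteq> 0"
  by (metis lin_nth_0 fps_zero_nth mult_eq_0_iff not_gr_zero of_nat_eq_0_iff)

text \<open>The I-functions are given by quotients of products; this is the step of their recurrences.\<close>

lemma fps_quotient_recurrence:
  fixes N D u v :: "complex fps"
  assumes "fps_nth D 0 \<noteq> 0" "fps_nth v 0 \<noteq> 0"
  shows "v * ((N * u) / (D * v)) = u * (N / D)"
proof -
  have "fps_nth (D * v) 0 \<noteq> 0" using assms by simp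
  then have "(N * u) / (D * v) = N * u * inverse (D * v)" by (rule fps_divide_unit)
  also have "inverse (D * v) = inverse D * inverse v" by (rule fps_inverse_mult)
  finally have "v * ((N * u) / (D * v)) = (v * inverse v) * (u * (N * inverse D))" by (simp add: mult_ac)
  also have "v * inverse v = 1" using assms(2) by (rule inverse_mult_eq_1')
  also have "N * inverse D = N / D" using assms(1) by (rule fps_divide_unit[symmetric])
  finally show ?thesis by simp
qed

lemma fps_prod_nth_0: "fps_nth (prod f A) 0 = (\<Prod>i\<in>A. fps_nth (f i) 0)"
  for f :: "'a \<Rightarrow> complex fps"
  by (induction A rule: infinite_finite_induct) auto

lemma residue_class_eq_range:
  fixes d s p :: nat
  assumes "s < p"
  shows "[d + 1 = s + 1] (mod p) \<longleftrightarrow> d \<in> range (\<lambda>k. p * k + s)"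
proof -
  have "[d + 1 = s + 1] (mod p) \<longleftrightarrow> d mod p = s"
    using assms by (simp only: cong_add_rcancel_nat) (simp add: cong_def)
  also have "\<dots> \<longleftrightarrow> d \<in> range (\<lambda>k. p * k + s)"
  proof
    assume "d mod p = s"
    then have "d = p * (d div p) + s" by (metis mult_div_mod_eq)
    then show "d \<in> range (\<lambda>k. p * k + s)" by (rule range_eqI)
  qed (use assms in auto)
  finally show ?thesis .
qed

text \<open>The substitution \<open>H = z X\<close> turns \<open>exp (H l / z)\<close> into \<open>exp (X l)\<close> and removes \<open>z\<close> from the
coefficients.\<close>

lemma GW_series_eq_frobenius_series:
  assumes C: "converges_below r C" and K: "\<And>d. fps_scale z (K d) = C d" and z: "z \<noteq> 0"
    and q: "cmod q < r" "exp l = q"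
  shows "fps_nth (fps_const z * fps_exp (l / z) * Abs_fps (\<lambda>n. suminf (\<lambda>d. q ^ d * fps_nth (K d) n))) n =
    z powi (1 - int n) * fps_nth (frobenius_series 0 C l) n"
proof -
  let ?S = "Abs_fps (\<lambda>n. suminf (\<lambda>d. q ^ d * fps_nth (K d) n))"
  have "fps_scale z ?S = fps_powser C q"
  proof (rule fps_ext)
    fix n
    have "(\<lambda>d. (fps_nth (C d) n * q ^ d) / z ^ n) sums (fps_nth (fps_powser C q) n / z ^ n)"
      by (intro sums_divide fps_powser_sums[OF C q(1)])
    also have "(\<lambda>d. (fps_nth (C d) n * q ^ d) / z ^ n) = (\<lambda>d. q ^ d * fps_nth (K d) n)"
      using z by (simp add: K[symmetric] fun_eq_iff)
    finally show "fps_nth (fps_scale z ?S) n = fps_nth (fps_powser C q) n"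
      using z by (simp add: sums_iff)
  qed
  then have "fps_scale z (fps_const z * fps_exp (l / z) * ?S) = fps_const z * frobenius_series 0 C l"
    using z q by (simp add: fps_scale_mult fps_scale_exp frobenius_series_def mult.assoc)
  then have "z ^ n * fps_nth (fps_const z * fps_exp (l / z) * ?S) n = z * fps_nth (frobenius_series 0 C l) n"
    by (metis fps_scale_nth fps_mult_left_const_nth)
  then show ?thesis using z by (simp add: power_int_diff field_simps)
qed

lemma frobenius_series_sums:
  assumes "converges_below r C" "cmod (exp x) < r"
  shows "(\<lambda>k. exp ((of_nat k + a) * x) * fps_nth (fps_exp x * C k) n) sums fps_nth (frobenius_series a C x) n"
proof -
  have "(\<lambda>k. exp (a * x) * (fps_nth (fps_exp x * C k) n * exp x ^ k)) sums
     (exp (a * x) * fps_nth (fps_powser (\<lambda>k. fps_exp x * C k) (exp x)) n)"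
    by (intro sums_mult fps_powser_sums[OF converges_below_mult_left[OF assms(1)] assms(2)])
  moreover have "exp (a * x) * (F * exp x ^ k) = exp ((of_nat k + a) * x) * F" for F k
    by (simp add: exp_add distrib_right exp_of_nat_mult)
  moreover have "fps_const (exp (a * x)) * fps_powser (\<lambda>k. fps_exp x * C k) (exp x) = frobenius_series a C x"
    by (simp add: fps_powser_mult_left[OF assms] frobenius_series_def mult.assoc)
  ultimately show ?thesis by (metis (no_types, lifting) fps_mult_left_const_nth sums_cong)
qed

text \<open>With \<open>x = p t\<close> and \<open>H = p z X\<close> the factor \<open>exp ((d + 1 + H / z) t)\<close> for \<open>d = p k + s\<close> becomes
\<open>exp ((k + (s + 1) / p + X) x)\<close>, which is the shape of a Frobenius series. The factor \<open>w k\<close> stands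
for the powers of \<open>3\<close> or \<open>2\<close> that the hybrid I-function contains explicitly, \<open>y\<close> for the power of \<open>z\<close>
that is common to all terms of a sector.\<close>

lemma hybrid_series_eq_frobenius_series:
  assumes B: "converges_below r B" "cmod (exp (of_nat p * t)) < r" and p: "p > 0" and z: "z \<noteq> 0"
    and R: "\<And>k. fps_scale (of_nat p * z) (R (p * k + s)) = fps_const (w k * y) * B k"
    and w: "\<And>k. w k \<noteq> 0"
    and P: "\<And>d. P d \<longleftrightarrow> d \<in> range (\<lambda>k. p * k + s)"
    and T: "\<And>k. T (p * k + s) =
      fps_const (z * exp (of_nat (p * k + s + 1) * t) / w k) * fps_exp (t / z) * R (p * k + s)"
  shows "suminf (\<lambda>d. if P d then fps_nth (T d) n else 0) =
    z * y / (of_nat p * z) ^ n * fps_nth (frobenius_series (of_nat (s + 1) / of_nat p) B (of_nat p * t)) n"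
proof -
  let ?g = "\<lambda>k. p * k + s" and ?a = "of_nat (s + 1) / of_nat p :: complex" and ?x = "of_nat p * t"
  have T': "fps_nth (T (?g k)) n = z * y / (of_nat p * z) ^ n *
      (exp ((of_nat k + ?a) * ?x) * fps_nth (fps_exp ?x * B k) n)" for k
  proof -
    have "fps_scale (of_nat p * z) (T (?g k)) =
       fps_const (z * exp (of_nat (p * k + s + 1) * t) / w k) * fps_exp ?x * (fps_const (w k * y) * B k)"
      unfolding T fps_scale_mult R fps_scale_exp fps_scale_const using z by simp
    also have "\<dots> = fps_const (z * exp (of_nat (p * k + s + 1) * t) / w k) * (fps_const (w k * y) * (fps_exp ?x * B k))"
      by (simp only: mult_ac)
    also have "\<dots> = fps_const (z * y * exp ((of_nat k + ?a) * ?x)) * (fps_exp ?x * B k)"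
    proof -
      have "of_nat (p * k + s + 1) * t = (of_nat k + ?a) * ?x" using p by (simp add: field_simps)
      then have "z * exp (of_nat (p * k + s + 1) * t) / w k * (w k * y) = z * y * exp ((of_nat k + ?a) * ?x)"
        using w[of k] by (simp add: field_simps del: of_nat_add of_nat_mult)
      then show ?thesis by (simp only: mult.assoc[symmetric] fps_const_mult)
    qed
    finally have "(of_nat p * z) ^ n * fps_nth (T (?g k)) n =
       z * y * exp ((of_nat k + ?a) * ?x) * fps_nth (fps_exp ?x * B k) n"
      by (metis fps_scale_nth fps_mult_left_const_nth)
    then show ?thesis using z p by (simp add: field_simps)
  qed
  have Pg: "P (?g k)" for k unfolding P by (rule rangeI)
  have "strict_mono ?g" using p by (auto simp: strict_mono_def)
  moreover have "(\<lambda>k. if P (?g k) then fps_nth (T (?g k)) n else 0) sums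
     (z * y / (of_nat p * z) ^ n * fps_nth (frobenius_series ?a B ?x) n)"
    using sums_mult[OF frobenius_series_sums[OF B, of ?a n], of "z * y / (of_nat p * z) ^ n"]
    by (simp only: Pg if_True T')
  ultimately have "(\<lambda>d. if P d then fps_nth (T d) n else 0) sums
     (z * y / (of_nat p * z) ^ n * fps_nth (frobenius_series ?a B ?x) n)"
    by (subst (asm) sums_mono_reindex) (auto simp: P)
  then show ?thesis by (simp add: sums_iff)
qed

section \<open>Graded maps\<close>

lemma laurent_eval_superset:
  assumes "finite K" "Poly_Mapping.keys p \<subseteq> K"
  shows "laurent_eval z p = (\<Sum>k\<in>K. Poly_Mapping.lookup p k * z powi k)"
  unfolding laurent_eval_def using assms
  by (intro sum.mono_neutral_left) (auto simp: in_keys_iff)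

lemma laurent_eval_add: "laurent_eval z (p + q) = laurent_eval z p + laurent_eval z q"
proof -
  let ?K = "Poly_Mapping.keys p \<union> Poly_Mapping.keys q"
  have "laurent_eval z (p + q) = (\<Sum>k\<in>?K. Poly_Mapping.lookup (p + q) k * z powi k)"
    by (rule laurent_eval_superset) (use Poly_Mapping.keys_add[of p q] in auto)
  also have "\<dots> = laurent_eval z p + laurent_eval z q"
    by (simp add: laurent_eval_superset[of ?K] lookup_add distrib_right sum.distrib)
  finally show ?thesis .
qed

lemma laurent_eval_sum: "laurent_eval z (\<Sum>i\<in>I. f i) = (\<Sum>i\<in>I. laurent_eval z (f i))"
  by (induction I rule: infinite_finite_induct)
     (simp_all add: laurent_eval_add, simp_all add: laurent_eval_def)

lemma laurent_eval_single: "laurent_eval z (Poly_Mapping.single k c) = c * z powi k"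
  by (cases "c = 0") (auto simp: laurent_eval_def)

text \<open>Degrees leave one possible power of \<open>z\<close> for each matrix entry: \<open>z^(e i - h)\<close> where \<open>2 e i\<close> is the
degree of the basis element \<open>i\<close> and \<open>2 h\<close> that of \<open>H^h\<close>.\<close>

definition graded_map :: "('b :: finite \<Rightarrow> int) \<Rightarrow> (hpow \<Rightarrow> 'b \<Rightarrow> complex) \<Rightarrow> complex ^ 'b \<Rightarrow> H_GW_laurent" where
  "graded_map e c v = (\<chi> h. \<Sum>i\<in>UNIV. Poly_Mapping.single (e i - int (hexp h)) (c h i * v $ i))"

lemma graded_map_degree_preserving:
  fixes e :: "'b :: finite \<Rightarrow> int"
  assumes "\<And>i. deg i = 2 * e i"
  shows "degree_preserving_linear deg (graded_map e c)"
  unfolding degree_preserving_linear_def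
proof (intro conjI allI impI)
  interpret L: vector_space "laurent_scale"
    by unfold_locales
      (auto simp: laurent_scale_def vec_eq_iff algebra_simps single_add mult_single)
  have "graded_map e c (v + w) = graded_map e c v + graded_map e c w" for v w
    by (simp add: graded_map_def vec_eq_iff distrib_left single_add sum.distrib)
  moreover have "graded_map e c (r *s v) = laurent_scale r (graded_map e c v)" for r v
    by (simp add: graded_map_def laurent_scale_def vec_eq_iff sum_distrib_left mult_single mult_ac)
  ultimately show "Vector_Spaces.linear (*s) laurent_scale (graded_map e c)"
    by unfold_locales auto
next
  fix d and v :: "complex ^ 'b" assume v: "homogeneous deg d v"
  show "laurent_homogeneous d (graded_map e c v)"
    unfolding laurent_homogeneous_def
  proof (intro allI impI)
    fix h k assume "Poly_Mapping.lookup (graded_map e c v $ h) k \<noteq> 0"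
    then have "(\<Sum>i\<in>UNIV. Poly_Mapping.lookup (Poly_Mapping.single (e i - int (hexp h)) (c h i * v $ i)) k) \<noteq> 0"
      by (simp add: graded_map_def lookup_sum)
    then obtain i where "Poly_Mapping.lookup (Poly_Mapping.single (e i - int (hexp h)) (c h i * v $ i)) k \<noteq> 0"
      by (meson sum.neutral)
    then have "k = e i - int (hexp h)" "v $ i \<noteq> 0"
      by (auto simp: lookup_single when_def split: if_splits)
    moreover have "deg i = d" using v \<open>v $ i \<noteq> 0\<close> by (simp add: homogeneous_def)
    ultimately show "hpow_deg h + 2 * k = d" using assms[of i] by (simp add: hpow_deg_def)
  qed
qed

lemma eval_at_graded_map:
  "eval_at z (graded_map e c v) $ h = (\<Sum>i\<in>UNIV. c h i * v $ i * z powi (e i - int (hexp h)))"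
  by (simp add: eval_at_def graded_map_def laurent_eval_sum laurent_eval_single)

text \<open>The powers of \<open>z\<close> in both I-functions are those that make the matrix entries \<open>c h i z^(e i - h) / k i\<close>
convert one into the other for all \<open>z\<close>, once \<open>c\<close> does so for the functions without \<open>z\<close>. The
constants \<open>k i\<close> allow for the numerical factor between \<open>H\<close> and \<open>z X\<close> in the hybrid I-functions.\<close>

lemma transformation_from_connection:
  fixes e :: "'b :: finite \<Rightarrow> int" and k :: "'b \<Rightarrow> complex" and v :: "'b \<Rightarrow> complex \<Rightarrow> complex"
    and w :: "hpow \<Rightarrow> complex \<Rightarrow> complex" and p :: complex
  assumes deg: "\<And>i. deg i = 2 * e i" and k: "\<And>i. k i \<noteq> 0"
    and hyb: "\<And>z. z \<noteq> 0 \<Longrightarrow> \<forall>\<^sub>F t in nhds 0. \<forall>i. I t z $ i = z powi (1 - e i) * k i * v i (p * t)"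
    and GW: "\<And>z. z \<noteq> 0 \<Longrightarrow> \<forall>\<^sub>F q in nhds (pathstart \<gamma>). \<forall>h. J q z $ h = z powi (1 - int (hexp h)) * w h q"
    and conn: "\<And>h. \<exists>G c. continuation_along \<gamma> (w h) G \<and>
      (\<forall>\<^sub>F x in nhds 0. G (exp (- x)) = (\<Sum>i\<in>UNIV. c i * v i x))"
  shows "\<exists>U :: complex ^ 'b \<Rightarrow> H_GW_laurent. degree_preserving_linear deg U \<and>
    (\<forall>z. z \<noteq> 0 \<longrightarrow> (\<exists>G. continuation_along_vec \<gamma> (\<lambda>q. J q z) G \<and>
       (\<forall>\<^sub>F t in nhds 0. eval_at z (U (I t z)) = G (inverse (exp (p * t))))))"
proof -
  obtain G c where G: "\<And>h. continuation_along \<gamma> (w h) (G h)"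
    and c: "\<And>h. \<forall>\<^sub>F x in nhds 0. G h (exp (- x)) = (\<Sum>i\<in>UNIV. c h i * v i x)"
    using conn by metis
  define U where "U = graded_map e (\<lambda>h i. c h i / k i)"
  have "\<exists>G. continuation_along_vec \<gamma> (\<lambda>q. J q z) G \<and>
       (\<forall>\<^sub>F t in nhds 0. eval_at z (U (I t z)) = G (inverse (exp (p * t))))" if z: "z \<noteq> 0" for z
  proof (intro exI conjI)
    let ?G = "\<lambda>q. \<chi> h. z powi (1 - int (hexp h)) * G h q"
    show "continuation_along_vec \<gamma> (\<lambda>q. J q z) ?G"
      unfolding continuation_along_vec_def
    proof
      fix h
      have "continuation_along \<gamma> (\<lambda>q. z powi (1 - int (hexp h)) * w h q) (\<lambda>q. z powi (1 - int (hexp h)) * G h q)"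
        by (rule continuation_along_cmult[OF G])
      moreover have "\<forall>\<^sub>F q in nhds (pathstart \<gamma>). z powi (1 - int (hexp h)) * w h q = J q z $ h"
        using GW[OF z] by eventually_elim simp
      ultimately show "continuation_along \<gamma> (\<lambda>q. J q z $ h) (\<lambda>q. ?G q $ h)"
        using continuation_along_cong_start by simp
    qed
    have "\<forall>\<^sub>F x in nhds 0. \<forall>h. G h (exp (- x)) = (\<Sum>i\<in>UNIV. c h i * v i x)"
      using c by (intro eventually_all_finite)
    moreover have "filterlim (\<lambda>t. p * t) (nhds 0) (nhds 0)"
    proof -
      have "((\<lambda>t. p * t) \<longlongrightarrow> p * 0) (at 0)" by (intro tendsto_intros)
      then show ?thesis using tendsto_at_iff_tendsto_nhds[of "\<lambda>t. p * t" 0] by simp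
    qed
    ultimately have "\<forall>\<^sub>F t in nhds 0. \<forall>h. G h (exp (- (p * t))) = (\<Sum>i\<in>UNIV. c h i * v i (p * t))"
      by (rule eventually_compose_filterlim)
    then show "\<forall>\<^sub>F t in nhds 0. eval_at z (U (I t z)) = ?G (inverse (exp (p * t)))"
      using hyb[OF z]
    proof eventually_elim
      case (elim t)
      have "eval_at z (U (I t z)) $ h = z powi (1 - int (hexp h)) * G h (exp (- (p * t)))" for h
      proof -
        have "eval_at z (U (I t z)) $ h =
            (\<Sum>i\<in>UNIV. c h i / k i * (z powi (1 - e i) * k i * v i (p * t)) * z powi (e i - int (hexp h)))"
          using elim by (simp add: U_def eval_at_graded_map)
        also have "\<dots> = (\<Sum>i\<in>UNIV. z powi (1 - int (hexp h)) * (c h i * v i (p * t)))"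
        proof (rule sum.cong)
          fix i
          have "z powi (1 - e i) * z powi (e i - int (hexp h)) = z powi (1 - int (hexp h))"
            using z by (simp add: power_int_add[symmetric])
          moreover have "c h i / k i * (X * k i * V) * Y = (X * Y) * (c h i * V)" for X Y V
            using k[of i] by (simp add: field_simps)
          ultimately show "c h i / k i * (z powi (1 - e i) * k i * v i (p * t)) * z powi (e i - int (hexp h)) =
              z powi (1 - int (hexp h)) * (c h i * v i (p * t))"
            by (simp only:)
        qed simp
        also have "\<dots> = z powi (1 - int (hexp h)) * G h (exp (- (p * t)))"
          using elim by (simp add: sum_distrib_left)
        finally show ?thesis .
      qed
      then show ?case by (simp add: vec_eq_iff exp_minus)
    qed
  qed
  moreover have "degree_preserving_linear deg U"
    unfolding U_def by (rule graded_map_degree_preserving[OF deg])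
  ultimately show ?thesis by blast
qed

lemma continuation_path_start:
  assumes "continuation_path \<rho> \<gamma>" "log_branch_at lg (pathstart \<gamma>)"
  shows "\<forall>\<^sub>F q in nhds (pathstart \<gamma>). cmod q < \<rho> \<and> exp (lg q) = q"
proof -
  have "\<forall>\<^sub>F q in nhds (pathstart \<gamma>). q \<in> ball 0 \<rho>"
    using assms(1) by (intro eventually_nhds_in_open) (auto simp: continuation_path_def)
  moreover have "\<forall>\<^sub>F q in nhds (pathstart \<gamma>). exp (lg q) = q"
    using assms(2) by (simp add: log_branch_at_def)
  ultimately show ?thesis by eventually_elim simp
qed

lemma eventually_cmod_exp_less:
  assumes "r > 1"
  shows "\<forall>\<^sub>F t in nhds 0. cmod (exp (p * t)) < r"
proof -
  have "open {t. cmod (exp (p * t)) < r}" by (intro open_Collect_less continuous_intros)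
  from eventually_nhds_in_open[OF this, of 0] show ?thesis using assms by simp
qed

lemma hexp_less: "hexp h < 4"
  by (cases h) auto

section \<open>The cubic case\<close>

lemma cubic_GW_coeff_0: "cubic_GW_coeff 0 z = 1"
  by (simp add: cubic_GW_coeff_def)

lemma cubic_cancel:
  "a ^ 6 * x = (p ^ 2 * r ^ 2 * (3 * a) ^ 2) * y \<Longrightarrow> a ^ 2 * (a ^ 4 * x) = a ^ 2 * (9 * p ^ 2 * r ^ 2 * y)"
  for a :: "'a::idom"
  by algebra

lemma cubic_rescale:
  "(w * a) ^ 4 * x = n * (w * p) ^ 2 * (w * r) ^ 2 * y \<Longrightarrow> w ^ 4 * (a ^ 4 * x) = w ^ 4 * (n * p ^ 2 * r ^ 2 * y)"
  for a :: "'a::idom"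
  by algebra

lemma cubic_symbol_factorization:
  "36 + 324 * s + 1053 * s ^ 2 + 1458 * s ^ 3 + 729 * s ^ 4 = 9 * (3 * s + 1) ^ 2 * (3 * s + 2) ^ 2"
  for s :: "'a::idom"
  by algebra

lemma cubic_symbol_reflection:
  "9 * (3 * (- s) + 1) ^ 2 * (3 * (- s) + 2) ^ 2 = 9 * (3 * s - 1) ^ 2 * (3 * s - 2) ^ 2"
  for s :: "'a::idom"
  by algebra

lemma cubic_GW_coeff_Suc:
  assumes z: "z \<noteq> 0"
  shows "lin 1 (Suc d) z ^ 4 * cubic_GW_coeff (Suc d) z =
     9 * lin 3 (3 * d + 1) z ^ 2 * lin 3 (3 * d + 2) z ^ 2 * cubic_GW_coeff d z"
proof -
  let ?u = "(lin 3 (3*d+1) z)^2 * (lin 3 (3*d+2) z)^2 * (lin 3 (3*d+3) z)^2" and ?v = "(lin 1 (Suc d) z) ^ 6"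
  have N: "(\<Prod>b=1..3*Suc d. (lin 3 b z)^2) = (\<Prod>b=1..3*d. (lin 3 b z)^2) * ?u"
    by (simp add: eval_nat_numeral mult.assoc)
  have D: "(\<Prod>b=1..Suc d. (lin 1 b z)^6) = (\<Prod>b=1..d. (lin 1 b z)^6) * ?v" by simp
  have "?v * cubic_GW_coeff (Suc d) z = ?u * cubic_GW_coeff d z"
    unfolding cubic_GW_coeff_def N D
    by (rule fps_quotient_recurrence) (use z in \<open>auto simp: fps_prod_nth_0 fps_power_zeroth simp del: of_nat_Suc\<close>)
  \<comment> \<open>The factor \<open>3 H + (3 d + 3) z\<close> is a multiple of the new denominator factor, which leaves a fourth power.\<close>
  moreover have "lin 3 (3*d+3) z = 3 * lin 1 (Suc d) z"
    by (simp add: lin_def algebra_simps numeral_fps_const fps_const_add[symmetric] del: fps_const_add)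
  ultimately have "lin 1 (Suc d) z ^ 6 * cubic_GW_coeff (Suc d) z =
     (lin 3 (3*d+1) z)^2 * (lin 3 (3*d+2) z)^2 * (3 * lin 1 (Suc d) z)^2 * cubic_GW_coeff d z" by simp
  then have "lin 1 (Suc d) z ^ 2 * (lin 1 (Suc d) z ^ 4 * cubic_GW_coeff (Suc d) z) =
     lin 1 (Suc d) z ^ 2 * (9 * lin 3 (3 * d + 1) z ^ 2 * lin 3 (3 * d + 2) z ^ 2 * cubic_GW_coeff d z)"
    by (rule cubic_cancel)
  moreover have "lin 1 (Suc d) z ^ 2 \<noteq> 0" using lin_nonzero[of "Suc d" z 1] z by simp
  ultimately show ?thesis by (metis mult_left_cancel)
qed

lemma cubic_GW_coeff_homogeneous:
  assumes z: "z \<noteq> 0"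
  shows "fps_scale z (cubic_GW_coeff d z) = cubic_GW_coeff d 1"
proof (induction d)
  case (Suc d)
  have "fps_scale z (lin 1 (Suc d) z ^ 4 * cubic_GW_coeff (Suc d) z) =
     fps_scale z (9 * lin 3 (3 * d + 1) z ^ 2 * lin 3 (3 * d + 2) z ^ 2 * cubic_GW_coeff d z)"
    by (simp only: cubic_GW_coeff_Suc[OF z])
  then have "fps_const z ^ 4 * (lin 1 (Suc d) 1 ^ 4 * fps_scale z (cubic_GW_coeff (Suc d) z)) =
     fps_const z ^ 4 * (9 * lin 3 (3 * d + 1) 1 ^ 2 * lin 3 (3 * d + 2) 1 ^ 2 * cubic_GW_coeff d 1)"
    unfolding fps_scale_mult fps_scale_power fps_scale_lin_homogeneous Suc numeral_fps_const fps_scale_const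
    by (rule cubic_rescale)
  also have "9 * lin 3 (3 * d + 1) 1 ^ 2 * lin 3 (3 * d + 2) 1 ^ 2 * cubic_GW_coeff d 1 =
      lin 1 (Suc d) 1 ^ 4 * cubic_GW_coeff (Suc d) 1"
    by (rule cubic_GW_coeff_Suc[symmetric]) simp
  finally show ?case using z lin_nonzero[of "Suc d" 1 1] by simp
qed (simp add: cubic_GW_coeff_0)

text \<open>The coefficients of \<open>9 (3s + 1)^2 (3s + 2)^2 = 3^6 (s + 1/3)^2 (s + 2/3)^2\<close>.\<close>

definition cubic_symbol :: "nat \<Rightarrow> complex" where
  "cubic_symbol j = [36, 324, 1053, 1458, 729] ! j"

lemma quartic_eval_cubic_symbol: "quartic_eval cubic_symbol s = 9 * (3 * s + 1) ^ 2 * (3 * s + 2) ^ 2"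
proof -
  have "quartic_eval cubic_symbol s = 36 + 324 * s + 1053 * s ^ 2 + 1458 * s ^ 3 + 729 * s ^ 4"
    by (simp add: quartic_eval_def cubic_symbol_def eval_nat_numeral flip: numeral_fps_const)
  then show ?thesis by (simp only: cubic_symbol_factorization)
qed

lemma quartic_eval_cubic_symbol_uminus:
  "quartic_eval (\<lambda>j. (- 1) ^ j * cubic_symbol j) s = 9 * (3 * s - 1) ^ 2 * (3 * s - 2) ^ 2"
  unfolding quartic_eval_reflect quartic_eval_cubic_symbol by (rule cubic_symbol_reflection)

lemma cubic_GW_recurrence:
  "(fps_const (of_nat (Suc k)) + fps_X) ^ 4 * cubic_GW_coeff (Suc k) 1 =
     quartic_eval cubic_symbol (fps_const (of_nat k) + fps_X) * cubic_GW_coeff k 1"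
proof -
  have "3 * (fps_const (of_nat k) + fps_X) + 1 = lin 3 (3 * k + 1) 1"
       "3 * (fps_const (of_nat k) + fps_X) + 2 = lin 3 (3 * k + 2) 1"
       "fps_const (of_nat (Suc k)) + fps_X = lin 1 (Suc k) 1"
    by (rule fps_ext; auto simp: lin_def fps_X_def numeral_fps_const)+
  then show ?thesis using cubic_GW_coeff_Suc[of 1 k] by (simp only: quartic_eval_cubic_symbol mult.assoc) simp
qed

lemma cubic_GW_converges: "converges_below (1 / 729) (\<lambda>k. cubic_GW_coeff k 1)"
proof (rule converges_below_ratio)
  fix N k :: nat assume k: "k \<ge> 1"
  let ?C = "\<lambda>k. cubic_GW_coeff k 1"
  have lin: "lin c b 1 = fps_const (of_nat b) + fps_const c * fps_X" for c b by (simp add: lin_def add.commute)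
  have "real k ^ 4 * fps_norm N (?C (Suc k)) \<le> fps_norm N (lin 1 (Suc k) 1 ^ 4 * ?C (Suc k))"
    using fps_norm_linear_power_lower[of 1 "of_nat (Suc k)" 4 N "?C (Suc k)"] unfolding lin norm_of_nat by simp
  also have "\<dots> = fps_norm N (fps_const 9 * (lin 3 (3 * k + 1) 1 ^ 2 * (lin 3 (3 * k + 2) 1 ^ 2 * ?C k)))"
    unfolding numeral_fps_const[symmetric] by (simp add: cubic_GW_coeff_Suc mult.assoc)
  also have "\<dots> \<le> 9 * ((real (3 * k + 1) + 3) ^ 2 * ((real (3 * k + 2) + 3) ^ 2 * fps_norm N (?C k)))"
    unfolding fps_norm_const_mult lin
    using order_trans[OF fps_norm_linear_power_upper[of N "of_nat (3 * k + 1)" 3 2]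
        mult_left_mono[OF fps_norm_linear_power_upper[of N "of_nat (3 * k + 2)" 3 2 "?C k"]]]
    unfolding norm_of_nat by simp
  finally show "real k ^ 4 * fps_norm N (?C (Suc k)) \<le>
      (9 * (real (3 * k + 1) + 3) ^ 2 * (real (3 * k + 2) + 3) ^ 2) * fps_norm N (?C k)"
    by (simp add: mult.assoc)
next
  show "(\<lambda>k. (9 * (real (3 * k + 1) + 3) ^ 2 * (real (3 * k + 2) + 3) ^ 2) / real k ^ 4) \<longlonglongrightarrow> 729"
    by real_asymp
qed auto

definition cubic_hyb_coeff :: "nat \<Rightarrow> complex \<Rightarrow> complex fps" where
  "cubic_hyb_coeff d z =
     (\<Prod>b\<in>{b\<in>{1..d}. [b = d + 1] (mod 3)}. (lin 1 b z)^4) /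
     (\<Prod>b\<in>{b\<in>{1..d}. \<not> [b = d + 1] (mod 3)}. (lin 1 b z)^2)"

text \<open>Increasing \<open>d\<close> by \<open>3\<close> preserves the residue class of \<open>d + 1\<close>, so the two products only acquire the
factors with \<open>b = d + 1\<close> and with \<open>b = d + 2, d + 3\<close>.\<close>

lemma cubic_hyb_coeff_step:
  assumes z: "z \<noteq> 0"
  shows "(lin 1 (d + 2) z ^ 2 * lin 1 (d + 3) z ^ 2) * cubic_hyb_coeff (d + 3) z =
    lin 1 (d + 1) z ^ 4 * cubic_hyb_coeff d z"
proof -
  have shift: "[b = d + 3 + 1] (mod 3) \<longleftrightarrow> [b = d + 1] (mod 3)" for b
  proof -
    have "(d + 3 + 1) mod 3 = (d + 1) mod 3" by presburger
    then show ?thesis by (simp only: cong_def)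
  qed
  have ivl: "{1..d+3} = insert (d + 1) (insert (d + 2) (insert (d + 3) {1..d}))" by auto
  have "\<not> [d + 2 = d + 1] (mod 3)" "\<not> [d + 3 = d + 1] (mod 3)"
    unfolding cong_def by presburger+
  then have "{b\<in>{1..d+3}. [b = d + 1] (mod 3)} = insert (d + 1) {b\<in>{1..d}. [b = d + 1] (mod 3)}"
    and "{b\<in>{1..d+3}. \<not> [b = d + 1] (mod 3)} =
      insert (d + 2) (insert (d + 3) {b\<in>{1..d}. \<not> [b = d + 1] (mod 3)})"
    unfolding ivl by auto
  then have "cubic_hyb_coeff (d + 3) z =
     ((\<Prod>b\<in>{b\<in>{1..d}. [b = d + 1] (mod 3)}. (lin 1 b z)^4) * lin 1 (d + 1) z ^ 4) /
     ((\<Prod>b\<in>{b\<in>{1..d}. \<not> [b = d + 1] (mod 3)}. (lin 1 b z)^2) * (lin 1 (d + 2) z ^ 2 * lin 1 (d + 3) z ^ 2))"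
    unfolding cubic_hyb_coeff_def shift by (simp add: mult_ac)
  then show ?thesis
    unfolding cubic_hyb_coeff_def[of d]
    by (simp only:) (rule fps_quotient_recurrence,
        use z in \<open>auto simp: fps_prod_nth_0 fps_power_zeroth simp del: of_nat_Suc of_nat_add\<close>)
qed

lemma cubic_hyb_coeff_0: "cubic_hyb_coeff 0 z = 1"
  by (simp add: cubic_hyb_coeff_def)

lemma cubic_hyb_coeff_1:
  assumes "z \<noteq> 0"
  shows "lin 1 1 z ^ 2 * cubic_hyb_coeff 1 z = 1"
proof -
  have "{b\<in>{1..1::nat}. [b = 1 + 1] (mod 3)} = {}" "{b\<in>{1..1::nat}. \<not> [b = 1 + 1] (mod 3)} = {1}"
    by (auto simp: cong_def)
  then have "cubic_hyb_coeff 1 z = 1 / lin 1 1 z ^ 2" by (simp only: cubic_hyb_coeff_def) simp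
  then show ?thesis
    using assms fps_quotient_recurrence[of 1 "lin 1 1 z ^ 2" 1 1] by (simp add: fps_power_zeroth)
qed

lemma cubic_hyb_rescale:
  "(w * p)^2 * (w * r)^2 * x = (w * a)^4 * y \<Longrightarrow> w^4 * (p^2 * r^2 * x) = w^4 * (a^4 * y)" for a :: "'a::idom"
  by algebra

text \<open>The factors of numerator and denominator balance for \<open>s = 0\<close>; for \<open>s = 1\<close> the denominator has an
additional square, which reflects the degree shift by \<open>4\<close> of the second sector.\<close>

lemma cubic_hyb_coeff_homogeneous:
  assumes z: "z \<noteq> 0" and s: "s < 2"
  shows "fps_scale z (cubic_hyb_coeff (3 * k + s) z) = fps_const (1 / z ^ (2 * s)) * cubic_hyb_coeff (3 * k + s) 1"
proof (induction k)
  case 0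
  consider "s = 0" | "s = 1" using s by linarith
  then show ?case
  proof cases
    case 1 then show ?thesis by (simp add: cubic_hyb_coeff_0)
  next
    case 2
    have "fps_scale z (lin 1 1 z ^ 2 * cubic_hyb_coeff 1 z) = 1"
      by (simp only: cubic_hyb_coeff_1[OF z] fps_scale_one)
    then have "lin 1 1 1 ^ 2 * (fps_const (z ^ 2) * fps_scale z (cubic_hyb_coeff 1 z)) = 1"
      unfolding fps_scale_mult fps_scale_power fps_scale_lin_homogeneous
      by (simp add: power_mult_distrib mult_ac)
    also have "1 = lin 1 1 1 ^ 2 * cubic_hyb_coeff 1 1" by (rule cubic_hyb_coeff_1[symmetric]) simp
    finally have eq: "fps_const (z ^ 2) * fps_scale z (cubic_hyb_coeff 1 z) = cubic_hyb_coeff 1 1"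
      using lin_nonzero[of 1 1 1] by simp
    have "fps_const (1 / z ^ 2) * (fps_const (z ^ 2) * fps_scale z (cubic_hyb_coeff 1 z)) =
        fps_scale z (cubic_hyb_coeff 1 z)"
      using z by (simp only: mult.assoc[symmetric] fps_const_mult) simp
    then show ?thesis using 2 unfolding eq by simp
  qed
next
  case (Suc k)
  let ?d = "3 * k + s"
  have "fps_scale z ((lin 1 (?d + 2) z ^ 2 * lin 1 (?d + 3) z ^ 2) * cubic_hyb_coeff (?d + 3) z) =
    fps_scale z (lin 1 (?d + 1) z ^ 4 * cubic_hyb_coeff ?d z)"
    by (simp only: cubic_hyb_coeff_step[OF z])
  then have "fps_const z ^ 4 * (lin 1 (?d + 2) 1 ^ 2 * lin 1 (?d + 3) 1 ^ 2 * fps_scale z (cubic_hyb_coeff (?d + 3) z)) =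
     fps_const z ^ 4 * (lin 1 (?d + 1) 1 ^ 4 * (fps_const (1 / z ^ (2 * s)) * cubic_hyb_coeff ?d 1))"
    unfolding fps_scale_mult fps_scale_power fps_scale_lin_homogeneous Suc by (rule cubic_hyb_rescale)
  also have "lin 1 (?d + 1) 1 ^ 4 * (fps_const (1 / z ^ (2 * s)) * cubic_hyb_coeff ?d 1) =
      fps_const (1 / z ^ (2 * s)) * (lin 1 (?d + 1) 1 ^ 4 * cubic_hyb_coeff ?d 1)" by (simp only: mult_ac)
  also have "lin 1 (?d + 1) 1 ^ 4 * cubic_hyb_coeff ?d 1 =
      (lin 1 (?d + 2) 1 ^ 2 * lin 1 (?d + 3) 1 ^ 2) * cubic_hyb_coeff (?d + 3) 1"
    by (rule cubic_hyb_coeff_step[symmetric]) simp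
  also have "fps_const (1 / z ^ (2 * s)) * (lin 1 (?d + 2) 1 ^ 2 * lin 1 (?d + 3) 1 ^ 2 * cubic_hyb_coeff (?d + 3) 1) =
     lin 1 (?d + 2) 1 ^ 2 * lin 1 (?d + 3) 1 ^ 2 * (fps_const (1 / z ^ (2 * s)) * cubic_hyb_coeff (?d + 3) 1)"
    by (simp only: mult_ac)
  finally have "fps_scale z (cubic_hyb_coeff (?d + 3) z) = fps_const (1 / z ^ (2 * s)) * cubic_hyb_coeff (?d + 3) 1"
    using z lin_nonzero[of "?d + 2" 1 1] lin_nonzero[of "?d + 3" 1 1]
    by (simp del: One_nat_def add_2_eq_Suc')
  then show ?case by (simp add: add.commute add.left_commute)
qed

text \<open>Coefficients in the variable \<open>X\<close> with \<open>H = 3 z X\<close>, at \<open>z = 1\<close>. The sector with index \<open>s + 1\<close>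
consists of the terms with \<open>d = 3 k + s\<close>.\<close>

definition cubic_hyb_frobenius :: "nat \<Rightarrow> nat \<Rightarrow> complex fps" where
  "cubic_hyb_frobenius s k = fps_const (1 / 3 ^ (6 * k)) * fps_scale 3 (cubic_hyb_coeff (3 * k + s) 1)"

lemma cubic_hyb_frobenius_Suc:
  "729 * (fps_const (of_nat (3 * k + s + 2)) + fps_const 3 * fps_X) ^ 2 *
     (fps_const (of_nat (3 * k + s + 3)) + fps_const 3 * fps_X) ^ 2 * cubic_hyb_frobenius s (Suc k) =
   (fps_const (of_nat (3 * k + s + 1)) + fps_const 3 * fps_X) ^ 4 * cubic_hyb_frobenius s k"
proof -
  let ?d = "3 * k + s"
  have "fps_scale 3 ((lin 1 (?d + 2) 1 ^ 2 * lin 1 (?d + 3) 1 ^ 2) * cubic_hyb_coeff (?d + 3) 1) =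
    fps_scale 3 (lin 1 (?d + 1) 1 ^ 4 * cubic_hyb_coeff ?d 1)"
    by (simp only: cubic_hyb_coeff_step[of 1] one_neq_zero not_False_eq_True)
  then have eq: "(fps_const (of_nat (?d + 2)) + fps_const 3 * fps_X) ^ 2 *
     (fps_const (of_nat (?d + 3)) + fps_const 3 * fps_X) ^ 2 * fps_scale 3 (cubic_hyb_coeff (?d + 3) 1) =
     (fps_const (of_nat (?d + 1)) + fps_const 3 * fps_X) ^ 4 * fps_scale 3 (cubic_hyb_coeff ?d 1)"
    unfolding fps_scale_mult fps_scale_power fps_scale_lin by (simp only: mult_1_left mult_1_right)
  have d: "3 * Suc k + s = ?d + 3" by simp
  have c: "729 * (fps_const (1 / 3 ^ (6 * Suc k)) * F) = fps_const (1 / 3 ^ (6 * k)) * F" for F :: "complex fps"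
    by (simp only: numeral_fps_const mult.assoc[symmetric] fps_const_mult) (simp add: power_add)
  have red: "729 * X ^ 2 * Y ^ 2 * cubic_hyb_frobenius s (Suc k) =
      fps_const (1 / 3 ^ (6 * k)) * (X ^ 2 * Y ^ 2 * fps_scale 3 (cubic_hyb_coeff (?d + 3) 1))" for X Y
  proof -
    have "729 * X ^ 2 * Y ^ 2 * cubic_hyb_frobenius s (Suc k) = 729 * (fps_const (1 / 3 ^ (6 * Suc k)) *
        (X ^ 2 * Y ^ 2 * fps_scale 3 (cubic_hyb_coeff (?d + 3) 1)))"
      unfolding cubic_hyb_frobenius_def d by (simp only: mult_ac)
    then show ?thesis unfolding c .
  qed
  show ?thesis unfolding red eq by (simp only: cubic_hyb_frobenius_def mult_ac)
qed

lemma power4_of_triple: "(3 * x) ^ 4 * y = 81 * (x ^ 4 * y)" for x :: "'a::comm_ring_1"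
  by (simp add: power_mult_distrib)

lemma cubic_hyb_recurrence:
  "quartic_eval (\<lambda>j. (- 1) ^ j * cubic_symbol j) (fps_const (of_nat (Suc k) + of_nat (s + 1) / 3) + fps_X) *
     cubic_hyb_frobenius s (Suc k) =
   (fps_const (of_nat k + of_nat (s + 1) / 3) + fps_X) ^ 4 * cubic_hyb_frobenius s k"
proof -
  let ?S = "fps_const (of_nat (Suc k) + of_nat (s + 1) / 3) + fps_X :: complex fps"
  let ?T = "fps_const (of_nat k + of_nat (s + 1) / 3) + fps_X :: complex fps"
  have S: "3 * ?S - 1 = fps_const (of_nat (3 * k + s + 3)) + fps_const 3 * fps_X"
    "3 * ?S - 2 = fps_const (of_nat (3 * k + s + 2)) + fps_const 3 * fps_X"
    "3 * ?T = fps_const (of_nat (3 * k + s + 1)) + fps_const 3 * fps_X"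
    by (rule fps_ext; auto simp: fps_X_def numeral_fps_const field_simps)+
  \<comment> \<open>The factor \<open>81 = 3^4\<close> clears the denominators of the exponents in the fourth power on the right.\<close>
  have "81 * (9 * (3 * ?S - 1) ^ 2 * (3 * ?S - 2) ^ 2 * cubic_hyb_frobenius s (Suc k)) =
      (3 * ?T) ^ 4 * cubic_hyb_frobenius s k"
    using cubic_hyb_frobenius_Suc[of k s] unfolding S[symmetric] by (simp add: mult_ac)
  also have "\<dots> = 81 * (?T ^ 4 * cubic_hyb_frobenius s k)" by (rule power4_of_triple)
  finally show ?thesis unfolding quartic_eval_cubic_symbol_uminus
    by (rule mult_left_cancel[THEN iffD1, rotated]) (rule numeral_neq_zero)
qed

lemma cubic_hyb_converges: "converges_below 729 (cubic_hyb_frobenius s)"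
proof -
  have "converges_below (1 / (1 / 729)) (cubic_hyb_frobenius s)"
  proof (rule converges_below_ratio)
    fix N k :: nat assume k: "k \<ge> 1"
    let ?F = "cubic_hyb_frobenius s"
    define u where "u = (\<lambda>b. fps_const (of_nat b) + fps_const (3 :: complex) * fps_X)"
    have low: "(real b - 3) ^ 2 * fps_norm N f \<le> fps_norm N (u b ^ 2 * f)" if "b \<ge> 3" for b f
      using fps_norm_linear_power_lower[of 3 "of_nat b" 2 N f] that unfolding u_def norm_of_nat by simp
    let ?p = "3 * k + s + 2" and ?r = "3 * k + s + 3"
    have "729 * ((real ?p - 3) ^ 2 * ((real ?r - 3) ^ 2 * fps_norm N (?F (Suc k)))) \<le>
        729 * ((real ?p - 3) ^ 2 * fps_norm N (u ?r ^ 2 * ?F (Suc k)))"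
      by (intro mult_left_mono low) auto
    also have "\<dots> \<le> 729 * fps_norm N (u ?p ^ 2 * (u ?r ^ 2 * ?F (Suc k)))"
      using k by (intro mult_left_mono low) auto
    also have "\<dots> = fps_norm N (729 * u ?p ^ 2 * u ?r ^ 2 * ?F (Suc k))"
      unfolding mult.assoc numeral_fps_const fps_norm_const_mult by simp
    also have "\<dots> = fps_norm N (u (3 * k + s + 1) ^ 4 * ?F k)"
      by (simp only: cubic_hyb_frobenius_Suc u_def)
    also have "\<dots> \<le> (real (3 * k + s + 1) + 3) ^ 4 * fps_norm N (?F k)"
      using fps_norm_linear_power_upper[of N "of_nat (3 * k + s + 1)" 3 4 "?F k"]
      unfolding u_def norm_of_nat by simp
    finally show "(729 * (real ?p - 3) ^ 2 * (real ?r - 3) ^ 2) * fps_norm N (?F (Suc k)) \<le>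
        (real (3 * k + s + 1) + 3) ^ 4 * fps_norm N (?F k)"
      by (simp only: mult.assoc)
    show "729 * (real ?p - 3) ^ 2 * (real ?r - 3) ^ 2 > 0" using k by simp
  next
    show "(\<lambda>k. (real (3 * k + s + 1) + 3) ^ 4 /
        (729 * (real (3 * k + s + 2) - 3) ^ 2 * (real (3 * k + s + 3) - 3) ^ 2)) \<longlonglongrightarrow> 1 / 729"
      by real_asymp
  qed simp
  then show ?thesis by simp
qed

text \<open>The exponents \<open>1/3\<close> and \<open>2/3\<close> at infinity are double roots of the indicial polynomial, so two
solutions belong to each sector.\<close>

lemma cubic_hyb_head:
  assumes "s < 2" "l \<le> 1"
  shows "fps_nth (quartic_eval (\<lambda>j. (- 1) ^ j * cubic_symbol j)
      (fps_const (of_nat (s + 1) / 3) + fps_X) * cubic_hyb_frobenius s 0) l = 0"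
proof -
  let ?S = "fps_const (of_nat (s + 1) / 3) + fps_X :: complex fps"
  have "3 * ?S = of_nat (s + 1) + 3 * fps_X"
    by (rule fps_ext) (auto simp: fps_X_def numeral_fps_const fps_of_nat[symmetric] simp del: of_nat_Suc of_nat_add)
  moreover consider "s = 0" | "s = 1" using assms(1) by linarith
  ultimately have "3 * ?S - 1 = 3 * fps_X \<or> 3 * ?S - 2 = 3 * fps_X" by cases auto
  moreover have "\<exists>G. 9 * A ^ 2 * B ^ 2 * F = fps_X ^ 2 * G" if "A = 3 * fps_X \<or> B = 3 * fps_X"
    for A B F :: "complex fps"
    using that
  proof
    assume "A = 3 * fps_X"
    then have "9 * A ^ 2 * B ^ 2 * F = fps_X ^ 2 * (81 * B ^ 2 * F)" by (simp add: power_mult_distrib mult_ac)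
    then show ?thesis ..
  next
    assume "B = 3 * fps_X"
    then have "9 * A ^ 2 * B ^ 2 * F = fps_X ^ 2 * (81 * A ^ 2 * F)" by (simp add: power_mult_distrib mult_ac)
    then show ?thesis ..
  qed
  ultimately obtain G where "9 * (3 * ?S - 1) ^ 2 * (3 * ?S - 2) ^ 2 * cubic_hyb_frobenius s 0 = fps_X ^ 2 * G"
    by metis
  then show ?thesis unfolding quartic_eval_cubic_symbol_uminus using assms(2) by (simp add: fps_X_power_mult_nth)
qed

lemma cubic_hyb_frobenius_0_nonzero:
  assumes "s < 2"
  shows "fps_nth (cubic_hyb_frobenius s 0) 0 \<noteq> 0"
proof -
  have "fps_nth (cubic_hyb_coeff 1 1) 0 \<noteq> 0"
  proof
    assume "fps_nth (cubic_hyb_coeff 1 1) 0 = 0"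
    then have "fps_nth (lin 1 1 1 ^ 2 * cubic_hyb_coeff 1 1) 0 = 0" by simp
    moreover have "lin 1 1 1 ^ 2 * cubic_hyb_coeff 1 1 = 1" by (rule cubic_hyb_coeff_1) simp
    ultimately show False by (metis fps_one_nth one_neq_zero)
  qed
  moreover have "fps_nth (cubic_hyb_coeff 0 1) 0 \<noteq> 0" by (simp add: cubic_hyb_coeff_0)
  moreover have "s = 0 \<or> s = 1" using assms by linarith
  ultimately have "fps_nth (cubic_hyb_coeff s 1) 0 \<noteq> 0" by blast
  then show ?thesis by (simp add: cubic_hyb_frobenius_def)
qed

lemma cubic_I_hyb_eq_frobenius_series:
  assumes z: "z \<noteq> 0" and t: "cmod (exp (3 * t)) < 729"
  shows "cubic_I_hyb t z $ i = z * (1 / z ^ (2 * (cubic_sector i - 1))) / (3 * z) ^ cubic_exp i *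
    fps_nth (frobenius_series (of_nat (cubic_sector i) / 3) (cubic_hyb_frobenius (cubic_sector i - 1)) (3 * t)) (cubic_exp i)"
proof -
  define s where "s = cubic_sector i - 1"
  have s: "s < 2" "cubic_sector i = s + 1" by (cases i; simp add: s_def)+
  have "suminf (\<lambda>d. if [d + 1 = s + 1] (mod 3) then fps_nth (cubic_hyb_term d t z) (cubic_exp i) else 0) =
    z * (1 / z ^ (2 * s)) / (of_nat 3 * z) ^ cubic_exp i *
      fps_nth (frobenius_series (of_nat (s + 1) / of_nat 3) (cubic_hyb_frobenius s) (of_nat 3 * t)) (cubic_exp i)"
  proof (rule hybrid_series_eq_frobenius_series[OF cubic_hyb_converges _ _ z,
        where R = "\<lambda>d. cubic_hyb_coeff d z" and w = "\<lambda>k. 3 ^ (6 * k)"])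
    show "fps_scale (of_nat 3 * z) (cubic_hyb_coeff (3 * k + s) z) =
        fps_const (3 ^ (6 * k) * (1 / z ^ (2 * s))) * cubic_hyb_frobenius s k" for k
    proof -
      have "fps_scale (of_nat 3 * z) (cubic_hyb_coeff (3 * k + s) z) =
          fps_scale 3 (fps_scale z (cubic_hyb_coeff (3 * k + s) z))" by (simp add: fps_scale_scale)
      also have "\<dots> = fps_const (1 / z ^ (2 * s)) * fps_scale 3 (cubic_hyb_coeff (3 * k + s) 1)"
        by (simp only: cubic_hyb_coeff_homogeneous[OF z s(1)] fps_scale_mult fps_scale_const)
      also have "\<dots> = fps_const (3 ^ (6 * k) * (1 / z ^ (2 * s))) * cubic_hyb_frobenius s k"
        unfolding cubic_hyb_frobenius_def by (simp only: mult.assoc[symmetric] fps_const_mult) simp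
      finally show ?thesis .
    qed
    show "[d + 1 = s + 1] (mod 3) \<longleftrightarrow> d \<in> range (\<lambda>k. 3 * k + s)" for d
      using s(1) by (intro residue_class_eq_range) simp
    show "cubic_hyb_term (3 * k + s) t z = fps_const (z * exp (of_nat (3 * k + s + 1) * t) / 3 ^ (6 * k)) *
        fps_exp (t / z) * cubic_hyb_coeff (3 * k + s) z" for k
    proof -
      have "(3 * k + s) div 3 = k" using s(1) by simp
      then show ?thesis by (simp only: cubic_hyb_term_def cubic_hyb_coeff_def)
    qed
  qed (use t in auto)
  then show ?thesis by (simp add: cubic_I_hyb_def s)
qed

text \<open>The order of growth for \<open>x \<rightarrow> -\<infinity>\<close>: the exponent \<open>1/3\<close> dominates \<open>2/3\<close>, and a logarithm dominates
its absence.\<close>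

primrec cubic_rank :: "cubic_basis \<Rightarrow> nat" where
  "cubic_rank One2 = 0"
| "cubic_rank Hyp2 = 1"
| "cubic_rank One1 = 2"
| "cubic_rank Hyp1 = 3"

lemma cubic_rank_bij: "bij_betw cubic_rank UNIV {..<4}"
  by (auto simp: bij_betw_def inj_on_def UNIV_cubic_basis lessThan_nat_numeral lessThan_Suc)

lemma cubic_rank_dominance:
  assumes "cubic_rank i < cubic_rank k"
  shows "((\<lambda>t::real. (exp (real (cubic_sector i) / 3 * t) * t ^ cubic_exp i) /
     (exp (real (cubic_sector k) / 3 * t) * t ^ cubic_exp k)) \<longlongrightarrow> 0) at_bot"
proof -
  have "(i, k) \<in> {(One2, Hyp2), (One2, One1), (One2, Hyp1), (Hyp2, One1), (Hyp2, Hyp1), (One1, Hyp1)}"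
    using assms by (cases i; cases k) simp_all
  then show ?thesis
    by (elim insertE emptyE; clarsimp simp only: prod.inject cubic_sector.simps cubic_exp.simps of_nat_1 of_nat_numeral;
        real_asymp)
qed

lemma cubic_transformation:
  assumes \<gamma>: "continuation_path (1 / 3 ^ 6) \<gamma>" and lg: "log_branch_at lg (pathstart \<gamma>)"
  shows "\<exists>U :: H_hyb_cubic \<Rightarrow> H_GW_laurent. degree_preserving_linear cubic_deg U \<and>
    (\<forall>z. z \<noteq> 0 \<longrightarrow> (\<exists>G. continuation_along_vec \<gamma> (\<lambda>q. cubic_I_GW lg q z) G \<and>
       (\<forall>\<^sub>F t in nhds 0. eval_at z (U (cubic_I_hyb t z)) = G (inverse (exp (3 * t))))))"
proof -
  define s where "s = (\<lambda>i. cubic_sector i - 1)"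
  have s: "s i < 2" "cubic_sector i = s i + 1" for i by (cases i; simp add: s_def)+
  let ?v = "\<lambda>i x. fps_nth (frobenius_series (of_real (real (cubic_sector i) / 3)) (cubic_hyb_frobenius (s i)) x) (cubic_exp i)"
  let ?w = "\<lambda>h q. fps_nth (frobenius_series 0 (\<lambda>k. cubic_GW_coeff k 1) (lg q)) (hexp h)"
  have \<gamma>': "continuation_path (1 / 729) \<gamma>" using \<gamma> by simp
  show ?thesis
  proof (rule transformation_from_connection[where e = "\<lambda>i. int (cubic_exp i) + 2 * int (s i)"
        and k = "\<lambda>i. 1 / 3 ^ cubic_exp i" and v = ?v and w = ?w])
    show "cubic_deg i = 2 * (int (cubic_exp i) + 2 * int (s i))" for i
      by (cases i) (auto simp: s_def)
  next
    fix z :: complex assume z: "z \<noteq> 0"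
    have "\<forall>\<^sub>F t in nhds 0. cmod (exp (3 * t)) < 729" by (rule eventually_cmod_exp_less) simp
    then show "\<forall>\<^sub>F t in nhds 0. \<forall>i. cubic_I_hyb t z $ i =
        z powi (1 - (int (cubic_exp i) + 2 * int (s i))) * (1 / 3 ^ cubic_exp i) * ?v i (3 * t)"
    proof eventually_elim
      case (elim t)
      have "z * (1 / z ^ (2 * s i)) / (3 * z) ^ cubic_exp i =
          z powi (1 - (int (cubic_exp i) + 2 * int (s i))) * (1 / 3 ^ cubic_exp i)" for i
        using z by (cases i) (simp_all add: s_def power_int_def field_simps eval_nat_numeral)
      then show ?case using cubic_I_hyb_eq_frobenius_series[OF z elim] by (simp add: s_def)
    qed
    show "\<forall>\<^sub>F q in nhds (pathstart \<gamma>). \<forall>h. cubic_I_GW lg q z $ h = z powi (1 - int (hexp h)) * ?w h q"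
      using continuation_path_start[OF \<gamma>' lg]
    proof eventually_elim
      case (elim q)
      then show ?case
        unfolding cubic_I_GW_def
        using GW_series_eq_frobenius_series[OF cubic_GW_converges cubic_GW_coeff_homogeneous[OF z] z] by simp
    qed
  next
    fix h
    show "\<exists>G c. continuation_along \<gamma> (?w h) G \<and>
        (\<forall>\<^sub>F x in nhds 0. G (exp (- x)) = (\<Sum>i\<in>UNIV. c i * ?v i x))"
    proof (rule frobenius_series_connection[where b = cubic_symbol and \<kappa> = 729 and rk = cubic_rank])
      show "quartic_eval (\<lambda>j. (- 1) ^ j * cubic_symbol j)
           (fps_const (of_nat (Suc k) + complex_of_real (real (cubic_sector i) / 3)) + fps_X) *
          cubic_hyb_frobenius (s i) (Suc k) =
         (fps_const (of_nat k + complex_of_real (real (cubic_sector i) / 3)) + fps_X) ^ 4 *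
          cubic_hyb_frobenius (s i) k" for i k
        using cubic_hyb_recurrence[of k "s i"] unfolding s(2)[symmetric] by simp
      show "fps_nth (quartic_eval (\<lambda>j. (- 1) ^ j * cubic_symbol j)
           (fps_const (complex_of_real (real (cubic_sector i) / 3)) + fps_X) *
          cubic_hyb_frobenius (s i) 0) l = 0" if "l \<le> cubic_exp i" for i l
      proof -
        have "l \<le> 1" using that by (cases i) auto
        then show ?thesis using cubic_hyb_head[OF s(1)[of i]] unfolding s(2)[symmetric] by simp
      qed
      show "cubic_symbol 4 = complex_of_real 729" by (simp add: cubic_symbol_def)
      show "(fps_const (of_nat (Suc k)) + fps_X) ^ 4 * cubic_GW_coeff (Suc k) 1 =
          quartic_eval cubic_symbol (fps_const (of_nat k) + fps_X) * cubic_GW_coeff k 1" for k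
        by (rule cubic_GW_recurrence)
      show "((\<lambda>t. exp (real (cubic_sector i) / 3 * t) * t ^ cubic_exp i /
          (exp (real (cubic_sector k) / 3 * t) * t ^ cubic_exp k)) \<longlongrightarrow> 0) at_bot"
        if "cubic_rank i < cubic_rank k" for i k by (rule cubic_rank_dominance[OF that])
      show "fps_nth (cubic_hyb_frobenius (s i) 0) 0 \<noteq> 0" for i
        by (rule cubic_hyb_frobenius_0_nonzero[OF s(1)])
    qed (use \<gamma>' lg in \<open>auto intro: cubic_GW_converges cubic_hyb_converges cubic_rank_bij hexp_less\<close>)
  qed auto
qed

section \<open>The quadric case\<close>

lemma quadric_GW_coeff_0: "quadric_GW_coeff 0 z = 1"
  by (simp add: quadric_GW_coeff_def)

lemma quadric_cancel:
  "a ^ 8 * x = (p ^ 4 * (2 * a) ^ 4) * y \<Longrightarrow> a ^ 4 * (a ^ 4 * x) = a ^ 4 * (16 * p ^ 4 * y)" for a :: "'a::idom"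
  by algebra

lemma quadric_GW_coeff_Suc:
  assumes z: "z \<noteq> 0"
  shows "lin 1 (Suc d) z ^ 4 * quadric_GW_coeff (Suc d) z = 16 * lin 2 (2 * d + 1) z ^ 4 * quadric_GW_coeff d z"
proof -
  let ?u = "(lin 2 (2*d+1) z)^4 * (lin 2 (2*d+2) z)^4" and ?v = "(lin 1 (Suc d) z) ^ 8"
  have N: "(\<Prod>b=1..2*Suc d. (lin 2 b z)^4) = (\<Prod>b=1..2*d. (lin 2 b z)^4) * ?u"
    by (simp add: mult.assoc)
  have D: "(\<Prod>b=1..Suc d. (lin 1 b z)^8) = (\<Prod>b=1..d. (lin 1 b z)^8) * ?v" by simp
  have "?v * quadric_GW_coeff (Suc d) z = ?u * quadric_GW_coeff d z"
    unfolding quadric_GW_coeff_def N D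
    by (rule fps_quotient_recurrence) (use z in \<open>auto simp: fps_prod_nth_0 fps_power_zeroth simp del: of_nat_Suc\<close>)
  \<comment> \<open>The factor \<open>2 H + (2 d + 2) z\<close> is a multiple of the new denominator factor, which leaves a fourth power.\<close>
  moreover have "lin 2 (2*d+2) z = 2 * lin 1 (Suc d) z"
    by (simp add: lin_def algebra_simps numeral_fps_const fps_const_add[symmetric] del: fps_const_add)
  ultimately have "lin 1 (Suc d) z ^ 8 * quadric_GW_coeff (Suc d) z =
     (lin 2 (2*d+1) z)^4 * (2 * lin 1 (Suc d) z)^4 * quadric_GW_coeff d z" by simp
  then have "lin 1 (Suc d) z ^ 4 * (lin 1 (Suc d) z ^ 4 * quadric_GW_coeff (Suc d) z) =
     lin 1 (Suc d) z ^ 4 * (16 * lin 2 (2 * d + 1) z ^ 4 * quadric_GW_coeff d z)"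
    by (rule quadric_cancel)
  moreover have "lin 1 (Suc d) z ^ 4 \<noteq> 0" using lin_nonzero[of "Suc d" z 1] z by simp
  ultimately show ?thesis by (metis mult_left_cancel)
qed

lemma quadric_rescale:
  "(w * a) ^ 4 * x = n * (w * p) ^ 4 * y \<Longrightarrow> w ^ 4 * (a ^ 4 * x) = w ^ 4 * (n * p ^ 4 * y)" for a :: "'a::idom"
  by algebra

lemma quadric_GW_coeff_homogeneous:
  assumes z: "z \<noteq> 0"
  shows "fps_scale z (quadric_GW_coeff d z) = quadric_GW_coeff d 1"
proof (induction d)
  case (Suc d)
  have "fps_scale z (lin 1 (Suc d) z ^ 4 * quadric_GW_coeff (Suc d) z) =
     fps_scale z (16 * lin 2 (2 * d + 1) z ^ 4 * quadric_GW_coeff d z)"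
    by (simp only: quadric_GW_coeff_Suc[OF z])
  then have "fps_const z ^ 4 * (lin 1 (Suc d) 1 ^ 4 * fps_scale z (quadric_GW_coeff (Suc d) z)) =
     fps_const z ^ 4 * (16 * lin 2 (2 * d + 1) 1 ^ 4 * quadric_GW_coeff d 1)"
    unfolding fps_scale_mult fps_scale_power fps_scale_lin_homogeneous Suc numeral_fps_const fps_scale_const
    by (rule quadric_rescale)
  also have "16 * lin 2 (2 * d + 1) 1 ^ 4 * quadric_GW_coeff d 1 =
      lin 1 (Suc d) 1 ^ 4 * quadric_GW_coeff (Suc d) 1"
    by (rule quadric_GW_coeff_Suc[symmetric]) simp
  finally show ?case using z lin_nonzero[of "Suc d" 1 1] by simp
qed (simp add: quadric_GW_coeff_0)

text \<open>The coefficients of \<open>16 (2s + 1)^4 = 2^8 (s + 1/2)^4\<close>.\<close>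

definition quadric_symbol :: "nat \<Rightarrow> complex" where
  "quadric_symbol j = [16, 128, 384, 512, 256] ! j"

lemma quadric_symbol_factorization:
  "16 + 128 * s + 384 * s ^ 2 + 512 * s ^ 3 + 256 * s ^ 4 = 16 * (2 * s + 1) ^ 4" for s :: "'a::idom"
  by algebra

lemma quadric_symbol_reflection: "16 * (2 * (- s) + 1) ^ 4 = 16 * (2 * s - 1) ^ 4" for s :: "'a::idom"
  by algebra

lemma quartic_eval_quadric_symbol: "quartic_eval quadric_symbol s = 16 * (2 * s + 1) ^ 4"
proof -
  have "quartic_eval quadric_symbol s = 16 + 128 * s + 384 * s ^ 2 + 512 * s ^ 3 + 256 * s ^ 4"
    by (simp add: quartic_eval_def quadric_symbol_def eval_nat_numeral flip: numeral_fps_const)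
  then show ?thesis by (simp only: quadric_symbol_factorization)
qed

lemma quadric_GW_recurrence:
  "(fps_const (of_nat (Suc k)) + fps_X) ^ 4 * quadric_GW_coeff (Suc k) 1 =
     quartic_eval quadric_symbol (fps_const (of_nat k) + fps_X) * quadric_GW_coeff k 1"
proof -
  have "2 * (fps_const (of_nat k) + fps_X) + 1 = lin 2 (2 * k + 1) 1"
       "fps_const (of_nat (Suc k)) + fps_X = lin 1 (Suc k) 1"
    by (rule fps_ext; auto simp: lin_def fps_X_def numeral_fps_const)+
  then show ?thesis using quadric_GW_coeff_Suc[of 1 k] by (simp only: quartic_eval_quadric_symbol mult.assoc) simp
qed

lemma quadric_GW_converges: "converges_below (1 / 256) (\<lambda>k. quadric_GW_coeff k 1)"
proof (rule converges_below_ratio)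
  fix N k :: nat assume k: "k \<ge> 1"
  let ?C = "\<lambda>k. quadric_GW_coeff k 1"
  have lin: "lin c b 1 = fps_const (of_nat b) + fps_const c * fps_X" for c b by (simp add: lin_def add.commute)
  have "real k ^ 4 * fps_norm N (?C (Suc k)) \<le> fps_norm N (lin 1 (Suc k) 1 ^ 4 * ?C (Suc k))"
    using fps_norm_linear_power_lower[of 1 "of_nat (Suc k)" 4 N "?C (Suc k)"] unfolding lin norm_of_nat by simp
  also have "\<dots> = fps_norm N (fps_const 16 * (lin 2 (2 * k + 1) 1 ^ 4 * ?C k))"
    unfolding numeral_fps_const[symmetric] by (simp add: quadric_GW_coeff_Suc mult.assoc)
  also have "\<dots> \<le> 16 * ((real (2 * k + 1) + 2) ^ 4 * fps_norm N (?C k))"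
    unfolding fps_norm_const_mult lin
    using fps_norm_linear_power_upper[of N "of_nat (2 * k + 1)" 2 4 "?C k"]
    unfolding norm_of_nat by simp
  finally show "real k ^ 4 * fps_norm N (?C (Suc k)) \<le> (16 * (real (2 * k + 1) + 2) ^ 4) * fps_norm N (?C k)"
    by (simp add: mult.assoc)
next
  show "(\<lambda>k. (16 * (real (2 * k + 1) + 2) ^ 4) / real k ^ 4) \<longlonglongrightarrow> 256"
    by real_asymp
qed auto

definition quadric_hyb_coeff :: "nat \<Rightarrow> complex \<Rightarrow> complex fps" where
  "quadric_hyb_coeff d z =
     (\<Prod>b\<in>{b\<in>{1..d}. [b = d + 1] (mod 2)}. (lin 1 b z)^4) /
     (\<Prod>b\<in>{b\<in>{1..d}. \<not> [b = d + 1] (mod 2)}. (lin 1 b z)^4)"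

text \<open>Increasing \<open>d\<close> by \<open>2\<close> preserves the parity of \<open>d + 1\<close>, so the products acquire the factors with
\<open>b = d + 1\<close> and \<open>b = d + 2\<close>.\<close>

lemma quadric_hyb_coeff_step:
  assumes z: "z \<noteq> 0"
  shows "lin 1 (d + 2) z ^ 4 * quadric_hyb_coeff (d + 2) z = lin 1 (d + 1) z ^ 4 * quadric_hyb_coeff d z"
proof -
  have shift: "[b = d + 2 + 1] (mod 2) \<longleftrightarrow> [b = d + 1] (mod 2)" for b
  proof -
    have "(d + 2 + 1) mod 2 = (d + 1) mod 2" by presburger
    then show ?thesis by (simp only: cong_def)
  qed
  have ivl: "{1..d+2} = insert (d + 1) (insert (d + 2) {1..d})" by auto
  have "\<not> [d + 2 = d + 1] (mod 2)"
    unfolding cong_def by presburger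
  then have "{b\<in>{1..d+2}. [b = d + 1] (mod 2)} = insert (d + 1) {b\<in>{1..d}. [b = d + 1] (mod 2)}"
    and "{b\<in>{1..d+2}. \<not> [b = d + 1] (mod 2)} = insert (d + 2) {b\<in>{1..d}. \<not> [b = d + 1] (mod 2)}"
    unfolding ivl by auto
  then have "quadric_hyb_coeff (d + 2) z =
     ((\<Prod>b\<in>{b\<in>{1..d}. [b = d + 1] (mod 2)}. (lin 1 b z)^4) * lin 1 (d + 1) z ^ 4) /
     ((\<Prod>b\<in>{b\<in>{1..d}. \<not> [b = d + 1] (mod 2)}. (lin 1 b z)^4) * lin 1 (d + 2) z ^ 4)"
    unfolding quadric_hyb_coeff_def shift by (simp add: mult_ac)
  then show ?thesis
    unfolding quadric_hyb_coeff_def[of d]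
    by (simp only:) (rule fps_quotient_recurrence,
        use z in \<open>auto simp: fps_prod_nth_0 fps_power_zeroth simp del: of_nat_Suc of_nat_add\<close>)
qed

lemma quadric_hyb_coeff_0: "quadric_hyb_coeff 0 z = 1"
  by (simp add: quadric_hyb_coeff_def)

lemma quadric_hyb_rescale:
  "(w * p) ^ 4 * x = (w * a) ^ 4 * y \<Longrightarrow> w ^ 4 * (p ^ 4 * x) = w ^ 4 * (a ^ 4 * y)" for a :: "'a::idom"
  by algebra

lemma quadric_hyb_coeff_homogeneous:
  assumes z: "z \<noteq> 0"
  shows "fps_scale z (quadric_hyb_coeff (2 * k) z) = quadric_hyb_coeff (2 * k) 1"
proof (induction k)
  case (Suc k)
  let ?d = "2 * k"
  have "fps_scale z (lin 1 (?d + 2) z ^ 4 * quadric_hyb_coeff (?d + 2) z) =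
    fps_scale z (lin 1 (?d + 1) z ^ 4 * quadric_hyb_coeff ?d z)"
    by (simp only: quadric_hyb_coeff_step[OF z])
  then have "fps_const z ^ 4 * (lin 1 (?d + 2) 1 ^ 4 * fps_scale z (quadric_hyb_coeff (?d + 2) z)) =
     fps_const z ^ 4 * (lin 1 (?d + 1) 1 ^ 4 * quadric_hyb_coeff ?d 1)"
    unfolding fps_scale_mult fps_scale_power fps_scale_lin_homogeneous Suc by (rule quadric_hyb_rescale)
  also have "lin 1 (?d + 1) 1 ^ 4 * quadric_hyb_coeff ?d 1 = lin 1 (?d + 2) 1 ^ 4 * quadric_hyb_coeff (?d + 2) 1"
    by (rule quadric_hyb_coeff_step[symmetric]) simp
  finally have "fps_scale z (quadric_hyb_coeff (?d + 2) z) = quadric_hyb_coeff (?d + 2) 1"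
    using z lin_nonzero[of "?d + 2" 1 1] by (simp del: One_nat_def add_2_eq_Suc')
  then show ?case by simp
qed (simp add: quadric_hyb_coeff_0)

text \<open>Coefficients in the variable \<open>X\<close> with \<open>H = 2 z X\<close>, at \<open>z = 1\<close>. In this case the I-function has
a single sector, formed by the terms with \<open>d = 2 k\<close>.\<close>

definition quadric_hyb_frobenius :: "nat \<Rightarrow> complex fps" where
  "quadric_hyb_frobenius k = fps_const (1 / 2 ^ (8 * k)) * fps_scale 2 (quadric_hyb_coeff (2 * k) 1)"

lemma quadric_hyb_frobenius_Suc:
  "256 * (fps_const (of_nat (2 * k + 2)) + fps_const 2 * fps_X) ^ 4 * quadric_hyb_frobenius (Suc k) =
   (fps_const (of_nat (2 * k + 1)) + fps_const 2 * fps_X) ^ 4 * quadric_hyb_frobenius k"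
proof -
  let ?d = "2 * k"
  have "fps_scale 2 (lin 1 (?d + 2) 1 ^ 4 * quadric_hyb_coeff (?d + 2) 1) =
    fps_scale 2 (lin 1 (?d + 1) 1 ^ 4 * quadric_hyb_coeff ?d 1)"
    by (simp only: quadric_hyb_coeff_step[of 1] one_neq_zero not_False_eq_True)
  then have eq: "(fps_const (of_nat (?d + 2)) + fps_const 2 * fps_X) ^ 4 * fps_scale 2 (quadric_hyb_coeff (?d + 2) 1) =
     (fps_const (of_nat (?d + 1)) + fps_const 2 * fps_X) ^ 4 * fps_scale 2 (quadric_hyb_coeff ?d 1)"
    unfolding fps_scale_mult fps_scale_power fps_scale_lin by (simp only: mult_1_left mult_1_right)
  have d: "2 * Suc k = ?d + 2" by simp
  have c: "256 * (fps_const (1 / 2 ^ (8 * Suc k)) * F) = fps_const (1 / 2 ^ (8 * k)) * F" for F :: "complex fps"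
    by (simp only: numeral_fps_const mult.assoc[symmetric] fps_const_mult) (simp add: power_add)
  have red: "256 * X ^ 4 * quadric_hyb_frobenius (Suc k) =
      fps_const (1 / 2 ^ (8 * k)) * (X ^ 4 * fps_scale 2 (quadric_hyb_coeff (?d + 2) 1))" for X
  proof -
    have "256 * X ^ 4 * quadric_hyb_frobenius (Suc k) = 256 * (fps_const (1 / 2 ^ (8 * Suc k)) *
        (X ^ 4 * fps_scale 2 (quadric_hyb_coeff (?d + 2) 1)))"
      unfolding quadric_hyb_frobenius_def d by (simp only: mult_ac)
    then show ?thesis unfolding c .
  qed
  show ?thesis unfolding red eq by (simp only: quadric_hyb_frobenius_def mult_ac)
qed

lemma power4_of_double: "16 * (16 * x ^ 4 * y) = 256 * x ^ 4 * y" "(2 * x) ^ 4 * y = 16 * (x ^ 4 * y)" for x :: "'a::comm_ring_1"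
  by (simp_all add: power_mult_distrib mult.assoc[symmetric])

lemma quadric_hyb_recurrence:
  "quartic_eval (\<lambda>j. (- 1) ^ j * quadric_symbol j) (fps_const (of_nat (Suc k) + 1 / 2) + fps_X) *
     quadric_hyb_frobenius (Suc k) =
   (fps_const (of_nat k + 1 / 2) + fps_X) ^ 4 * quadric_hyb_frobenius k"
proof -
  let ?S = "fps_const (of_nat (Suc k) + 1 / 2) + fps_X :: complex fps"
  let ?T = "fps_const (of_nat k + 1 / 2) + fps_X :: complex fps"
  have S: "2 * ?S - 1 = fps_const (of_nat (2 * k + 2)) + fps_const 2 * fps_X"
    "2 * ?T = fps_const (of_nat (2 * k + 1)) + fps_const 2 * fps_X"
    by (rule fps_ext; auto simp: fps_X_def numeral_fps_const field_simps)+
  \<comment> \<open>The factor \<open>16 = 2^4\<close> clears the denominators of the exponents in the fourth power on the right.\<close>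
  have "16 * (16 * (2 * ?S - 1) ^ 4 * quadric_hyb_frobenius (Suc k)) = (2 * ?T) ^ 4 * quadric_hyb_frobenius k"
    using quadric_hyb_frobenius_Suc[of k] unfolding S[symmetric] power4_of_double(1) .
  also have "\<dots> = 16 * (?T ^ 4 * quadric_hyb_frobenius k)" by (rule power4_of_double(2))
  finally show ?thesis unfolding quartic_eval_reflect quartic_eval_quadric_symbol quadric_symbol_reflection
    by (rule mult_left_cancel[THEN iffD1, rotated]) (rule numeral_neq_zero)
qed

lemma quadric_hyb_converges: "converges_below 256 quadric_hyb_frobenius"
proof -
  have "converges_below (1 / (1 / 256)) quadric_hyb_frobenius"
  proof (rule converges_below_ratio)
    fix N k :: nat assume k: "k \<ge> 1"
    let ?F = "quadric_hyb_frobenius"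
    define u where "u = (\<lambda>b. fps_const (of_nat b) + fps_const (2 :: complex) * fps_X)"
    have low: "(real b - 2) ^ 4 * fps_norm N f \<le> fps_norm N (u b ^ 4 * f)" if "b \<ge> 2" for b f
      using fps_norm_linear_power_lower[of 2 "of_nat b" 4 N f] that unfolding u_def norm_of_nat by simp
    let ?p = "2 * k + 2"
    have "256 * ((real ?p - 2) ^ 4 * fps_norm N (?F (Suc k))) \<le> 256 * fps_norm N (u ?p ^ 4 * ?F (Suc k))"
      by (intro mult_left_mono low) auto
    also have "\<dots> = fps_norm N (256 * u ?p ^ 4 * ?F (Suc k))"
      unfolding mult.assoc numeral_fps_const fps_norm_const_mult by simp
    also have "\<dots> = fps_norm N (u (2 * k + 1) ^ 4 * ?F k)"
      by (simp only: quadric_hyb_frobenius_Suc u_def)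
    also have "\<dots> \<le> (real (2 * k + 1) + 2) ^ 4 * fps_norm N (?F k)"
      using fps_norm_linear_power_upper[of N "of_nat (2 * k + 1)" 2 4 "?F k"]
      unfolding u_def norm_of_nat by simp
    finally show "(256 * (real ?p - 2) ^ 4) * fps_norm N (?F (Suc k)) \<le>
        (real (2 * k + 1) + 2) ^ 4 * fps_norm N (?F k)"
      by (simp only: mult.assoc)
    show "256 * (real ?p - 2) ^ 4 > 0" using k by simp
  next
    show "(\<lambda>k. (real (2 * k + 1) + 2) ^ 4 / (256 * (real (2 * k + 2) - 2) ^ 4)) \<longlonglongrightarrow> 1 / 256"
      by real_asymp
  qed simp
  then show ?thesis by simp
qed

text \<open>The exponent \<open>1/2\<close> at infinity is a fourfold root of the indicial polynomial, so that all four
solutions belong to one sector.\<close>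

lemma quadric_hyb_head:
  assumes "l \<le> 3"
  shows "fps_nth (quartic_eval (\<lambda>j. (- 1) ^ j * quadric_symbol j)
      (fps_const (1 / 2) + fps_X) * quadric_hyb_frobenius 0) l = 0"
proof -
  have "2 * (fps_const (1 / 2) + fps_X) - 1 = (2 * fps_X :: complex fps)"
    by (rule fps_ext) (auto simp: fps_X_def numeral_fps_const)
  moreover have "16 * (2 * fps_X) ^ 4 * F = fps_X ^ 4 * (256 * F)" for F :: "complex fps"
    by (simp add: power_mult_distrib mult_ac)
  ultimately show ?thesis
    unfolding quartic_eval_reflect quartic_eval_quadric_symbol quadric_symbol_reflection
    using assms by (simp only:) (simp add: fps_X_power_mult_nth)
qed

lemma quadric_I_hyb_eq_frobenius_series:
  assumes z: "z \<noteq> 0" and t: "cmod (exp (2 * t)) < 256"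
  shows "quadric_I_hyb t z $ i = z / (2 * z) ^ hexp i *
    fps_nth (frobenius_series (1 / 2) quadric_hyb_frobenius (2 * t)) (hexp i)"
proof -
  have "suminf (\<lambda>d. if [d + 1 = 1] (mod 2) then fps_nth (quadric_hyb_term d t z) (hexp i) else 0) =
    z * 1 / (of_nat 2 * z) ^ hexp i *
      fps_nth (frobenius_series (of_nat (0 + 1) / of_nat 2) quadric_hyb_frobenius (of_nat 2 * t)) (hexp i)"
  proof (rule hybrid_series_eq_frobenius_series[OF quadric_hyb_converges _ _ z,
        where R = "\<lambda>d. quadric_hyb_coeff d z" and w = "\<lambda>k. 2 ^ (8 * k)" and s = 0])
    show "fps_scale (of_nat 2 * z) (quadric_hyb_coeff (2 * k + 0) z) =
        fps_const (2 ^ (8 * k) * 1) * quadric_hyb_frobenius k" for k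
    proof -
      have "fps_scale (of_nat 2 * z) (quadric_hyb_coeff (2 * k + 0) z) =
          fps_scale 2 (fps_scale z (quadric_hyb_coeff (2 * k) z))" by (simp add: fps_scale_scale)
      also have "\<dots> = fps_scale 2 (quadric_hyb_coeff (2 * k) 1)"
        by (simp only: quadric_hyb_coeff_homogeneous[OF z])
      also have "\<dots> = fps_const (2 ^ (8 * k) * 1) * quadric_hyb_frobenius k"
        unfolding quadric_hyb_frobenius_def by (simp only: mult.assoc[symmetric] fps_const_mult) simp
      finally show ?thesis .
    qed
    show "[d + 1 = 1] (mod 2) \<longleftrightarrow> d \<in> range (\<lambda>k. 2 * k + 0)" for d :: nat
      using residue_class_eq_range[of 0 2 d] by simp
    show "quadric_hyb_term (2 * k + 0) t z = fps_const (z * exp (of_nat (2 * k + 0 + 1) * t) / 2 ^ (8 * k)) *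
        fps_exp (t / z) * quadric_hyb_coeff (2 * k + 0) z" for k
    proof -
      have "(2 * k + 0) div 2 = k" by simp
      then show ?thesis by (simp only: quadric_hyb_term_def quadric_hyb_coeff_def)
    qed
  qed (use t in auto)
  then show ?thesis by (simp add: quadric_I_hyb_def)
qed

lemma hexp_bij: "bij_betw hexp UNIV {..<4}"
  by (auto simp: bij_betw_def inj_on_def UNIV_hpow lessThan_nat_numeral lessThan_Suc)

lemma hexp_dominance:
  assumes "hexp i < hexp k"
  shows "((\<lambda>t::real. (exp (1 / 2 * t) * t ^ hexp i) / (exp (1 / 2 * t) * t ^ hexp k)) \<longlongrightarrow> 0) at_bot"
proof -
  have "(i, k) \<in> {(Pow0, Pow1), (Pow0, Pow2), (Pow0, Pow3), (Pow1, Pow2), (Pow1, Pow3), (Pow2, Pow3)}"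
    using assms by (cases i; cases k) simp_all
  then show ?thesis
    by (elim insertE emptyE; clarsimp simp only: prod.inject hexp.simps; real_asymp)
qed

lemma quadric_transformation:
  assumes \<gamma>: "continuation_path (1 / 2 ^ 8) \<gamma>" and lg: "log_branch_at lg (pathstart \<gamma>)"
  shows "\<exists>U :: H_hyb_quadric \<Rightarrow> H_GW_laurent. degree_preserving_linear hpow_deg U \<and>
    (\<forall>z. z \<noteq> 0 \<longrightarrow> (\<exists>G. continuation_along_vec \<gamma> (\<lambda>q. quadric_I_GW lg q z) G \<and>
       (\<forall>\<^sub>F t in nhds 0. eval_at z (U (quadric_I_hyb t z)) = G (inverse (exp (2 * t))))))"
proof -
  let ?v = "\<lambda>i x. fps_nth (frobenius_series (of_real (1 / 2)) quadric_hyb_frobenius x) (hexp i)"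
  let ?w = "\<lambda>h q. fps_nth (frobenius_series 0 (\<lambda>k. quadric_GW_coeff k 1) (lg q)) (hexp h)"
  have \<gamma>': "continuation_path (1 / 256) \<gamma>" using \<gamma> by simp
  show ?thesis
  proof (rule transformation_from_connection[where e = "\<lambda>i. int (hexp i)"
        and k = "\<lambda>i. 1 / 2 ^ hexp i" and v = ?v and w = ?w])
    show "hpow_deg i = 2 * int (hexp i)" for i by (simp add: hpow_deg_def)
  next
    fix z :: complex assume z: "z \<noteq> 0"
    have "\<forall>\<^sub>F t in nhds 0. cmod (exp (2 * t)) < 256" by (rule eventually_cmod_exp_less) simp
    then show "\<forall>\<^sub>F t in nhds 0. \<forall>i. quadric_I_hyb t z $ i =
        z powi (1 - int (hexp i)) * (1 / 2 ^ hexp i) * ?v i (2 * t)"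
    proof eventually_elim
      case (elim t)
      have "z / (2 * z) ^ hexp i = z powi (1 - int (hexp i)) * (1 / 2 ^ hexp i)" for i
        using z by (simp add: power_int_diff field_simps)
      then show ?case using quadric_I_hyb_eq_frobenius_series[OF z elim] by simp
    qed
    show "\<forall>\<^sub>F q in nhds (pathstart \<gamma>). \<forall>h. quadric_I_GW lg q z $ h = z powi (1 - int (hexp h)) * ?w h q"
      using continuation_path_start[OF \<gamma>' lg]
    proof eventually_elim
      case (elim q)
      then show ?case
        unfolding quadric_I_GW_def
        using GW_series_eq_frobenius_series[OF quadric_GW_converges quadric_GW_coeff_homogeneous[OF z] z] by simp
    qed
  next
    fix h
    show "\<exists>G c. continuation_along \<gamma> (?w h) G \<and>
        (\<forall>\<^sub>F x in nhds 0. G (exp (- x)) = (\<Sum>i\<in>UNIV. c i * ?v i x))"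
    proof (rule frobenius_series_connection[where b = quadric_symbol and \<kappa> = 256 and rk = hexp])
      show "quartic_eval (\<lambda>j. (- 1) ^ j * quadric_symbol j)
           (fps_const (of_nat (Suc k) + complex_of_real (1 / 2)) + fps_X) * quadric_hyb_frobenius (Suc k) =
         (fps_const (of_nat k + complex_of_real (1 / 2)) + fps_X) ^ 4 * quadric_hyb_frobenius k" for k
        using quadric_hyb_recurrence[of k] by simp
      show "fps_nth (quartic_eval (\<lambda>j. (- 1) ^ j * quadric_symbol j)
           (fps_const (complex_of_real (1 / 2)) + fps_X) * quadric_hyb_frobenius 0) l = 0" if "l \<le> hexp i" for i l
        using quadric_hyb_head[of l] that hexp_less[of i] by simp
      show "quadric_symbol 4 = complex_of_real 256" by (simp add: quadric_symbol_def)
      show "fps_nth (quadric_hyb_frobenius 0) 0 \<noteq> 0"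
        by (simp add: quadric_hyb_frobenius_def quadric_hyb_coeff_0)
      show "((\<lambda>t::real. exp (1 / 2 * t) * t ^ hexp i / (exp (1 / 2 * t) * t ^ hexp k)) \<longlongrightarrow> 0) at_bot"
        if "hexp i < hexp k" for i k by (rule hexp_dominance[OF that])
      show "(fps_const (of_nat (Suc k)) + fps_X) ^ 4 * quadric_GW_coeff (Suc k) 1 =
          quartic_eval quadric_symbol (fps_const (of_nat k) + fps_X) * quadric_GW_coeff k 1" for k
        by (rule quadric_GW_recurrence)
    qed (use \<gamma>' lg in \<open>auto intro: quadric_GW_converges quadric_hyb_converges hexp_bij hexp_less\<close>)
  qed auto
qed

theorem corollary1p1p2:
  shows
    "(\<forall>\<gamma> lg. continuation_path (1 / 3^6) \<gamma> \<and> log_branch_at lg (pathstart \<gamma>) \<longrightarrow>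
       (\<exists>U :: H_hyb_cubic \<Rightarrow> H_GW_laurent.
          degree_preserving_linear cubic_deg U \<and>
          (\<forall>z. z \<noteq> 0 \<longrightarrow>
             (\<exists>G. continuation_along_vec \<gamma> (\<lambda>q. cubic_I_GW lg q z) G \<and>
                  (\<forall>\<^sub>F t in nhds 0.
                     eval_at z (U (cubic_I_hyb t z)) = G (inverse (exp (3 * t))))))))
     \<and>
     (\<forall>\<gamma> lg. continuation_path (1 / 2^8) \<gamma> \<and> log_branch_at lg (pathstart \<gamma>) \<longrightarrow>
       (\<exists>U :: H_hyb_quadric \<Rightarrow> H_GW_laurent.
          degree_preserving_linear hpow_deg U \<and>
          (\<forall>z. z \<noteq> 0 \<longrightarrow>
             (\<exists>G. continuation_along_vec \<gamma> (\<lambda>q. quadric_I_GW lg q z) G \<and>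
                  (\<forall>\<^sub>F t in nhds 0.
                     eval_at z (U (quadric_I_hyb t z)) = G (inverse (exp (2 * t))))))))"
  using cubic_transformation quadric_transformation by blast

end
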